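(* Let $\hat{\mathbf M}\in\mathbb R^{m\times n}$ be a given (deterministic) matrix with singular values $\hat\sigma_1\ge\hat\sigma_2\ge\cdots$, let $1\le k\le\min\{m,n\}$ with $\hat\sigma_k>0$, and let $\hat{\mathbf U}_g^{(k)}$ be the output of RSVD applied to $\hat{\mathbf M}$ with parameters $k$, $g$ and $\tilde k$, where $$n\ \ge\ \tilde k\ \ge\ (1-c_{\mathrm{gap}})^{-2}\bigl\{k+(8k\log(1/\vartheta))^{1/2}+2\log(1/\vartheta)\bigr\}$$ and $c_{\mathrm{gap}}\in(0,1)$, $\vartheta\in(0,1)$ are arbitrary. Let $\tilde g=g$ if $\hat{\mathbf M}$ is symmetric and $\tilde g=2g+1$ otherwise. Let $|||\cdot|||$ be any unitarily invariant norm. Then for every integer $g\ge1$, with probability at least $1-\vartheta-2e^{-n/2}$, $$|||\sin\Theta(\hat{\mathbf U}_g^{(k)},\hat{\mathbf U}^{(k)})|||=|||(\mathbf I-\hat{\mathbf U}_g^{(k)}\hat{\mathbf U}_g^{(k)\top})\hat{\mathbf U}^{(k)}|||\le\frac{3\,n^{1/2}\,|||(\hat{\boldsymbol\Sigma}_\perp^{(k)})^{\tilde g}|||}{c_{\mathrm{gap}}\,\tilde k^{1/2}\,\hat\sigma_k^{\tilde g}}.$$ In particular, with $\hat\zeta_k=\hat\sigma_{k+1}/\hat\sigma_k$, with probability at least $1-\vartheta-2e^{-n/2}$, $$d_2(\hat{\mathbf U}_g^{(k)},\hat{\mathbf U}^{(k)})\le\sqrt2\,\|\sin\Theta(\hat{\mathbf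 U}_g^{(k)},\hat{\mathbf U}^{(k)})\|\le\frac{3\sqrt2\,n^{1/2}}{c_{\mathrm{gap}}\,\tilde k^{1/2}}\,\hat\zeta_k^{\tilde g}.$$
   Context: Notation: $\|\cdot\|$ is the spectral norm. For $\mathbf U_1,\mathbf U_2$ with $d$ orthonormal columns, $d_2(\mathbf U_1,\mathbf U_2)=\inf_{\mathbf W}\|\mathbf U_1-\mathbf U_2\mathbf W\|$, the infimum over $d\times d$ orthogonal matrices $\mathbf W$, and $\sin\Theta(\mathbf U_1,\mathbf U_2)$ is the diagonal matrix of the singular values of $(\mathbf I-\mathbf U_1\mathbf U_1^\top)\mathbf U_2$. Unitarily invariant norms are understood, as usual, as given by a symmetric gauge function of the singular values, so that they apply to matrices of all sizes (appending zero singular values does not change the norm). SVD: $\hat{\mathbf M}=\hat{\mathbf U}^{(k)}\hat{\boldsymbol\Sigma}^{(k)}\hat{\mathbf V}^{(k)\top}+\hat{\mathbf U}^{(k)}_\perp\hat{\boldsymbol\Sigma}^{(k)}_\perp\hat{\mathbf V}^{(k)\top}_\perp$, where $\hat{\boldsymbol\Sigma}^{(k)}$ is diagonal with the $k$ largest singular values, $\hat{\mathbf U}^{(k)}\in\mathbb R^{m\times k}$ and $\hat{\mathbf V}^{(k)}\in\mathbb R^{n\times k}$ contain the corresponding left and right singular vectors, and $\hat{\boldsymbol\Sigma}^{(k)}_\perp$ is diagonal with the remaining singular values. ($\hat\sigma_{k+1}=0$ if $k=\min\{m,n\}$.) RSVD with rank $k$, sketching dimension $\tilde k\ge k$ and power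 $g\ge1$ (an integer): draw $\mathbf G\in\mathbb R^{n\times\tilde k}$ with i.i.d. standard normal entries; form $\mathbf Y_g=\hat{\mathbf M}^g\mathbf G$ if $\hat{\mathbf M}$ is symmetric and $\mathbf Y_g=\hat{\mathbf M}(\hat{\mathbf M}^\top\hat{\mathbf M})^g\mathbf G$ otherwise; $\hat{\mathbf U}_g^{(k)}$ is the $m\times k$ matrix whose orthonormal columns are the $k$ leading left singular vectors of $\mathbf Y_g$. Probability is with respect to $\mathbf G$. *)

theory Defs
  imports "HOL-Probability.Probability" "Jordan_Normal_Form.Char_Poly"
begin

section \<open>Singular values and the singular value decomposition\<close>

text \<open>
  The square roots of the eigenvalues of \<open>A\<^sup>T A\<close>, with multiplicity and in decreasing order. The
  list has \<open>dim_col A\<close> entries; those beyond the first \<open>min (dim_row A) (dim_col A)\<close> are zero.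
\<close>

definition singular_values :: "real mat \<Rightarrow> real list" where
  "singular_values A =
     rev (sorted_list_of_multiset (image_mset sqrt (proots (char_poly (A\<^sup>T * A)))))"

text \<open>The \<open>i\<close>-th largest singular value, counting from 1, and zero past the end of the list.\<close>

definition sing_val :: "real mat \<Rightarrow> nat \<Rightarrow> real" where
  "sing_val A i =
     (if 1 \<le> i \<and> i \<le> length (singular_values A) then singular_values A ! (i - 1) else 0)"

definition orthonormal_cols :: "real mat \<Rightarrow> bool" where
  "orthonormal_cols U \<longleftrightarrow> U\<^sup>T * U = 1\<^sub>m (dim_col U)"

text \<open>
  \<open>M = U \<Sigma> V\<^sup>T + U' \<Sigma>' V'\<^sup>T\<close> is a singular value decomposition of \<open>M\<close> whose first summand carries
  the \<open>k\<close> largest singular values. The second summand carries the remaining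
  \<open>min m n - k\<close> of them, so that \<open>\<Sigma>'\<close> is square. As usual, the singular vectors need not be
  unique; the predicate holds for every admissible choice.
\<close>

definition svd_split ::
  "nat \<Rightarrow> real mat \<Rightarrow> real mat \<Rightarrow> real mat \<Rightarrow> real mat \<Rightarrow> real mat \<Rightarrow> real mat \<Rightarrow> real mat \<Rightarrow> bool"
where
  "svd_split k M U S V U' S' V' \<longleftrightarrow>
     (let m = dim_row M; n = dim_col M; r = min m n - k in
       k \<le> min m n \<and>
       U \<in> carrier_mat m k \<and> V \<in> carrier_mat n k \<and>
       U' \<in> carrier_mat m r \<and> V' \<in> carrier_mat n r \<and>
       orthonormal_cols U \<and> orthonormal_cols U' \<and> U\<^sup>T * U' = 0\<^sub>m k r \<and>
       orthonormal_cols V \<and> orthonormal_cols V' \<and> V\<^sup>T * V' = 0\<^sub>m k r \<and>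
       S = mat_diag k (\<lambda>i. sing_val M (i + 1)) \<and>
       S' = mat_diag r (\<lambda>i. sing_val M (k + i + 1)) \<and>
       M = U * S * V\<^sup>T + U' * S' * V'\<^sup>T)"

definition leading_left_singular_vectors :: "nat \<Rightarrow> real mat \<Rightarrow> real mat \<Rightarrow> bool" where
  "leading_left_singular_vectors k Y U \<longleftrightarrow> (\<exists>S V U' S' V'. svd_split k Y U S V U' S' V')"

section \<open>Norms and subspace distances\<close>

definition spectral_norm :: "real mat \<Rightarrow> real" where
  "spectral_norm A = sing_val A 1"

text \<open>
  Symmetric gauge functions on finitely supported sequences. Using sequences instead of
  tuples of a fixed length gives one norm for matrices of all sizes, invariant under
  appending zero singular values. No normalization is imposed.
\<close>

definition symmetric_gauge :: "((nat \<Rightarrow> real) \<Rightarrow> real) \<Rightarrow> bool" where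
  "symmetric_gauge \<Phi> \<longleftrightarrow>
     (\<forall>x. finite {i. x i \<noteq> 0} \<longrightarrow>
        (x \<noteq> (\<lambda>_. 0) \<longrightarrow> \<Phi> x > 0) \<and>
        (\<forall>c. \<Phi> (\<lambda>i. c * x i) = \<bar>c\<bar> * \<Phi> x) \<and>
        (\<forall>y. finite {i. y i \<noteq> 0} \<longrightarrow> \<Phi> (\<lambda>i. x i + y i) \<le> \<Phi> x + \<Phi> y) \<and>
        (\<forall>\<pi>. bij \<pi> \<longrightarrow> \<Phi> (x \<circ> \<pi>) = \<Phi> x) \<and>
        (\<forall>s. (\<forall>i. s i = 1 \<or> s i = -1) \<longrightarrow> \<Phi> (\<lambda>i. s i * x i) = \<Phi> x))"

definition ui_norm :: "((nat \<Rightarrow> real) \<Rightarrow> real) \<Rightarrow> real mat \<Rightarrow> real" where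
  "ui_norm \<Phi> A = \<Phi> (\<lambda>i. sing_val A (i + 1))"

definition sin_Theta :: "real mat \<Rightarrow> real mat \<Rightarrow> real mat" where
  "sin_Theta U1 U2 =
     mat_diag (dim_col U2) (\<lambda>i. sing_val ((1\<^sub>m (dim_row U1) - U1 * U1\<^sup>T) * U2) (i + 1))"

text \<open>
  \<open>orthogonal_mat\<close> of the matrix library does not ask for columns of length one and is
  therefore not used here.
\<close>

definition d2 :: "real mat \<Rightarrow> real mat \<Rightarrow> real" where
  "d2 U1 U2 =
     (INF W \<in> {W \<in> carrier_mat (dim_col U2) (dim_col U2). orthonormal_cols W}.
        spectral_norm (U1 - U2 * W))"

section \<open>Randomized singular value decomposition\<close>

definition std_gaussian_matrix :: "'w measure \<Rightarrow> nat \<Rightarrow> nat \<Rightarrow> ('w \<Rightarrow> real mat) \<Rightarrow> bool" where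
  "std_gaussian_matrix P m n G \<longleftrightarrow>
     prob_space P \<and>
     (\<forall>\<omega>\<in>space P. G \<omega> \<in> carrier_mat m n) \<and>
     prob_space.indep_vars P (\<lambda>_. borel) (\<lambda>(i, j) \<omega>. G \<omega> $$ (i, j)) ({..<m} \<times> {..<n}) \<and>
     (\<forall>i<m. \<forall>j<n. distributed P lborel (\<lambda>\<omega>. G \<omega> $$ (i, j)) std_normal_density)"

definition symmetric_mat :: "real mat \<Rightarrow> bool" where
  "symmetric_mat A \<longleftrightarrow> A\<^sup>T = A"

definition rsvd_sketch :: "nat \<Rightarrow> real mat \<Rightarrow> real mat \<Rightarrow> real mat" where
  "rsvd_sketch g M G =
     (if symmetric_mat M then (M ^\<^sub>m g) * G else M * ((M\<^sup>T * M) ^\<^sub>m g) * G)"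

definition rsvd_output :: "nat \<Rightarrow> nat \<Rightarrow> real mat \<Rightarrow> real mat \<Rightarrow> real mat \<Rightarrow> bool" where
  "rsvd_output k g M G U \<longleftrightarrow> leading_left_singular_vectors k (rsvd_sketch g M G) U"

text \<open>
  Since singular vectors may be selected arbitrarily, \<open>{\<omega> \<in> space P. Q \<omega>}\<close> need not be measurable;
  hence the probability is bounded from below on a measurable event contained in that set.
\<close>

definition with_prob_at_least :: "'w measure \<Rightarrow> real \<Rightarrow> ('w \<Rightarrow> bool) \<Rightarrow> bool" where
  "with_prob_at_least P p Q \<longleftrightarrow> (\<exists>E\<in>sets P. measure P E \<ge> p \<and> (\<forall>\<omega>\<in>E. Q \<omega>))"

end

theory Submission
  imports Defs "HOL-Real_Asymp.Real_Asymp" "HOL-Combinatorics.List_Permutation"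
begin

text \<open>
  Write the sketch as \<open>Y = U D \<Omega>\<^sub>1 + U' D' \<Omega>\<^sub>2\<close> with \<open>D = \<Sigma>\<^sub>k\<^sup>g\<close>, \<open>D' = \<Sigma>\<^sub>\<bottom>\<^sup>g\<close> and \<open>\<Omega>\<^sub>1 = W\<^sup>T G\<close>, \<open>\<Omega>\<^sub>2 = W'\<^sup>T G\<close>.
  If \<open>Y V = Uh S\<close> is the leading part of the singular value decomposition of \<open>Y\<close>, then
  \<open>(1 - U U\<^sup>T) Uh = U' D' \<Omega>\<^sub>2 V S\<inverse>\<close>, and the two products \<open>(1 - U U\<^sup>T) Uh\<close> and \<open>(1 - Uh Uh\<^sup>T) U\<close> have
  the same singular values. Hence the sines are bounded one by one by the entries of \<open>D'\<close> times
  \<open>\<parallel>G\<parallel> / \<sigma>\<^sub>k(Y)\<close>, and \<open>\<sigma>\<^sub>k(Y) \<ge> \<sigma>\<^sub>k(U\<^sup>T Y) \<ge> \<sigma>\<^sub>k\<^sup>g \<sigma>\<^sub>m\<^sub>i\<^sub>n(\<Omega>\<^sub>1)\<close>; symmetric gauges are monotone.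

  The sharp tails of \<open>\<parallel>G\<parallel>\<close> and \<open>\<sigma>\<^sub>m\<^sub>i\<^sub>n(\<Omega>\<^sub>1)\<close> come from Gordon's inequality applied to exponential
  moments: with independent \<open>\<gamma>\<close>, \<open>h\<close>, \<open>g\<close> standard Gaussian,
  \<open>E exp (- l (\<sigma>\<^sub>m\<^sub>i\<^sub>n + \<gamma>)) \<le> E exp (- l \<parallel>h\<parallel>) E exp (l \<parallel>g\<parallel>)\<close>. The left side has the
  factor \<open>exp (l\<^sup>2 / 2)\<close> and each factor on the right is at most \<open>exp (l\<^sup>2 / 2)\<close> times the exponential
  of its mean, so no concentration inequality in high dimension is needed.
\<close>

text \<open>The hypothesis on the sketch size says exactly that
  \<open>sqrt k + t \<le> (1 - c) * sqrt kt\<close> with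
  \<open>t = sqrt (2 * ln (1 / \<theta>))\<close>. So the smallest singular value must stay above
  \<open>sqrt N - sqrt k - t\<close> with failure probability \<open>exp (- t\<^sup>2 / 2)\<close>,
  and there is no constant to lose. The exponential comparison centres the tail at a difference of
  two chi means instead; that this difference is at least \<open>sqrt N - sqrt k\<close> is a sharp
  statement about \<open>chi_mean\<close> and needs a bound of its own. In the exponent the right
  side contributes \<open>l\<^sup>2\<close> and the extra variable \<gamma> takes half of it back,
  so that \<open>\<bar>l\<bar> = t\<close> gives the rate \<open>- t\<^sup>2 / 2\<close>. The
  comparison runs over finite sets of directions, but its bound does not depend on their number. It
  therefore passes to a countable dense set of directions, and by homogeneity and continuity to all.
  The good event is expressed through \<open>G\<close> alone. On it the estimate is deterministic
  and holds for every admissible choice of singular vectors.\<close>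

unbundle no inner_syntax and no vec_syntax


section \<open>Spectral decomposition of real symmetric matrices\<close>

text \<open>Only the first \<open>r\<close> values of \<open>q\<close> matter, so a partial
  orthonormal family is enlarged by a function update and keeps its type.\<close>

definition orthofam :: "nat \<Rightarrow> nat \<Rightarrow> (nat \<Rightarrow> real vec) \<Rightarrow> bool" where
  "orthofam n r q \<longleftrightarrow>
     (\<forall>i<r. q i \<in> carrier_vec n) \<and> (\<forall>i<r. \<forall>j<r. q i \<bullet> q j = (if i = j then 1 else 0))"

definition fam_mat :: "nat \<Rightarrow> nat \<Rightarrow> (nat \<Rightarrow> real vec) \<Rightarrow> real mat" where
  "fam_mat n r q = mat n r (\<lambda>(i, j). q j $ i)"

lemma fam_mat_carrier [simp]: "fam_mat n r q \<in> carrier_mat n r"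
  by (simp add: fam_mat_def)

lemma dim_fam_mat [simp]: "dim_row (fam_mat n r q) = n" "dim_col (fam_mat n r q) = r"
  by (simp_all add: fam_mat_def)

lemma col_fam_mat: "j < r \<Longrightarrow> q j \<in> carrier_vec n \<Longrightarrow> col (fam_mat n r q) j = q j"
  by (intro eq_vecI) (auto simp: fam_mat_def)

lemma scalar_prod_self_nonneg: "(v :: real vec) \<bullet> v \<ge> 0"
  by (auto simp: scalar_prod_def intro!: sum_nonneg)

lemma scalar_prod_self_eq_0:
  assumes "(v :: real vec) \<in> carrier_vec n"
  shows "v \<bullet> v = 0 \<longleftrightarrow> v = 0\<^sub>v n"
  using assms by (auto simp: scalar_prod_def sum_nonneg_eq_0_iff vec_eq_iff)

lemma scalar_prod_self_pos:
  assumes "(v :: real vec) \<in> carrier_vec n" "v \<noteq> 0\<^sub>v n"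
  shows "v \<bullet> v > 0"
  using scalar_prod_self_eq_0[OF assms(1)] scalar_prod_self_nonneg[of v] assms(2) by linarith

lemma scalar_prod_mult_mat_vec:
  assumes "(A :: real mat) \<in> carrier_mat p n" "x \<in> carrier_vec n" "y \<in> carrier_vec p"
  shows "(A *\<^sub>v x) \<bullet> y = x \<bullet> (A\<^sup>T *\<^sub>v y)"
proof -
  have "(A *\<^sub>v x) \<bullet> y = y \<bullet> (A *\<^sub>v x)"
    using assms by (intro comm_scalar_prod[of _ p]) auto
  also have "\<dots> = (A\<^sup>T *\<^sub>v y) \<bullet> x" by (rule transpose_vec_mult_scalar[OF assms, symmetric])
  also have "\<dots> = x \<bullet> (A\<^sup>T *\<^sub>v y)"
    using assms by (intro comm_scalar_prod[of _ n]) auto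
  finally show ?thesis .
qed

lemma scalar_prod_mult_mat_vec_self:
  assumes "(A :: real mat) \<in> carrier_mat p n" "x \<in> carrier_vec n"
  shows "(A *\<^sub>v x) \<bullet> (A *\<^sub>v x) = x \<bullet> ((A\<^sup>T * A) *\<^sub>v x)"
proof -
  have "(A *\<^sub>v x) \<bullet> (A *\<^sub>v x) = x \<bullet> (A\<^sup>T *\<^sub>v (A *\<^sub>v x))"
    using assms by (intro scalar_prod_mult_mat_vec) auto
  also have "A\<^sup>T *\<^sub>v (A *\<^sub>v x) = (A\<^sup>T * A) *\<^sub>v x"
    using assms by (intro assoc_mult_mat_vec[symmetric, of _ n p _ n]) auto
  finally show ?thesis .
qed

lemma orthonormal_cols_isometry:
  assumes "Q \<in> carrier_mat p n" "Q\<^sup>T * Q = 1\<^sub>m n" "x \<in> carrier_vec n" "y \<in> carrier_vec n"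
  shows "(Q *\<^sub>v x) \<bullet> (Q *\<^sub>v y) = x \<bullet> (y :: real vec)"
proof -
  have "(Q *\<^sub>v x) \<bullet> (Q *\<^sub>v y) = x \<bullet> (Q\<^sup>T *\<^sub>v (Q *\<^sub>v y))"
    using assms by (intro scalar_prod_mult_mat_vec) auto
  also have "Q\<^sup>T *\<^sub>v (Q *\<^sub>v y) = (Q\<^sup>T * Q) *\<^sub>v y"
    using assms by (intro assoc_mult_mat_vec[symmetric, of _ n p _ n]) auto
  finally show ?thesis using assms by simp
qed

text \<open>Padding \<open>A\<close> with zero rows gives a square matrix \<open>B\<close> whose row
  \<open>r\<close> vanishes. Then \<open>B\<^sup>T\<close> kills a unit vector, both determinants
  are 0, and \<open>B\<close> has a kernel vector, which \<open>A\<close> kills as well.\<close>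

lemma homogeneous_system_nontrivial:
  fixes A :: "'a :: field mat"
  assumes A: "A \<in> carrier_mat r n" and "r < n"
  shows "\<exists>x\<in>carrier_vec n. x \<noteq> 0\<^sub>v n \<and> A *\<^sub>v x = 0\<^sub>v r"
proof -
  define B where "B = mat n n (\<lambda>(i, j). if i < r then A $$ (i, j) else 0)"
  have B: "B \<in> carrier_mat n n" by (simp add: B_def)
  have "B\<^sup>T *\<^sub>v unit_vec n r = 0\<^sub>v n"
    using \<open>r < n\<close> by (intro eq_vecI) (auto simp: B_def scalar_prod_def unit_vec_def intro!: sum.neutral)
  moreover have "unit_vec n r \<noteq> (0\<^sub>v n :: 'a vec)"
    using \<open>r < n\<close> by (metis index_unit_vec(2) index_zero_vec(1) zero_neq_one)
  ultimately have "\<exists>v. v \<in> carrier_vec n \<and> v \<noteq> 0\<^sub>v n \<and> B\<^sup>T *\<^sub>v v = 0\<^sub>v n"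
    by (intro exI[of _ "unit_vec n r"]) auto
  then have "det (B\<^sup>T) = 0"
    using B det_0_iff_vec_prod_zero_field[of "B\<^sup>T" n] by auto
  then have "det B = 0" using B by (simp add: det_transpose)
  then obtain x where x: "x \<in> carrier_vec n" "x \<noteq> 0\<^sub>v n" "B *\<^sub>v x = 0\<^sub>v n"
    using B det_0_iff_vec_prod_zero_field by blast
  have "A *\<^sub>v x = 0\<^sub>v r"
  proof (intro eq_vecI)
    fix i assume i: "i < dim_vec (0\<^sub>v r :: 'a vec)"
    have "(A *\<^sub>v x) $ i = (B *\<^sub>v x) $ i"
      using A x(1) i \<open>r < n\<close> by (simp add: B_def scalar_prod_def)
    then show "(A *\<^sub>v x) $ i = 0\<^sub>v r $ i" using x i \<open>r < n\<close> by simp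
  qed (use A in auto)
  with x show ?thesis by blast
qed

text \<open>The dimension count behind the min-max arguments and the extension of orthonormal
  families: fewer than \<open>n\<close> linear conditions leave a unit vector free.\<close>

lemma orthogonal_vector_exists:
  assumes "\<And>i. i < r \<Longrightarrow> f i \<in> carrier_vec n" and "r < n"
  shows "\<exists>x\<in>carrier_vec n. x \<bullet> x = (1 :: real) \<and> (\<forall>i<r. f i \<bullet> x = 0)"
proof -
  have "(fam_mat n r f)\<^sup>T \<in> carrier_mat r n" by simp
  from homogeneous_system_nontrivial[OF this \<open>r < n\<close>] obtain x where
    x: "x \<in> carrier_vec n" "x \<noteq> 0\<^sub>v n" "(fam_mat n r f)\<^sup>T *\<^sub>v x = 0\<^sub>v r" by blast
  have f: "f i \<bullet> x = 0" if "i < r" for i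
  proof -
    have "((fam_mat n r f)\<^sup>T *\<^sub>v x) $ i = f i \<bullet> x"
      using that assms(1)[OF that] x(1) by (simp add: col_fam_mat)
    then show ?thesis using x that by simp
  qed
  define y where "y = (1 / sqrt (x \<bullet> x)) \<cdot>\<^sub>v x"
  have pos: "x \<bullet> x > 0" using x by (intro scalar_prod_self_pos[of _ n])
  have "y \<bullet> y = 1" using pos x by (simp add: y_def field_simps)
  moreover have "f i \<bullet> y = 0" if "i < r" for i
    using f[OF that] assms(1)[OF that] x by (simp add: y_def)
  moreover have "y \<in> carrier_vec n" using x by (simp add: y_def)
  ultimately show ?thesis by blast
qed

lemma orthofam_insert:
  assumes "orthofam n r q" "x \<in> carrier_vec n" "x \<bullet> x = 1" "\<And>i. i < r \<Longrightarrow> q i \<bullet> x = 0"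
  shows "orthofam n (Suc r) (q(r := x))"
proof -
  have "x \<bullet> q i = 0" if "i < r" for i
    using assms that comm_scalar_prod[OF assms(2), of "q i"] by (simp add: orthofam_def)
  with assms show ?thesis by (auto simp: orthofam_def less_Suc_eq)
qed

lemma orthofam_extend:
  assumes "orthofam n r q" "r \<le> n"
  shows "\<exists>q'. orthofam n n q' \<and> (\<forall>i<r. q' i = q i)"
  using assms
proof (induction "n - r" arbitrary: r q)
  case 0
  then show ?case by auto
next
  case (Suc d)
  have "r < n" using Suc by simp
  then obtain x where x: "x \<in> carrier_vec n" "x \<bullet> x = 1" "\<And>i. i < r \<Longrightarrow> q i \<bullet> x = 0"
    using orthogonal_vector_exists[of r q n] Suc.prems by (auto simp: orthofam_def)
  have "orthofam n (Suc r) (q(r := x))"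
    using Suc.prems(1) x by (rule orthofam_insert)
  moreover have "d = n - Suc r" "Suc r \<le> n" using Suc.hyps(2) \<open>r < n\<close> by auto
  ultimately obtain q' where "orthofam n n q'" "\<forall>i<Suc r. q' i = (q(r := x)) i"
    using Suc.hyps(1)[of "Suc r" "q(r := x)"] by blast
  then show ?case by (intro exI[of _ q']) auto
qed

lemma fam_mat_orthonormal:
  assumes "orthofam n r q"
  shows "(fam_mat n r q)\<^sup>T * fam_mat n r q = 1\<^sub>m r"
  using assms by (intro eq_matI) (auto simp: col_fam_mat orthofam_def)

lemma square_orthonormal_commute:
  assumes "(Q :: real mat) \<in> carrier_mat n n" "Q\<^sup>T * Q = 1\<^sub>m n"
  shows "Q * Q\<^sup>T = 1\<^sub>m n"
  using mat_mult_left_right_inverse[of "Q\<^sup>T" n Q] assms by auto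

text \<open>The characteristic polynomial splits over the complex numbers. For an eigenvector with
  real part \<open>x\<close>, imaginary part \<open>y\<close> and eigenvalue \<open>a\<close>,
  symmetry equates the inner products of \<open>A x\<close> with \<open>y\<close> and of
  \<open>x\<close> with \<open>A y\<close>, which leaves
  \<open>Im a * (x \<bullet> x + y \<bullet> y) = 0\<close>. So \<open>a\<close> is real, and
  \<open>x\<close> or \<open>y\<close> is a real eigenvector.\<close>

lemma symmetric_has_eigenvector:
  assumes A: "(A :: real mat) \<in> carrier_mat n n" and sym: "A\<^sup>T = A" and n: "n > 0"
  shows "\<exists>v\<in>carrier_vec n. \<exists>e. v \<bullet> v = 1 \<and> A *\<^sub>v v = e \<cdot>\<^sub>v v"
proof -
  define C where "C = map_mat complex_of_real A"
  have C: "C \<in> carrier_mat n n" using A by (simp add: C_def)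
  from char_poly_factorized[OF C] obtain as where
    as: "char_poly C = (\<Prod>a\<leftarrow>as. [:- a, 1:])" "length as = n" by blast
  with n obtain a where "a \<in> set as" by (cases as) auto
  then have "poly (char_poly C) a = 0"
    unfolding as by (auto simp: poly_prod_list prod_list_zero_iff image_iff intro!: bexI[of _ a])
  then have "eigenvalue C a" using eigenvalue_root_char_poly[OF C] by simp
  then obtain v where v: "v \<in> carrier_vec n" "v \<noteq> 0\<^sub>v n" "C *\<^sub>v v = a \<cdot>\<^sub>v v"
    using C by (auto simp: eigenvalue_def eigenvector_def)
  define x where "x = map_vec Re v"
  define y where "y = map_vec Im v"
  have xy: "x \<in> carrier_vec n" "y \<in> carrier_vec n" using v by (auto simp: x_def y_def)
  have comp: "(\<Sum>j<n. complex_of_real (A $$ (i, j)) * v $ j) = a * v $ i" if "i < n" for i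
  proof -
    have "(C *\<^sub>v v) $ i = a * v $ i" using v that by simp
    then show ?thesis using that C v A by (simp add: scalar_prod_def C_def atLeast0LessThan)
  qed
  have re: "(A *\<^sub>v x) $ i = Re a * x $ i - Im a * y $ i"
    and im: "(A *\<^sub>v y) $ i = Re a * y $ i + Im a * x $ i" if "i < n" for i
    using arg_cong[OF comp[OF that], of Re] arg_cong[OF comp[OF that], of Im] that A v
    by (simp_all add: scalar_prod_def x_def y_def atLeast0LessThan algebra_simps)
  have Ax: "A *\<^sub>v x = Re a \<cdot>\<^sub>v x - Im a \<cdot>\<^sub>v y" and Ay: "A *\<^sub>v y = Re a \<cdot>\<^sub>v y + Im a \<cdot>\<^sub>v x"
    using re im A xy by (auto intro!: eq_vecI simp del: index_mult_mat_vec)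
  have "(A *\<^sub>v x) \<bullet> y = x \<bullet> (A *\<^sub>v y)"
    using scalar_prod_mult_mat_vec[OF A xy] sym by simp
  then have "Im a * (x \<bullet> x + y \<bullet> y) = 0"
    unfolding Ax Ay using xy
    by (simp add: minus_scalar_prod_distrib[of _ n] scalar_prod_add_distrib[of _ n]
        algebra_simps)
  moreover have nz: "x \<noteq> 0\<^sub>v n \<or> y \<noteq> 0\<^sub>v n"
  proof (rule ccontr)
    assume "\<not> ?thesis"
    then have *: "map_vec Re v = 0\<^sub>v n" "map_vec Im v = 0\<^sub>v n" by (auto simp: x_def y_def)
    have "v = 0\<^sub>v n"
    proof (intro eq_vecI)
      fix i assume "i < dim_vec (0\<^sub>v n :: complex vec)"
      then have "i < n" by simp
      then have "map_vec Re v $ i = 0" "map_vec Im v $ i = 0" using * by simp_all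
      then show "v $ i = 0\<^sub>v n $ i" using \<open>i < n\<close> v by (simp add: complex_eq_iff)
    qed (use v in auto)
    with v show False by simp
  qed
  moreover have "x \<bullet> x + y \<bullet> y > 0"
    using nz xy scalar_prod_self_pos[of x n] scalar_prod_self_pos[of y n]
      scalar_prod_self_nonneg[of x] scalar_prod_self_nonneg[of y] by linarith
  ultimately have "Im a = 0" by simp
  then have "A *\<^sub>v x = Re a \<cdot>\<^sub>v x" "A *\<^sub>v y = Re a \<cdot>\<^sub>v y"
    using Ax Ay xy by auto
  then obtain z where z: "z \<in> carrier_vec n" "z \<noteq> 0\<^sub>v n" "A *\<^sub>v z = Re a \<cdot>\<^sub>v z"
    using nz xy by blast
  have pos: "z \<bullet> z > 0" using z scalar_prod_self_pos by blast
  define w where "w = (1 / sqrt (z \<bullet> z)) \<cdot>\<^sub>v z"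
  have "w \<in> carrier_vec n" "w \<bullet> w = 1" using z pos by (simp_all add: w_def field_simps)
  moreover have "A *\<^sub>v w = Re a \<cdot>\<^sub>v w"
    using z A by (simp add: w_def mult_mat_vec smult_smult_assoc mult.commute)
  ultimately show ?thesis by blast
qed

text \<open>A full orthonormal family is the column set of a square \<open>Q\<close> that has
  \<open>Q\<^sup>T\<close> as a two-sided inverse, so coefficients determine a vector. Vector
  identities below are checked against a basis in this way.\<close>

lemma orthofam_expand:
  assumes q: "orthofam n n q" and x: "x \<in> carrier_vec n" and y: "y \<in> carrier_vec n"
    and eq: "\<And>i. i < n \<Longrightarrow> q i \<bullet> x = q i \<bullet> y"
  shows "x = (y :: real vec)"
proof -
  define Q where "Q = fam_mat n n q"
  have Q: "Q \<in> carrier_mat n n" by (simp add: Q_def)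
  have QQ: "Q * Q\<^sup>T = 1\<^sub>m n"
    using square_orthonormal_commute[OF Q] fam_mat_orthonormal[OF q] by (simp add: Q_def)
  have "Q\<^sup>T *\<^sub>v x = Q\<^sup>T *\<^sub>v y"
    using eq Q q by (intro eq_vecI) (auto simp: Q_def col_fam_mat orthofam_def)
  then have "Q *\<^sub>v (Q\<^sup>T *\<^sub>v x) = Q *\<^sub>v (Q\<^sup>T *\<^sub>v y)" by simp
  then show ?thesis
    using Q x y QQ by (simp flip: assoc_mult_mat_vec[of Q n n "Q\<^sup>T" n])
qed

text \<open>Deflation: the eigenvectors found so far are completed to a basis, \<open>A\<close> is
  compressed to the span of the added vectors, and an eigenvector of the symmetric compression is
  lifted back.\<close>

lemma symmetric_orthofam_eigenvectors:
  assumes A: "(A :: real mat) \<in> carrier_mat n n" and sym: "A\<^sup>T = A" and "r \<le> n"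
  shows "\<exists>q d. orthofam n r q \<and> (\<forall>i<r. A *\<^sub>v q i = d i \<cdot>\<^sub>v q i)"
  using \<open>r \<le> n\<close>
proof (induction r)
  case 0
  then show ?case by (auto simp: orthofam_def)
next
  case (Suc r)
  then obtain q0 d where q0: "orthofam n r q0" and ev0: "\<And>i. i < r \<Longrightarrow> A *\<^sub>v q0 i = d i \<cdot>\<^sub>v q0 i"
    by auto
  obtain q where q: "orthofam n n q" and qq0: "\<And>i. i < r \<Longrightarrow> q i = q0 i"
    using orthofam_extend[OF q0] Suc.prems by auto
  have ev: "A *\<^sub>v q i = d i \<cdot>\<^sub>v q i" if "i < r" for i using ev0[OF that] qq0[OF that] by simp
  have qc: "q i \<in> carrier_vec n" if "i < n" for i using q that by (simp add: orthofam_def)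
  define E where "E = fam_mat n (n - r) (\<lambda>i. q (r + i))"
  have E: "E \<in> carrier_mat n (n - r)" by (simp add: E_def)
  have colE: "col E i = q (r + i)" if "i < n - r" for i
    using that qc by (simp add: E_def col_fam_mat)
  have EE: "E\<^sup>T * E = 1\<^sub>m (n - r)"
    unfolding E_def by (intro fam_mat_orthonormal) (use q in \<open>auto simp: orthofam_def\<close>)
  define B where "B = E\<^sup>T * (A * E)"
  have B: "B \<in> carrier_mat (n - r) (n - r)" using A E by (simp add: B_def)
  have "B\<^sup>T = (A * E)\<^sup>T * E" unfolding B_def using A E by (subst transpose_mult[of "E\<^sup>T" "n-r" n "A * E" "n-r"]) auto
  also have "\<dots> = (E\<^sup>T * A) * E" using A E sym by (subst transpose_mult[of A n n E "n-r"]) auto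
  also have "\<dots> = B" unfolding B_def using A E by (intro assoc_mult_mat[of _ "n-r" n _ n _ "n-r"]) auto
  finally have "B\<^sup>T = B" .
  from symmetric_has_eigenvector[OF B this] Suc.prems obtain y e where
    y: "y \<in> carrier_vec (n - r)" "y \<bullet> y = 1" "B *\<^sub>v y = e \<cdot>\<^sub>v y" by auto
  define v where "v = E *\<^sub>v y"
  have v: "v \<in> carrier_vec n" using E y by (simp add: v_def)
  have vv: "v \<bullet> v = 1" using orthonormal_cols_isometry[OF E EE] y by (simp add: v_def)
  have qv: "q i \<bullet> v = 0" if "i < r" for i
  proof -
    have "E\<^sup>T *\<^sub>v q i = 0\<^sub>v (n - r)"
      using that q E by (intro eq_vecI) (auto simp: colE orthofam_def)
    then have "v \<bullet> q i = 0"
      using scalar_prod_mult_mat_vec[OF E y(1) qc[of i]] that Suc.prems y by (simp add: v_def)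
    then show ?thesis using comm_scalar_prod[OF v qc[of i]] that Suc.prems by simp
  qed
  have Av: "A *\<^sub>v v = e \<cdot>\<^sub>v v"
  \<comment> \<open>Against an old eigenvector both sides vanish, by symmetry of \<open>A\<close>
    and orthogonality. Against a column of \<open>E\<close> the equation is the eigenvector equation
    of the compression \<open>B\<close>.\<close>
  proof (rule orthofam_expand[OF q])
    fix i assume i: "i < n"
    show "q i \<bullet> (A *\<^sub>v v) = q i \<bullet> (e \<cdot>\<^sub>v v)"
    proof (cases "i < r")
      case True
      have "q i \<bullet> (A *\<^sub>v v) = (A *\<^sub>v q i) \<bullet> v"
        using scalar_prod_mult_mat_vec[OF A qc[OF i] v] sym by simp
      also have "\<dots> = 0" using True v qc[OF i] by (simp add: ev qv)
      finally show ?thesis using True v qc[OF i] by (simp add: qv)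
    next
      case False
      define j where "j = i - r"
      have j: "j < n - r" "i = r + j" using False i by (auto simp: j_def)
      have "E\<^sup>T *\<^sub>v (A *\<^sub>v v) = B *\<^sub>v y"
        using A E y unfolding B_def v_def
        by (simp add: assoc_mult_mat_vec[of _ "n-r" n _ "n-r"] assoc_mult_mat_vec[of _ n n _ "n-r"])
      also have "\<dots> = e \<cdot>\<^sub>v (E\<^sup>T *\<^sub>v v)"
        using E y EE by (simp add: v_def y(3) flip: assoc_mult_mat_vec[of _ "n-r" n _ "n-r"])
      finally have "(E\<^sup>T *\<^sub>v (A *\<^sub>v v)) $ j = (e \<cdot>\<^sub>v (E\<^sup>T *\<^sub>v v)) $ j" by simp
      then show ?thesis using j E v qc[OF i] colE[OF j(1)] by simp
    qed
  qed (use A v in auto)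
  have "orthofam n r q" using q Suc.prems by (simp add: orthofam_def)
  then have fam: "orthofam n (Suc r) (q(r := v))" using v vv qv by (rule orthofam_insert)
  show ?case
    by (intro exI[of _ "q(r := v)"] exI[of _ "d(r := e)"]) (intro conjI fam, use ev Av in \<open>auto simp: less_Suc_eq\<close>)
qed

lemma antimono_rearrangement:
  fixes d :: "nat \<Rightarrow> real"
  shows "\<exists>\<pi>. \<pi> permutes {..<n} \<and> (\<forall>i j. i \<le> j \<longrightarrow> j < n \<longrightarrow> d (\<pi> j) \<le> d (\<pi> i))"
proof -
  define xs where "xs = map d [0..<n]"
  define ys where "ys = rev (sort xs)"
  have len: "length ys = n" by (simp add: ys_def xs_def)
  have "mset ys = mset xs" by (simp add: ys_def)
  then obtain \<pi> where \<pi>: "\<pi> permutes {..<length xs}" "permute_list \<pi> xs = ys"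
    by (metis mset_eq_permutation)
  have nth: "ys ! i = d (\<pi> i)" if "i < n" for i
  proof -
    have "\<pi> i < n" using that \<pi>(1) permutes_in_image[OF \<pi>(1), of i] by (simp add: xs_def)
    then show ?thesis using that \<pi> permute_list_nth[OF \<pi>(1), of i] by (simp add: xs_def)
  qed
  have "sorted_wrt (\<ge>) ys" by (simp add: ys_def sorted_wrt_rev)
  then have "ys ! j \<le> ys ! i" if "i \<le> j" "j < n" for i j
    using that sorted_wrt_nth_less[of "(\<ge>)" ys i j] len by (cases "i = j") auto
  then show ?thesis using \<pi>(1) nth by (intro exI[of _ \<pi>]) (auto simp: xs_def)
qed

lemma symmetric_spectral_decomposition:
  assumes A: "(A :: real mat) \<in> carrier_mat n n" and sym: "A\<^sup>T = A"
  obtains q d where "orthofam n n q" "\<And>i. i < n \<Longrightarrow> A *\<^sub>v q i = d i \<cdot>\<^sub>v q i"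
    "\<And>i j. i \<le> j \<Longrightarrow> j < n \<Longrightarrow> d j \<le> d i"
proof -
  obtain q d where q: "orthofam n n q" "\<And>i. i < n \<Longrightarrow> A *\<^sub>v q i = d i \<cdot>\<^sub>v q i"
    using symmetric_orthofam_eigenvectors[OF A sym, of n] by auto
  obtain \<pi> where \<pi>: "\<pi> permutes {..<n}" "\<And>i j. i \<le> j \<Longrightarrow> j < n \<Longrightarrow> d (\<pi> j) \<le> d (\<pi> i)"
    using antimono_rearrangement[of n d] by auto
  have lt: "\<pi> i < n" if "i < n" for i using permutes_in_image[OF \<pi>(1), of i] that by simp
  have inj: "\<pi> i = \<pi> j \<longleftrightarrow> i = j" for i j using permutes_inj[OF \<pi>(1)] by (simp add: inj_eq)
  show ?thesis
    by (rule that[of "q \<circ> \<pi>" "d \<circ> \<pi>"]) (use q \<pi> lt inj in \<open>auto simp: orthofam_def\<close>)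
qed

section \<open>Singular values\<close>

lemma rev_sort_sorted_desc:
  fixes xs :: "'a :: linorder list"
  assumes "sorted_wrt (\<ge>) xs"
  shows "rev (sort xs) = xs"
proof -
  have "sort xs = rev xs"
    using assms by (intro properties_for_sort) (auto simp: sorted_wrt_rev)
  then show ?thesis by simp
qed

lemma char_poly_mat_diag:
  "char_poly (mat_diag n (d :: nat \<Rightarrow> real)) = (\<Prod>a\<leftarrow>map d [0..<n]. [:- a, 1:])"
proof -
  have "diag_mat (mat_diag n d) = map d [0..<n]"
    by (auto simp: diag_mat_def mat_diag_def)
  then show ?thesis
    using char_poly_upper_triangular[of "mat_diag n d" n]
    by (simp add: mat_diag_def upper_triangular_def)
qed

lemma proots_prod_linear: "proots (\<Prod>a\<leftarrow>xs. [:- a, 1 :: real:]) = mset xs"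
proof (induction xs)
  case (Cons a xs)
  have "(\<Prod>a\<leftarrow>xs. [:- a, 1 :: real:]) \<noteq> 0" by (auto simp: prod_list_zero_iff)
  then show ?case using Cons by (simp add: proots_mult del: mult_pCons_left)
qed simp

text \<open>The definition collects roots with multiplicity and sorts them, so a factorization into
  linear factors with nonnegative decreasing \<open>s\<close> determines the list
  completely.\<close>

lemma singular_values_eq:
  assumes cp: "char_poly (A\<^sup>T * A) = (\<Prod>a\<leftarrow>map (\<lambda>i. (s i)\<^sup>2) [0..<n]. [:- a, 1:])"
    and s: "\<And>i. i < n \<Longrightarrow> s i \<ge> 0" "\<And>i j. i \<le> j \<Longrightarrow> j < n \<Longrightarrow> s j \<le> s i"
  shows "singular_values A = map s [0..<n]"
proof -
  have "image_mset sqrt (proots (char_poly (A\<^sup>T * A))) = mset (map sqrt (map (\<lambda>i. (s i)\<^sup>2) [0..<n]))"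
    unfolding cp proots_prod_linear by (simp only: mset_map)
  also have "map sqrt (map (\<lambda>i. (s i)\<^sup>2) [0..<n]) = map s [0..<n]"
    using s(1) by auto
  finally have "singular_values A = rev (sort (map s [0..<n]))"
    by (simp add: singular_values_def flip: sorted_list_of_multiset_mset)
  also have "\<dots> = map s [0..<n]"
    by (intro rev_sort_sorted_desc) (auto simp: sorted_wrt_iff_nth_less intro!: s)
  finally show ?thesis .
qed

lemma sing_val_eqI:
  assumes "char_poly (A\<^sup>T * A) = (\<Prod>a\<leftarrow>map (\<lambda>i. (s i)\<^sup>2) [0..<n]. [:- a, 1:])"
    and "\<And>i. i < n \<Longrightarrow> s i \<ge> 0" "\<And>i j. i \<le> j \<Longrightarrow> j < n \<Longrightarrow> s j \<le> s i"
  shows "sing_val A (i + 1) = (if i < n then s i else 0)"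
proof -
  have "singular_values A = map s [0..<n]" by (rule singular_values_eq) (use assms in auto)
  then show ?thesis by (simp add: sing_val_def)
qed

lemma similar_mat_orthofam:
  assumes A: "(A :: real mat) \<in> carrier_mat n n" and q: "orthofam n n q"
    and ev: "\<And>i. i < n \<Longrightarrow> A *\<^sub>v q i = d i \<cdot>\<^sub>v q i"
  shows "similar_mat A (mat_diag n d)"
proof -
  define Q where "Q = fam_mat n n q"
  have Q: "Q \<in> carrier_mat n n" by (simp add: Q_def)
  have QQ: "Q\<^sup>T * Q = 1\<^sub>m n" using fam_mat_orthonormal[OF q] by (simp add: Q_def)
  have QQ': "Q * Q\<^sup>T = 1\<^sub>m n" by (rule square_orthonormal_commute[OF Q QQ])
  have "A * Q = Q * mat_diag n d"
  proof (rule mat_col_eqI)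
    fix j assume "j < dim_col (Q * mat_diag n d)"
    then have j: "j < n" by (simp add: mat_diag_def)
    have c: "col Q j = q j" using j q by (simp add: Q_def col_fam_mat orthofam_def)
    have "col (A * Q) j = A *\<^sub>v q j" using c by (simp add: col_mult2[OF A Q j])
    also have "\<dots> = d j \<cdot>\<^sub>v q j" by (rule ev[OF j])
    also have "\<dots> = col (Q * mat_diag n d) j"
      using j Q q by (simp add: mat_diag_mult_right[OF Q])
        (auto intro!: eq_vecI simp: Q_def fam_mat_def orthofam_def)
    finally show "col (A * Q) j = col (Q * mat_diag n d) j" .
  qed (use A Q in \<open>auto simp: mat_diag_def\<close>)
  then have "A * Q * Q\<^sup>T = Q * mat_diag n d * Q\<^sup>T" by simp
  moreover have "A * Q * Q\<^sup>T = A * (Q * Q\<^sup>T)"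
    using A Q by (intro assoc_mult_mat[of _ n n _ n _ n]) auto
  ultimately have "A = Q * mat_diag n d * Q\<^sup>T" using A QQ' by simp
  then have "similar_mat_wit A (mat_diag n d) Q (Q\<^sup>T)"
    using A Q QQ QQ' by (intro similar_mat_witI[of _ _ n]) auto
  then show ?thesis by (auto simp: similar_mat_def)
qed

text \<open>Trades the roots of the characteristic polynomial for an orthonormal basis of right
  singular vectors. The eigenvalues are nonnegative because they are the squared lengths of the
  images of the \<open>q i\<close>. Families count from 0 and \<open>sing_val\<close> counts from 1,
  hence the shift \<open>i + 1\<close>.\<close>

lemma singular_system:
  assumes A: "A \<in> carrier_mat p n"
  obtains q where "orthofam n n q"
    "\<And>i. i < n \<Longrightarrow> (A\<^sup>T * A) *\<^sub>v q i = (sing_val A (i + 1))\<^sup>2 \<cdot>\<^sub>v q i"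
    "\<And>i. sing_val A (i + 1) \<ge> 0" "\<And>i j. i \<le> j \<Longrightarrow> sing_val A (j + 1) \<le> sing_val A (i + 1)"
    "\<And>i. i \<ge> n \<Longrightarrow> sing_val A (i + 1) = 0"
proof -
  have AA: "A\<^sup>T * A \<in> carrier_mat n n" using A by simp
  have "(A\<^sup>T * A)\<^sup>T = A\<^sup>T * A" using A by (subst transpose_mult[of _ n p _ n]) auto
  from symmetric_spectral_decomposition[OF AA this] obtain q d where
    q: "orthofam n n q" and ev: "\<And>i. i < n \<Longrightarrow> (A\<^sup>T * A) *\<^sub>v q i = d i \<cdot>\<^sub>v q i"
    and sorted: "\<And>i j. i \<le> j \<Longrightarrow> j < n \<Longrightarrow> d j \<le> d i" by blast
  have d: "d i \<ge> 0" if "i < n" for i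
  proof -
    have c: "q i \<in> carrier_vec n" "q i \<bullet> q i = 1" using q that by (auto simp: orthofam_def)
    have "d i = q i \<bullet> ((A\<^sup>T * A) *\<^sub>v q i)" using c by (simp add: ev[OF that])
    also have "\<dots> = (A *\<^sub>v q i) \<bullet> (A *\<^sub>v q i)"
      by (rule scalar_prod_mult_mat_vec_self[OF A c(1), symmetric])
    finally show ?thesis using scalar_prod_self_nonneg by simp
  qed
  have "char_poly (A\<^sup>T * A) = char_poly (mat_diag n d)"
    by (rule char_poly_similar[OF similar_mat_orthofam[OF AA q ev]])
  also have "\<dots> = (\<Prod>a\<leftarrow>map (\<lambda>i. (sqrt (d i))\<^sup>2) [0..<n]. [:- a, 1:])"
    unfolding char_poly_mat_diag using d
    by (intro arg_cong[where f = prod_list] map_cong) auto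
  finally have sv: "sing_val A (i + 1) = (if i < n then sqrt (d i) else 0)" for i
    by (rule sing_val_eqI) (use d sorted in auto)
  show ?thesis
    by (rule that[OF q]) (use sv ev d sorted in auto)
qed

lemma sing_val_nonneg: "sing_val A i \<ge> 0"
proof (cases i)
  case (Suc j)
  have "A \<in> carrier_mat (dim_row A) (dim_col A)" by simp
  from singular_system[OF this] show ?thesis using Suc by (metis Suc_eq_plus1)
qed (simp add: sing_val_def)

lemma sing_val_antimono:
  assumes "1 \<le> i" "i \<le> j"
  shows "sing_val A j \<le> sing_val A i"
proof -
  have "A \<in> carrier_mat (dim_row A) (dim_col A)" by simp
  from singular_system[OF this] have "sing_val A (b + 1) \<le> sing_val A (a + 1)" if "a \<le> b" for a b
    using that by metis
  from this[of "i - 1" "j - 1"] show ?thesis using assms by simp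
qed

lemma sing_val_eq_0: "dim_col A < i \<Longrightarrow> sing_val A i = 0"
proof (cases i)
  case (Suc j)
  assume "dim_col A < i"
  with Suc have "dim_col A \<le> j" by simp
  moreover have "A \<in> carrier_mat (dim_row A) (dim_col A)" by simp
  from singular_system[OF this] have "dim_col A \<le> j \<Longrightarrow> sing_val A (j + 1) = 0" by metis
  ultimately show ?thesis using Suc by simp
qed (simp add: sing_val_def)

lemma sing_val_mat_diag:
  assumes "\<And>i. i < n \<Longrightarrow> d i \<ge> 0" "\<And>i j. i \<le> j \<Longrightarrow> j < n \<Longrightarrow> d j \<le> d i"
  shows "sing_val (mat_diag n d) (i + 1) = (if i < n then d i else 0)"
proof (rule sing_val_eqI)
  have "(mat_diag n d)\<^sup>T = mat_diag n d" by (auto simp: mat_diag_def)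
  then have "(mat_diag n d)\<^sup>T * mat_diag n d = mat_diag n (\<lambda>i. (d i)\<^sup>2)"
    by (simp add: power2_eq_square)
  then show "char_poly ((mat_diag n d)\<^sup>T * mat_diag n d)
      = (\<Prod>a\<leftarrow>map (\<lambda>i. (d i)\<^sup>2) [0..<n]. [:- a, 1:])"
    by (simp add: char_poly_mat_diag)
qed (use assms in auto)

lemma pow_mat_diag: "mat_diag n d ^\<^sub>m g = mat_diag n (\<lambda>i. (d i :: real) ^ g)"
proof (induction g)
  case 0
  then show ?case by (auto simp: mat_diag_def)
next
  case (Suc g)
  then show ?case by (simp add: mult.commute)
qed

text \<open>One half of the Courant-Fischer principle: the span of the first \<open>i + 1\<close>
  right singular vectors contains a unit vector that meets the \<open>i\<close> conditions, and on
  this span \<open>A\<close> stretches by at least the singular value number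
  \<open>i + 1\<close>.\<close>

lemma sing_val_le:
  assumes A: "A \<in> carrier_mat p n"
    and f: "\<And>l. l < i \<Longrightarrow> f l \<in> carrier_vec n" and t: "t \<ge> 0"
    and le: "\<And>x. x \<in> carrier_vec n \<Longrightarrow> (\<And>l. l < i \<Longrightarrow> f l \<bullet> x = 0) \<Longrightarrow>
      (A *\<^sub>v x) \<bullet> (A *\<^sub>v x) \<le> t\<^sup>2 * (x \<bullet> x)"
  shows "sing_val A (i + 1) \<le> t"
proof (cases "i < n")
  case False
  then show ?thesis using A t sing_val_eq_0[of A "i + 1"] by simp
next
  case True
  obtain q where q: "orthofam n n q"
    and ev: "\<And>i. i < n \<Longrightarrow> (A\<^sup>T * A) *\<^sub>v q i = (sing_val A (i + 1))\<^sup>2 \<cdot>\<^sub>v q i"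
    using singular_system[OF A] by metis
  define E where "E = fam_mat n (i + 1) q"
  have E: "E \<in> carrier_mat n (i + 1)" by (simp add: E_def)
  have q': "orthofam n (i + 1) q" using q True by (auto simp: orthofam_def)
  have EE: "E\<^sup>T * E = 1\<^sub>m (i + 1)" using fam_mat_orthonormal[OF q'] by (simp add: E_def)
  have colE: "col E j = q j" if "j < i + 1" for j
    using that q' by (simp add: E_def col_fam_mat orthofam_def)
  have "E\<^sup>T *\<^sub>v f l \<in> carrier_vec (i + 1)" if "l < i" for l using f[OF that] E by simp
  from orthogonal_vector_exists[of i "\<lambda>l. E\<^sup>T *\<^sub>v f l" "i + 1", OF this]
  obtain y where y: "y \<in> carrier_vec (i + 1)" "y \<bullet> y = 1"
    and y0: "\<And>l. l < i \<Longrightarrow> (E\<^sup>T *\<^sub>v f l) \<bullet> y = 0" by auto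
  define x where "x = E *\<^sub>v y"
  have x: "x \<in> carrier_vec n" using E y by (simp add: x_def)
  have xx: "x \<bullet> x = 1" using orthonormal_cols_isometry[OF E EE y(1) y(1)] y by (simp add: x_def)
  have "f l \<bullet> x = 0" if "l < i" for l
    using transpose_vec_mult_scalar[OF E y(1) f[OF that]] y0[OF that] by (simp add: x_def)
  from le[OF x this] have "(A *\<^sub>v x) \<bullet> (A *\<^sub>v x) \<le> t\<^sup>2" by (simp add: xx)
  moreover have "(A *\<^sub>v x) \<bullet> (A *\<^sub>v x) \<ge> (sing_val A (i + 1))\<^sup>2"
  proof -
    \<comment> \<open>On the chosen span the quadratic form is diagonal: a weighted sum of the top
      squared singular values, each at least the last of them.\<close>
    have "E\<^sup>T * ((A\<^sup>T * A) * E) = mat_diag (i + 1) (\<lambda>j. (sing_val A (j + 1))\<^sup>2)"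
    proof (intro eq_matI)
      fix a b assume "a < dim_row (mat_diag (i + 1) (\<lambda>j. (sing_val A (j + 1))\<^sup>2))"
        "b < dim_col (mat_diag (i + 1) (\<lambda>j. (sing_val A (j + 1))\<^sup>2))"
      then have ab: "a < i + 1" "b < i + 1" by (auto simp: mat_diag_def)
      have "col ((A\<^sup>T * A) * E) b = (sing_val A (b + 1))\<^sup>2 \<cdot>\<^sub>v q b"
      proof -
        have "col ((A\<^sup>T * A) * E) b = (A\<^sup>T * A) *\<^sub>v col E b"
          by (rule col_mult2[of _ n n _ "i + 1"]) (use A E ab in auto)
        then show ?thesis using ab ev[of b] True colE by simp
      qed
      moreover have "(E\<^sup>T * ((A\<^sup>T * A) * E)) $$ (a, b) = q a \<bullet> col ((A\<^sup>T * A) * E) b"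
        using ab A E colE by simp
      moreover have qab: "q a \<in> carrier_vec n" "q b \<in> carrier_vec n"
        "q a \<bullet> q b = (if a = b then 1 else 0)"
        using ab q' by (auto simp: orthofam_def)
      ultimately show "(E\<^sup>T * ((A\<^sup>T * A) * E)) $$ (a, b)
          = mat_diag (i + 1) (\<lambda>j. (sing_val A (j + 1))\<^sup>2) $$ (a, b)"
        using ab qab by (simp add: mat_diag_def)
    qed (use A E in \<open>auto simp: mat_diag_def\<close>)
    then have "y \<bullet> (E\<^sup>T * ((A\<^sup>T * A) * E) *\<^sub>v y) = (\<Sum>j<i + 1. (sing_val A (j + 1))\<^sup>2 * (y $ j)\<^sup>2)"
      using y by (simp add: mat_diag_def scalar_prod_def atLeast0LessThan if_distrib if_distribR
          sum.delta power2_eq_square ac_simps cong: if_cong)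
    moreover have "y \<bullet> (E\<^sup>T * ((A\<^sup>T * A) * E) *\<^sub>v y) = (A *\<^sub>v x) \<bullet> (A *\<^sub>v x)"
    proof -
      have "y \<bullet> (E\<^sup>T * ((A\<^sup>T * A) * E) *\<^sub>v y) = y \<bullet> (E\<^sup>T *\<^sub>v ((A\<^sup>T * A) *\<^sub>v x))"
      proof -
        define H where "H = A\<^sup>T * A"
        have H: "H \<in> carrier_mat n n" using A by (simp add: H_def)
        have "E\<^sup>T * (H * E) *\<^sub>v y = E\<^sup>T *\<^sub>v (H * E *\<^sub>v y)"
          by (rule assoc_mult_mat_vec[of _ "i+1" n _ "i+1"]) (use H E y in auto)
        also have "H * E *\<^sub>v y = H *\<^sub>v (E *\<^sub>v y)"
          by (rule assoc_mult_mat_vec[of _ n n _ "i+1"]) (use H E y in auto)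
        finally show ?thesis by (simp add: H_def x_def)
      qed
      also have "\<dots> = x \<bullet> ((A\<^sup>T * A) *\<^sub>v x)"
        using scalar_prod_mult_mat_vec[OF E y(1), of "(A\<^sup>T * A) *\<^sub>v x"] A x by (simp add: x_def)
      also have "\<dots> = (A *\<^sub>v x) \<bullet> (A *\<^sub>v x)"
        by (rule scalar_prod_mult_mat_vec_self[OF A x, symmetric])
      finally show ?thesis .
    qed
    moreover have "(\<Sum>j<i + 1. (sing_val A (j + 1))\<^sup>2 * (y $ j)\<^sup>2) \<ge> (\<Sum>j<i + 1. (sing_val A (i + 1))\<^sup>2 * (y $ j)\<^sup>2)"
      by (intro sum_mono mult_right_mono power_mono sing_val_antimono sing_val_nonneg) auto
    moreover have "(\<Sum>j<i + 1. (sing_val A (i + 1))\<^sup>2 * (y $ j)\<^sup>2) = (sing_val A (i + 1))\<^sup>2 * (y \<bullet> y)"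
      using y(1) by (simp add: scalar_prod_def sum_distrib_left atLeast0LessThan power2_eq_square
          distrib_left)
    ultimately show ?thesis using y(2) by simp
  qed
  ultimately have "(sing_val A (i + 1))\<^sup>2 \<le> t\<^sup>2" by linarith
  then show ?thesis using t by (rule power2_le_imp_le)
qed

lemma mult_vec_norm_le_sing_val:
  assumes A: "A \<in> carrier_mat p n" and x: "x \<in> carrier_vec n"
  shows "(A *\<^sub>v x) \<bullet> (A *\<^sub>v x) \<le> (sing_val A 1)\<^sup>2 * (x \<bullet> x)"
proof -
  obtain q where q: "orthofam n n q"
    and ev: "\<And>i. i < n \<Longrightarrow> (A\<^sup>T * A) *\<^sub>v q i = (sing_val A (i + 1))\<^sup>2 \<cdot>\<^sub>v q i"
    using singular_system[OF A] by metis
  define E where "E = fam_mat n n q"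
  have E: "E \<in> carrier_mat n n" by (simp add: E_def)
  have EE: "E\<^sup>T * E = 1\<^sub>m n" using fam_mat_orthonormal[OF q] by (simp add: E_def)
  define y where "y = E\<^sup>T *\<^sub>v x"
  have y: "y \<in> carrier_vec n" using E x by (simp add: y_def)
  have xy: "x = E *\<^sub>v y"
    unfolding y_def using square_orthonormal_commute[OF E EE] E x
    by (simp flip: assoc_mult_mat_vec[of E n n "E\<^sup>T" n])
  have colE: "col E j = q j" if "j < n" for j
    using that q by (simp add: E_def col_fam_mat orthofam_def)
  have "E\<^sup>T *\<^sub>v ((A\<^sup>T * A) *\<^sub>v x) = vec n (\<lambda>j. (sing_val A (j + 1))\<^sup>2 * y $ j)"
  proof (intro eq_vecI)
    fix j assume "j < dim_vec (vec n (\<lambda>j. (sing_val A (j + 1))\<^sup>2 * y $ j))"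
    then have j: "j < n" by simp
    have qj: "q j \<in> carrier_vec n" using q j by (simp add: orthofam_def)
    have sym: "(A\<^sup>T * A)\<^sup>T = A\<^sup>T * A" using A by (subst transpose_mult[of _ n p _ n]) auto
    have "(E\<^sup>T *\<^sub>v ((A\<^sup>T * A) *\<^sub>v x)) $ j = q j \<bullet> ((A\<^sup>T * A) *\<^sub>v x)" using j E A colE by simp
    also have "\<dots> = ((A\<^sup>T * A) *\<^sub>v q j) \<bullet> x"
      using scalar_prod_mult_mat_vec[of "A\<^sup>T * A" n n "q j" x] A x qj sym by simp
    also have "\<dots> = (sing_val A (j + 1))\<^sup>2 * y $ j"
      using ev[OF j] qj x j E colE by (simp add: y_def)
    finally show "(E\<^sup>T *\<^sub>v ((A\<^sup>T * A) *\<^sub>v x)) $ j = vec n (\<lambda>j. (sing_val A (j + 1))\<^sup>2 * y $ j) $ j"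
      using j by simp
  qed (use E in auto)
  moreover have "(A *\<^sub>v x) \<bullet> (A *\<^sub>v x) = y \<bullet> (E\<^sup>T *\<^sub>v ((A\<^sup>T * A) *\<^sub>v x))"
    using scalar_prod_mult_mat_vec_self[OF A x] A x
      scalar_prod_mult_mat_vec[OF E y, of "(A\<^sup>T * A) *\<^sub>v x"] by (simp add: xy[symmetric])
  ultimately have "(A *\<^sub>v x) \<bullet> (A *\<^sub>v x) = (\<Sum>j<n. (sing_val A (j + 1))\<^sup>2 * (y $ j)\<^sup>2)"
    using y by (simp add: scalar_prod_def atLeast0LessThan power2_eq_square ac_simps)
  also have "\<dots> \<le> (\<Sum>j<n. (sing_val A 1)\<^sup>2 * (y $ j)\<^sup>2)"
    by (intro sum_mono mult_right_mono power_mono sing_val_antimono sing_val_nonneg) auto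
  also have "\<dots> = (sing_val A 1)\<^sup>2 * (y \<bullet> y)"
    using y by (simp add: scalar_prod_def sum_distrib_left atLeast0LessThan power2_eq_square)
  also have "y \<bullet> y = x \<bullet> x"
    using orthonormal_cols_isometry[OF E EE y y] xy by simp
  finally show ?thesis .
qed

text \<open>For a positive singular value the left vector is the normalized image of the right one.
  The other left vectors are an arbitrary completion, which is harmless because both identities then
  have zero on either side.\<close>

lemma square_svd:
  assumes C: "C \<in> carrier_mat k k"
  obtains p q where "orthofam k k p" "orthofam k k q"
    "\<And>i. i < k \<Longrightarrow> C *\<^sub>v q i = sing_val C (i + 1) \<cdot>\<^sub>v p i"
    "\<And>i. i < k \<Longrightarrow> C\<^sup>T *\<^sub>v p i = sing_val C (i + 1) \<cdot>\<^sub>v q i"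
proof -
  define \<sigma> where "\<sigma> i = sing_val C (i + 1)" for i
  obtain q where q: "orthofam k k q"
    and ev: "\<And>i. i < k \<Longrightarrow> (C\<^sup>T * C) *\<^sub>v q i = (\<sigma> i)\<^sup>2 \<cdot>\<^sub>v q i"
    and anti: "\<And>i j. i \<le> j \<Longrightarrow> \<sigma> j \<le> \<sigma> i"
    using singular_system[OF C] unfolding \<sigma>_def by metis
  have nonneg: "\<sigma> i \<ge> 0" for i by (simp add: \<sigma>_def sing_val_nonneg)
  have qc: "q i \<in> carrier_vec k" if "i < k" for i using q that by (simp add: orthofam_def)
  have gram: "(C *\<^sub>v q i) \<bullet> (C *\<^sub>v q j) = (if i = j then (\<sigma> i)\<^sup>2 else 0)" if "i < k" "j < k" for i j
  proof -
    have "(C *\<^sub>v q i) \<bullet> (C *\<^sub>v q j) = q i \<bullet> (C\<^sup>T *\<^sub>v (C *\<^sub>v q j))"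
      using C qc that by (intro scalar_prod_mult_mat_vec) auto
    also have "C\<^sup>T *\<^sub>v (C *\<^sub>v q j) = (\<sigma> j)\<^sup>2 \<cdot>\<^sub>v q j"
      using C qc[OF that(2)] ev[OF that(2)] assoc_mult_mat_vec[of "C\<^sup>T" k k C k "q j"] by simp
    also have "q i \<bullet> \<dots> = (\<sigma> j)\<^sup>2 * (q i \<bullet> q j)"
      using qc[OF that(1)] qc[OF that(2)] by simp
    also have "q i \<bullet> q j = (if i = j then 1 else 0)" using q that by (simp add: orthofam_def)
    finally show ?thesis by simp
  qed
  \<comment> \<open>The \<sigma>'s decrease, so below index \<open>k\<close> the positive ones are
    exactly those with index less than \<open>r\<close>.\<close>
  define r where "r = (if \<exists>i<k. \<sigma> i = 0 then LEAST i. i < k \<and> \<sigma> i = 0 else k)"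
  have L: "r < k \<and> \<sigma> r = 0" if ex: "\<exists>i<k. \<sigma> i = 0"
    using LeastI_ex[OF ex] ex by (simp add: r_def)
  have rk: "r \<le> k"
  proof (cases "\<exists>i<k. \<sigma> i = 0")
    case True
    then show ?thesis using L by simp
  next
    case False
    then have "r = k" unfolding r_def by (rule if_not_P)
    then show ?thesis by simp
  qed
  have pos: "\<sigma> i > 0" if ir: "i < r" for i
  proof -
    have ik: "i < k" using ir rk by simp
    have "\<sigma> i \<noteq> 0"
    proof
      assume "\<sigma> i = 0"
      with ik have ex: "\<exists>i<k. \<sigma> i = 0" by blast
      have "r \<le> i" unfolding r_def if_P[OF ex] by (rule Least_le) (use ik \<open>\<sigma> i = 0\<close> in simp)
      with ir show False by simp
    qed
    with nonneg[of i] show ?thesis by simp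
  qed
  have zero: "\<sigma> i = 0" if "r \<le> i" "i < k" for i
  proof -
    have "\<exists>i<k. \<sigma> i = 0" using that by (auto simp: r_def split: if_splits)
    then have "\<sigma> r = 0" using L by simp
    with anti[OF that(1)] nonneg[of i] show ?thesis by simp
  qed
  define p0 where "p0 i = (1 / \<sigma> i) \<cdot>\<^sub>v (C *\<^sub>v q i)" for i
  have Cq: "C *\<^sub>v q i \<in> carrier_vec k" if "i < k" for i using C qc[OF that] by simp
  have "p0 i \<bullet> p0 j = (if i = j then 1 else 0)" if "i < r" "j < r" for i j
  proof -
    have ij: "i < k" "j < k" using that rk by auto
    have "p0 i \<bullet> p0 j = (1 / \<sigma> i) * ((1 / \<sigma> j) * ((C *\<^sub>v q i) \<bullet> (C *\<^sub>v q j)))"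
      using Cq[OF ij(1)] Cq[OF ij(2)] by (simp add: p0_def)
    then show ?thesis using pos[OF that(1)] ij
      by (auto simp: gram power2_eq_square)
  qed
  then have "orthofam k r p0"
    using Cq rk by (auto simp: orthofam_def p0_def)
  from orthofam_extend[OF this rk] obtain p where
    p: "orthofam k k p" and pp0: "\<And>i. i < r \<Longrightarrow> p i = p0 i" by auto
  have pc: "p i \<in> carrier_vec k" if "i < k" for i using p that by (simp add: orthofam_def)
  have Cqp: "C *\<^sub>v q i = \<sigma> i \<cdot>\<^sub>v p i" if "i < k" for i
  proof (cases "i < r")
    case True
    then show ?thesis using pos[OF True] pp0[OF True] Cq[OF that]
      by (simp add: p0_def smult_smult_assoc)
  next
    case False
    then have "\<sigma> i = 0" using zero that by simp
    then have "(C *\<^sub>v q i) \<bullet> (C *\<^sub>v q i) = 0" using gram[OF that that] by simp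
    then have "C *\<^sub>v q i = 0\<^sub>v k" using scalar_prod_self_eq_0[OF Cq[OF that]] by simp
    then show ?thesis using \<open>\<sigma> i = 0\<close> pc[OF that] by (auto intro!: eq_vecI)
  qed
  have "C\<^sup>T *\<^sub>v p i = \<sigma> i \<cdot>\<^sub>v q i" if i: "i < k" for i
  proof (rule orthofam_expand[OF q])
    fix j assume j: "j < k"
    have "q j \<bullet> (C\<^sup>T *\<^sub>v p i) = (C *\<^sub>v q j) \<bullet> p i"
      using scalar_prod_mult_mat_vec[OF C qc[OF j] pc[OF i]] by simp
    also have "\<dots> = \<sigma> j * (p j \<bullet> p i)" using pc[OF i] pc[OF j] by (simp add: Cqp[OF j])
    also have "\<dots> = \<sigma> i * (q j \<bullet> q i)" using p q i j by (simp add: orthofam_def)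
    also have "\<dots> = q j \<bullet> (\<sigma> i \<cdot>\<^sub>v q i)" using qc[OF i] qc[OF j] by simp
    finally show "q j \<bullet> (C\<^sup>T *\<^sub>v p i) = q j \<bullet> (\<sigma> i \<cdot>\<^sub>v q i)" .
  qed (use C pc[OF i] qc[OF i] in auto)
  with that[OF p q] Cqp show ?thesis by (simp add: \<sigma>_def)
qed

lemma sing_val_1_le:
  assumes "A \<in> carrier_mat p n" "t \<ge> 0"
    and "\<And>x. x \<in> carrier_vec n \<Longrightarrow> (A *\<^sub>v x) \<bullet> (A *\<^sub>v x) \<le> t\<^sup>2 * (x \<bullet> x)"
  shows "sing_val A 1 \<le> t"
  using sing_val_le[OF assms(1), of 0 _ t] assms by simp

section \<open>Principal angles between two subspaces\<close>

lemma proj_complement_norm: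
  assumes U: "U \<in> carrier_mat m k" and UU: "U\<^sup>T * U = 1\<^sub>m k" and x: "x \<in> carrier_vec m"
  shows "((1\<^sub>m m - U * U\<^sup>T) *\<^sub>v x) \<bullet> ((1\<^sub>m m - U * U\<^sup>T) *\<^sub>v x) = x \<bullet> x - (U\<^sup>T *\<^sub>v x) \<bullet> (U\<^sup>T *\<^sub>v (x :: real vec))"
proof -
  define a where "a = U\<^sup>T *\<^sub>v x"
  have a: "a \<in> carrier_vec k" using U x by (simp add: a_def)
  have "(1\<^sub>m m - U * U\<^sup>T) *\<^sub>v x = 1\<^sub>m m *\<^sub>v x - (U * U\<^sup>T) *\<^sub>v x"
    by (rule minus_mult_distrib_mat_vec[of _ m m]) (use U x in auto)
  also have "(U * U\<^sup>T) *\<^sub>v x = U *\<^sub>v a"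
    unfolding a_def by (rule assoc_mult_mat_vec[of _ m k _ m]) (use U x in auto)
  finally have eq: "(1\<^sub>m m - U * U\<^sup>T) *\<^sub>v x = x - U *\<^sub>v a" using x by simp
  have Ua: "U *\<^sub>v a \<in> carrier_vec m" using U a by simp
  have 1: "(U *\<^sub>v a) \<bullet> (U *\<^sub>v a) = a \<bullet> a" by (rule orthonormal_cols_isometry[OF U UU a a])
  have 2: "(U *\<^sub>v a) \<bullet> x = a \<bullet> a"
    using scalar_prod_mult_mat_vec[OF U a x] by (simp add: a_def)
  have 3: "x \<bullet> (U *\<^sub>v a) = a \<bullet> a" using 2 comm_scalar_prod[OF x Ua] by simp
  have "(x - U *\<^sub>v a) \<bullet> (x - U *\<^sub>v a) = x \<bullet> x - x \<bullet> (U *\<^sub>v a) - ((U *\<^sub>v a) \<bullet> x - (U *\<^sub>v a) \<bullet> (U *\<^sub>v a))"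
    using x Ua by (simp add: minus_scalar_prod_distrib[of _ m] scalar_prod_minus_distrib[of _ m])
  then show ?thesis using 1 2 3 by (simp add: eq a_def)
qed

text \<open>The complementary projection \<open>R\<close> is symmetric and idempotent, so the Gram
  matrix of \<open>R * V\<close> is \<open>V\<^sup>T * (R * V)\<close>. It depends on the two frames
  only through \<open>U\<^sup>T * V\<close>.\<close>

lemma proj_complement_gram:
  assumes U: "U \<in> carrier_mat m k" and UU: "U\<^sup>T * U = 1\<^sub>m k"
    and V: "V \<in> carrier_mat m k" and VV: "V\<^sup>T * V = 1\<^sub>m k"
  shows "((1\<^sub>m m - U * U\<^sup>T) * V)\<^sup>T * ((1\<^sub>m m - U * U\<^sup>T) * V) = 1\<^sub>m k - (U\<^sup>T * V)\<^sup>T * (U\<^sup>T * (V :: real mat))"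
proof -
  define R where "R = 1\<^sub>m m - U * U\<^sup>T"
  have P: "R \<in> carrier_mat m m" using U by (simp add: R_def minus_carrier_mat)
  have UP: "U\<^sup>T * R = 0\<^sub>m k m"
  proof -
    have "U\<^sup>T * R = U\<^sup>T * 1\<^sub>m m - U\<^sup>T * (U * U\<^sup>T)"
      unfolding R_def by (rule mult_minus_distrib_mat[of _ k m _ m]) (use U in auto)
    also have "U\<^sup>T * (U * U\<^sup>T) = (U\<^sup>T * U) * U\<^sup>T"
      by (rule assoc_mult_mat[symmetric, of _ k m _ k _ m]) (use U in auto)
    finally show ?thesis using U UU by simp
  qed
  have PT: "R\<^sup>T = R"
    using U unfolding R_def
    by (auto intro!: eq_matI simp: comm_scalar_prod[of _ k])
  have PP: "R * R = R"
  proof -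
    have "R * R = 1\<^sub>m m * R - U * U\<^sup>T * R"
      by (subst (1) R_def, rule minus_mult_distrib_mat[of _ m m _ _ m]) (use U P in auto)
    also have "U * U\<^sup>T * R = U * (U\<^sup>T * R)"
      by (rule assoc_mult_mat[of _ m k _ m _ m]) (use U P in auto)
    finally show ?thesis using U P by (auto simp: UP intro!: eq_matI)
  qed
  have "(R * V)\<^sup>T * (R * V) = V\<^sup>T * R * (R * V)"
    using P V by (simp add: transpose_mult[of R m m V k] PT)
  also have "\<dots> = V\<^sup>T * (R * (R * V))"
    by (rule assoc_mult_mat[of _ k m _ m _ k]) (use P V in auto)
  also have "R * (R * V) = R * V"
    using assoc_mult_mat[of R m m R m V k] P V by (simp add: PP)
  also have "V\<^sup>T * (R * V) = V\<^sup>T * (V - U * (U\<^sup>T * V))"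
  proof -
    have "R * V = 1\<^sub>m m * V - U * U\<^sup>T * V"
      unfolding R_def by (rule minus_mult_distrib_mat[of _ m m _ _ k]) (use U V in auto)
    also have "U * U\<^sup>T * V = U * (U\<^sup>T * V)"
      by (rule assoc_mult_mat[of _ m k _ m _ k]) (use U V in auto)
    finally have "R * V = V - U * (U\<^sup>T * V)" using V by simp
    then show ?thesis by (simp only:)
  qed
  also have "V\<^sup>T * (V - U * (U\<^sup>T * V)) = V\<^sup>T * V - V\<^sup>T * (U * (U\<^sup>T * V))"
    by (rule mult_minus_distrib_mat[of _ k m _ k]) (use U V in auto)
  also have "V\<^sup>T * (U * (U\<^sup>T * V)) = V\<^sup>T * U * (U\<^sup>T * V)"
    by (rule assoc_mult_mat[symmetric, of _ k m _ k _ k]) (use U V in auto)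
  also have "V\<^sup>T * U = (U\<^sup>T * V)\<^sup>T"
    using transpose_mult[of "U\<^sup>T" k m V k] U V by simp
  finally show ?thesis by (simp add: VV R_def)
qed

text \<open>Both Gram matrices are \<open>1 - C\<^sup>T * C\<close> and \<open>1 - C * C\<^sup>T\<close> for the square matrix \<open>C = U\<^sup>T * V\<close>,
  and these have the same spectrum.\<close>

lemma singular_values_proj_complement_commute:
  assumes U: "U \<in> carrier_mat m k" and UU: "U\<^sup>T * U = 1\<^sub>m k"
    and V: "V \<in> carrier_mat m k" and VV: "V\<^sup>T * V = 1\<^sub>m k"
  shows "singular_values ((1\<^sub>m m - U * U\<^sup>T) * V) = singular_values ((1\<^sub>m m - V * V\<^sup>T) * U)"
proof -
  define C where "C = U\<^sup>T * V"
  have C: "C \<in> carrier_mat k k" using U V by (simp add: C_def)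
  have CT: "C\<^sup>T = V\<^sup>T * U"
    using transpose_mult[of "U\<^sup>T" k m V k] U V by (simp add: C_def)
  obtain p q where p: "orthofam k k p" and q: "orthofam k k q"
    and cq: "\<And>i. i < k \<Longrightarrow> C *\<^sub>v q i = sing_val C (i + 1) \<cdot>\<^sub>v p i"
    and cp: "\<And>i. i < k \<Longrightarrow> C\<^sup>T *\<^sub>v p i = sing_val C (i + 1) \<cdot>\<^sub>v q i"
    using square_svd[OF C] by metis
  \<comment> \<open>Stated for any \<open>A\<close> so that it applies to \<open>C\<close> and, with
    \<open>p\<close> and \<open>q\<close> exchanged, to \<open>C\<^sup>T\<close>.\<close>
  have key: "similar_mat (1\<^sub>m k - A\<^sup>T * A) (mat_diag k (\<lambda>i. 1 - (sing_val C (i + 1))\<^sup>2))"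
    if A: "A \<in> carrier_mat k k" and p: "orthofam k k p" and q: "orthofam k k q"
      and aq: "\<And>i. i < k \<Longrightarrow> A *\<^sub>v q i = sing_val C (i + 1) \<cdot>\<^sub>v p i"
      and ap: "\<And>i. i < k \<Longrightarrow> A\<^sup>T *\<^sub>v p i = sing_val C (i + 1) \<cdot>\<^sub>v q i" for A p q
  proof (rule similar_mat_orthofam[OF _ q])
    show "1\<^sub>m k - A\<^sup>T * A \<in> carrier_mat k k" using A by (simp add: minus_carrier_mat)
    fix i assume i: "i < k"
    have c: "q i \<in> carrier_vec k" "p i \<in> carrier_vec k" using p q i by (auto simp: orthofam_def)
    have "(1\<^sub>m k - A\<^sup>T * A) *\<^sub>v q i = 1\<^sub>m k *\<^sub>v q i - (A\<^sup>T * A) *\<^sub>v q i"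
      by (rule minus_mult_distrib_mat_vec[of _ k k]) (use A c in auto)
    also have "(A\<^sup>T * A) *\<^sub>v q i = A\<^sup>T *\<^sub>v (A *\<^sub>v q i)"
      by (rule assoc_mult_mat_vec[of _ k k _ k]) (use A c in auto)
    also have "\<dots> = (sing_val C (i + 1))\<^sup>2 \<cdot>\<^sub>v q i"
      unfolding aq[OF i] using mult_mat_vec[of "A\<^sup>T" k k "p i"] ap[OF i] A c
      by (simp add: smult_smult_assoc power2_eq_square)
    finally show "(1\<^sub>m k - A\<^sup>T * A) *\<^sub>v q i = (1 - (sing_val C (i + 1))\<^sup>2) \<cdot>\<^sub>v q i"
      using c by (auto intro!: eq_vecI simp: algebra_simps)
  qed
  have "char_poly (1\<^sub>m k - C\<^sup>T * C) = char_poly (1\<^sub>m k - C\<^sup>T\<^sup>T * C\<^sup>T)"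
    using char_poly_similar[OF key[OF C p q cq cp]] char_poly_similar[OF key[of "C\<^sup>T" q p]] C p q cq cp
    by simp
  then have "char_poly (((1\<^sub>m m - U * U\<^sup>T) * V)\<^sup>T * ((1\<^sub>m m - U * U\<^sup>T) * V))
      = char_poly (((1\<^sub>m m - V * V\<^sup>T) * U)\<^sup>T * ((1\<^sub>m m - V * V\<^sup>T) * U))"
    unfolding proj_complement_gram[OF U UU V VV] proj_complement_gram[OF V VV U UU] CT[symmetric]
      C_def[symmetric] by simp
  then show ?thesis by (simp add: singular_values_def)
qed

lemma sing_val_proj_complement_commute:
  assumes "U \<in> carrier_mat m k" "U\<^sup>T * U = 1\<^sub>m k" "V \<in> carrier_mat m k" "V\<^sup>T * V = 1\<^sub>m k"
  shows "sing_val ((1\<^sub>m m - U * U\<^sup>T) * V) i = sing_val ((1\<^sub>m m - V * V\<^sup>T) * U) i"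
  using singular_values_proj_complement_commute[OF assms] by (simp add: sing_val_def)

text \<open>Orthogonal Procrustes alignment: \<open>W = P * Q\<^sup>T\<close> is the polar factor of
  \<open>V\<^sup>T * U\<close>. In the coordinates \<open>y = Q\<^sup>T *\<^sub>v x\<close> the
  squared length of the difference is twice the sum of the
  \<open>(1 - \<sigma> i) * (y $ i)\<^sup>2\<close>, where \<sigma> lists the cosines of the
  principal angles. Projecting \<open>V *\<^sub>v p i\<close> off the range of \<open>U\<close>
  shows that the squared sine \<open>1 - (\<sigma> i)\<^sup>2\<close> is at most
  \<open>s\<^sup>2\<close>.\<close>

lemma d2_le_sqrt2_sin:
  assumes U: "U \<in> carrier_mat m k" and UU: "U\<^sup>T * U = 1\<^sub>m k"
    and V: "V \<in> carrier_mat m k" and VV: "V\<^sup>T * V = 1\<^sub>m k"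
  shows "d2 U V \<le> sqrt 2 * sing_val ((1\<^sub>m m - U * U\<^sup>T) * V) 1"
proof -
  define s where "s = sing_val ((1\<^sub>m m - U * U\<^sup>T) * V) 1"
  have s: "s \<ge> 0" by (simp add: s_def sing_val_nonneg)
  define C where "C = V\<^sup>T * U"
  have C: "C \<in> carrier_mat k k" using U V by (simp add: C_def)
  have CT: "C\<^sup>T = U\<^sup>T * V"
    using transpose_mult[of "V\<^sup>T" k m U k] U V by (simp add: C_def)
  define \<sigma> where "\<sigma> i = sing_val C (i + 1)" for i
  obtain p q where p: "orthofam k k p" and q: "orthofam k k q"
    and cq: "\<And>i. i < k \<Longrightarrow> C *\<^sub>v q i = \<sigma> i \<cdot>\<^sub>v p i"
    and cp: "\<And>i. i < k \<Longrightarrow> C\<^sup>T *\<^sub>v p i = \<sigma> i \<cdot>\<^sub>v q i"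
    using square_svd[OF C] unfolding \<sigma>_def by metis
  have nonneg: "\<sigma> i \<ge> 0" for i by (simp add: \<sigma>_def sing_val_nonneg)
  have sig: "1 - \<sigma> i \<le> s\<^sup>2" if i: "i < k" for i
  proof -
    have c: "q i \<in> carrier_vec k" "p i \<in> carrier_vec k" "p i \<bullet> p i = 1" "q i \<bullet> q i = 1"
      using p q i by (auto simp: orthofam_def)
    have Vp: "V *\<^sub>v p i \<in> carrier_vec m" using V c by simp
    have "((1\<^sub>m m - U * U\<^sup>T) * V) *\<^sub>v p i = (1\<^sub>m m - U * U\<^sup>T) *\<^sub>v (V *\<^sub>v p i)"
      by (rule assoc_mult_mat_vec[of _ m m _ k]) (use U V c in \<open>auto simp: minus_carrier_mat\<close>)
    moreover have "(1\<^sub>m m - U * U\<^sup>T) * V \<in> carrier_mat m k"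
      using U V by (intro mult_carrier_mat[of _ m m]) (auto simp: minus_carrier_mat)
    ultimately have "(V *\<^sub>v p i) \<bullet> (V *\<^sub>v p i) - (U\<^sup>T *\<^sub>v (V *\<^sub>v p i)) \<bullet> (U\<^sup>T *\<^sub>v (V *\<^sub>v p i)) \<le> s\<^sup>2"
      using mult_vec_norm_le_sing_val[of "(1\<^sub>m m - U * U\<^sup>T) * V" m k "p i"] U V c
      by (simp add: proj_complement_norm[OF U UU Vp] s_def)
    moreover have "U\<^sup>T *\<^sub>v (V *\<^sub>v p i) = \<sigma> i \<cdot>\<^sub>v q i"
      using assoc_mult_mat_vec[of "U\<^sup>T" k m V k "p i"] U V c cp[OF i] by (simp add: CT)
    moreover have "(V *\<^sub>v p i) \<bullet> (V *\<^sub>v p i) = 1"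
      using orthonormal_cols_isometry[OF V VV] c by simp
    ultimately have le: "1 - \<sigma> i * \<sigma> i \<le> s\<^sup>2" using c by simp
    show ?thesis
    \<comment> \<open>A number in the unit interval dominates its square, and for a larger one
      \<open>1 - \<sigma> i\<close> is negative.\<close>
    proof (cases "\<sigma> i \<le> 1")
      case True
      then have "\<sigma> i * \<sigma> i \<le> \<sigma> i" using nonneg[of i] by (simp add: mult_left_le)
      with le show ?thesis by simp
    next
      case False
      then show ?thesis using zero_le_power2[of s] by linarith
    qed
  qed
  define P where "P = fam_mat k k p"
  define Q where "Q = fam_mat k k q"
  have PQ: "P \<in> carrier_mat k k" "Q \<in> carrier_mat k k" by (simp_all add: P_def Q_def)
  have PP: "P\<^sup>T * P = 1\<^sub>m k" and QQ: "Q\<^sup>T * Q = 1\<^sub>m k"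
    using fam_mat_orthonormal[OF p] fam_mat_orthonormal[OF q] by (simp_all add: P_def Q_def)
  have QQ': "Q * Q\<^sup>T = 1\<^sub>m k" by (rule square_orthonormal_commute[OF PQ(2) QQ])
  define W where "W = P * Q\<^sup>T"
  have W: "W \<in> carrier_mat k k" using PQ by (simp add: W_def)
  have WW: "W\<^sup>T * W = 1\<^sub>m k"
  proof -
    have "W\<^sup>T = Q * P\<^sup>T" using transpose_mult[of P k k "Q\<^sup>T" k] PQ by (simp add: W_def)
    then have "W\<^sup>T * W = Q * (P\<^sup>T * (P * Q\<^sup>T))"
      using assoc_mult_mat[of Q k k "P\<^sup>T" k "P * Q\<^sup>T" k] PQ by (simp add: W_def)
    also have "P\<^sup>T * (P * Q\<^sup>T) = Q\<^sup>T"
      using assoc_mult_mat[of "P\<^sup>T" k k P k "Q\<^sup>T" k] PQ PP by simp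
    finally show ?thesis by (simp add: QQ')
  qed
  have "spectral_norm (U - V * W) \<le> sqrt 2 * s"
    unfolding spectral_norm_def
  proof (rule sing_val_1_le)
    show "U - V * W \<in> carrier_mat m k" using U V W by (simp add: minus_carrier_mat)
    show "0 \<le> sqrt 2 * s" using s by simp
    fix x :: "real vec" assume x: "x \<in> carrier_vec k"
    define y where "y = Q\<^sup>T *\<^sub>v x"
    have y: "y \<in> carrier_vec k" using PQ x by (simp add: y_def)
    have xQ: "x = Q *\<^sub>v y"
      using assoc_mult_mat_vec[of Q k k "Q\<^sup>T" k x] PQ x QQ' by (simp add: y_def)
    have Wx: "W *\<^sub>v x = P *\<^sub>v y"
      unfolding W_def y_def by (rule assoc_mult_mat_vec[of _ k k _ k]) (use PQ x in auto)
    have Py: "P *\<^sub>v y \<in> carrier_vec k" using PQ y by simp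
    have "(U - V * W) *\<^sub>v x = U *\<^sub>v x - (V * W) *\<^sub>v x"
      by (rule minus_mult_distrib_mat_vec[of _ m k]) (use U V W x in auto)
    also have "(V * W) *\<^sub>v x = V *\<^sub>v (P *\<^sub>v y)"
      unfolding Wx[symmetric] by (rule assoc_mult_mat_vec[of _ m k _ k]) (use V W x in auto)
    finally have eq: "(U - V * W) *\<^sub>v x = U *\<^sub>v x - V *\<^sub>v (P *\<^sub>v y)" .
    have c: "U *\<^sub>v x \<in> carrier_vec m" "V *\<^sub>v (P *\<^sub>v y) \<in> carrier_vec m" using U V x Py by auto
    have xx: "x \<bullet> x = y \<bullet> y" using orthonormal_cols_isometry[OF PQ(2) QQ y y] xQ by simp
    have 1: "(U *\<^sub>v x) \<bullet> (U *\<^sub>v x) = y \<bullet> y"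
      using orthonormal_cols_isometry[OF U UU x x] xx by simp
    have 2: "(V *\<^sub>v (P *\<^sub>v y)) \<bullet> (V *\<^sub>v (P *\<^sub>v y)) = y \<bullet> y"
      using orthonormal_cols_isometry[OF V VV Py Py] orthonormal_cols_isometry[OF PQ(1) PP y y] by simp
    have "(V *\<^sub>v (P *\<^sub>v y)) \<bullet> (U *\<^sub>v x) = (P *\<^sub>v y) \<bullet> (V\<^sup>T *\<^sub>v (U *\<^sub>v x))"
      by (rule scalar_prod_mult_mat_vec[OF V Py c(1)])
    also have "V\<^sup>T *\<^sub>v (U *\<^sub>v x) = C *\<^sub>v x"
      unfolding C_def by (rule assoc_mult_mat_vec[symmetric, of _ k m _ k]) (use U V x in auto)
    also have "(P *\<^sub>v y) \<bullet> (C *\<^sub>v x) = y \<bullet> (P\<^sup>T *\<^sub>v (C *\<^sub>v x))"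
      by (rule scalar_prod_mult_mat_vec[OF PQ(1) y]) (use C x in auto)
    also have "P\<^sup>T *\<^sub>v (C *\<^sub>v x) = vec k (\<lambda>i. \<sigma> i * y $ i)"
    proof (intro eq_vecI)
      fix i assume "i < dim_vec (vec k (\<lambda>i. \<sigma> i * y $ i))"
      then have i: "i < k" by simp
      have ci: "q i \<in> carrier_vec k" "p i \<in> carrier_vec k" using p q i by (auto simp: orthofam_def)
      have "(P\<^sup>T *\<^sub>v (C *\<^sub>v x)) $ i = p i \<bullet> (C *\<^sub>v x)"
        using i ci by (simp add: P_def col_fam_mat)
      also have "\<dots> = (C\<^sup>T *\<^sub>v p i) \<bullet> x"
        by (rule transpose_vec_mult_scalar[OF C x ci(2), symmetric])
      also have "\<dots> = \<sigma> i * y $ i"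
        using i ci x by (simp add: cp[OF i] y_def Q_def col_fam_mat)
      finally show "(P\<^sup>T *\<^sub>v (C *\<^sub>v x)) $ i = vec k (\<lambda>i. \<sigma> i * y $ i) $ i" using i by simp
    qed (use PQ in auto)
    also have "y \<bullet> vec k (\<lambda>i. \<sigma> i * y $ i) = (\<Sum>i<k. \<sigma> i * (y $ i)\<^sup>2)"
      using y by (simp add: scalar_prod_def atLeast0LessThan power2_eq_square ac_simps)
    finally have 3: "(V *\<^sub>v (P *\<^sub>v y)) \<bullet> (U *\<^sub>v x) = (\<Sum>i<k. \<sigma> i * (y $ i)\<^sup>2)" .
    have 4: "(U *\<^sub>v x) \<bullet> (V *\<^sub>v (P *\<^sub>v y)) = (\<Sum>i<k. \<sigma> i * (y $ i)\<^sup>2)"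
      using 3 comm_scalar_prod[OF c] by simp
    have yy: "y \<bullet> y = (\<Sum>i<k. (y $ i)\<^sup>2)"
      using y by (simp add: scalar_prod_def atLeast0LessThan power2_eq_square)
    have "((U - V * W) *\<^sub>v x) \<bullet> ((U - V * W) *\<^sub>v x) = 2 * (\<Sum>i<k. (1 - \<sigma> i) * (y $ i)\<^sup>2)"
      unfolding eq using c 1 2 3 4 yy
      by (simp add: minus_scalar_prod_distrib[of _ m] scalar_prod_minus_distrib[of _ m]
          left_diff_distrib sum_subtractf)
    also have "\<dots> \<le> 2 * (\<Sum>i<k. s\<^sup>2 * (y $ i)\<^sup>2)"
      by (intro mult_left_mono sum_mono mult_right_mono sig) auto
    also have "\<dots> = (sqrt 2 * s)\<^sup>2 * (x \<bullet> x)"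
      by (simp add: xx yy power_mult_distrib sum_distrib_left mult.assoc)
    finally show "((U - V * W) *\<^sub>v x) \<bullet> ((U - V * W) *\<^sub>v x) \<le> (sqrt 2 * s)\<^sup>2 * (x \<bullet> x)" .
  qed
  moreover have "d2 U V \<le> spectral_norm (U - V * W)"
    unfolding d2_def
  proof (rule cINF_lower)
    show "bdd_below ((\<lambda>W. spectral_norm (U - V * W)) `
        {W \<in> carrier_mat (dim_col V) (dim_col V). orthonormal_cols W})"
      by (auto simp: spectral_norm_def sing_val_nonneg intro!: bdd_belowI[of _ 0])
    show "W \<in> {W \<in> carrier_mat (dim_col V) (dim_col V). orthonormal_cols W}"
      using V W WW by (auto simp: orthonormal_cols_def)
  qed
  ultimately show ?thesis by (simp add: s_def)
qed

section \<open>Monotonicity of symmetric gauges\<close>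

lemma
  assumes "symmetric_gauge \<Phi>" "finite {i. x i \<noteq> 0}"
  shows symmetric_gauge_scale: "\<Phi> (\<lambda>i. c * x i) = \<bar>c\<bar> * \<Phi> x"
    and symmetric_gauge_triangle:
      "finite {i. y i \<noteq> 0} \<Longrightarrow> \<Phi> (\<lambda>i. x i + y i) \<le> \<Phi> x + \<Phi> y"
    and symmetric_gauge_sign: "(\<And>i. s i = 1 \<or> s i = -1) \<Longrightarrow> \<Phi> (\<lambda>i. s i * x i) = \<Phi> x"
  using assms unfolding symmetric_gauge_def by simp_all

text \<open>Lowering coordinate \<open>j\<close> by the factor \<open>t\<close> in the unit interval
  is a convex combination of \<open>y\<close> and of \<open>y\<close> with the sign of that
  coordinate flipped, with weights \<open>(1 + t) / 2\<close> and \<open>(1 - t) / 2\<close>. Both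
  vectors have the same gauge.\<close>

lemma symmetric_gauge_mono_coord:
  assumes \<Phi>: "symmetric_gauge \<Phi>" and fin: "finite {i. y i \<noteq> 0}" and x: "0 \<le> x" "x \<le> y j"
  shows "\<Phi> (y(j := x)) \<le> \<Phi> y"
proof (cases "y j = 0")
  case True
  then have "y(j := x) = y" using x by (auto simp: fun_eq_iff)
  then show ?thesis by simp
next
  case False
  then have yj: "y j > 0" using x by auto
  define t where "t = x / y j"
  have t: "0 \<le> t" "t \<le> 1" using x yj by (auto simp: t_def)
  define s :: "nat \<Rightarrow> real" where "s i = (if i = j then -1 else 1)" for i
  let ?a = "(1 + t) / 2" and ?b = "(1 - t) / 2"
  have fins: "finite {i. s i * y i \<noteq> 0}" by (rule finite_subset[OF _ fin]) auto
  have fa: "finite {i. ?a * y i \<noteq> 0}" by (rule finite_subset[OF _ fin]) auto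
  have fb: "finite {i. ?b * (s i * y i) \<noteq> 0}" by (rule finite_subset[OF _ fin]) auto
  have s: "s i = 1 \<or> s i = -1" for i by (simp add: s_def)
  have "y(j := x) = (\<lambda>i. ?a * y i + ?b * (s i * y i))"
    using yj by (auto simp: fun_eq_iff s_def t_def field_simps)
  then have "\<Phi> (y(j := x)) \<le> \<Phi> (\<lambda>i. ?a * y i) + \<Phi> (\<lambda>i. ?b * (s i * y i))"
    using symmetric_gauge_triangle[OF \<Phi> fa fb] by simp
  moreover have "\<Phi> (\<lambda>i. ?a * y i) = ?a * \<Phi> y"
    using symmetric_gauge_scale[OF \<Phi> fin, of ?a] t by simp
  moreover have "\<Phi> (\<lambda>i. ?b * (s i * y i)) = ?b * \<Phi> y"
    using symmetric_gauge_scale[OF \<Phi> fins, of ?b] symmetric_gauge_sign[OF \<Phi> fin s] t by simp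
  ultimately show ?thesis by (simp add: field_simps)
qed

text \<open>Coordinates are lowered one at a time over the finite support of \<open>y\<close>; off
  this support \<open>x\<close> vanishes together with \<open>y\<close>.\<close>

lemma symmetric_gauge_mono:
  assumes \<Phi>: "symmetric_gauge \<Phi>" and fin: "finite {i. y i \<noteq> 0}"
    and x: "\<And>i. 0 \<le> x i" "\<And>i. x i \<le> y i"
  shows "\<Phi> x \<le> \<Phi> y"
proof -
  define S where "S = {i. y i \<noteq> 0}"
  have "\<Phi> (\<lambda>i. if i \<in> T then x i else y i) \<le> \<Phi> y" if "finite T" for T
    using that
  proof (induction T rule: finite_induct)
    case (insert j T)
    let ?z = "\<lambda>i. if i \<in> T then x i else y i"
    have "finite {i. ?z i \<noteq> 0}"
      by (rule finite_subset[of _ "T \<union> S"]) (use insert fin in \<open>auto simp: S_def\<close>)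
    from symmetric_gauge_mono_coord[OF \<Phi> this, of "x j" j]
    have "\<Phi> (?z(j := x j)) \<le> \<Phi> ?z" using x insert by simp
    moreover have "?z(j := x j) = (\<lambda>i. if i \<in> insert j T then x i else y i)"
      by (auto simp: fun_eq_iff)
    ultimately show ?case using insert by simp
  qed simp
  from this[of S] fin have "\<Phi> (\<lambda>i. if i \<in> S then x i else y i) \<le> \<Phi> y" by (simp add: S_def)
  moreover have "(\<lambda>i. if i \<in> S then x i else y i) = x"
  proof
    fix i show "(if i \<in> S then x i else y i) = x i" using x(1)[of i] x(2)[of i] by (auto simp: S_def)
  qed
  ultimately show ?thesis by simp
qed

section \<open>Two-block forms and their action on vectors\<close>

lemma mat_diag_mult_vec:
  "x \<in> carrier_vec n \<Longrightarrow> mat_diag n d *\<^sub>v x = vec n (\<lambda>i. d i * x $ i :: real)"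
  by (intro eq_vecI)
    (auto simp: mat_diag_def scalar_prod_def if_distrib if_distribR sum.delta cong: if_cong)

lemma svd_form_mult_vec:
  assumes "U \<in> carrier_mat m k" "S \<in> carrier_mat k k" "V \<in> carrier_mat n k"
    "U' \<in> carrier_mat m r" "S' \<in> carrier_mat r r" "V' \<in> carrier_mat n r" "x \<in> carrier_vec n"
  shows "(U * S * V\<^sup>T + U' * S' * V'\<^sup>T) *\<^sub>v (x :: real vec)
    = U *\<^sub>v (S *\<^sub>v (V\<^sup>T *\<^sub>v x)) + U' *\<^sub>v (S' *\<^sub>v (V'\<^sup>T *\<^sub>v x))"
proof -
  have *: "(U * S * V\<^sup>T) *\<^sub>v x = U *\<^sub>v (S *\<^sub>v (V\<^sup>T *\<^sub>v x))"
    if "U \<in> carrier_mat m k" "S \<in> carrier_mat k k" "V \<in> carrier_mat n k" for k U S V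
  proof -
    have "(U * S * V\<^sup>T) *\<^sub>v x = (U * S) *\<^sub>v (V\<^sup>T *\<^sub>v x)"
      by (rule assoc_mult_mat_vec[of _ m k _ n]) (use that assms(7) in auto)
    also have "\<dots> = U *\<^sub>v (S *\<^sub>v (V\<^sup>T *\<^sub>v x))"
      by (rule assoc_mult_mat_vec[of _ m k _ k]) (use that assms(7) in auto)
    finally show ?thesis .
  qed
  have "(U * S * V\<^sup>T + U' * S' * V'\<^sup>T) *\<^sub>v x = (U * S * V\<^sup>T) *\<^sub>v x + (U' * S' * V'\<^sup>T) *\<^sub>v x"
    by (rule add_mult_distrib_mat_vec[of _ m n]) (use assms in auto)
  then show ?thesis using *[OF assms(1-3)] *[OF assms(4-6)] by (simp only:)
qed

lemma svd_form_transpose: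
  assumes "U \<in> carrier_mat m k" "S \<in> carrier_mat k k" "V \<in> carrier_mat n k"
    "U' \<in> carrier_mat m r" "S' \<in> carrier_mat r r" "V' \<in> carrier_mat n r"
  shows "(U * S * V\<^sup>T + U' * S' * V'\<^sup>T)\<^sup>T
    = V * S\<^sup>T * U\<^sup>T + V' * S'\<^sup>T * (U' :: real mat)\<^sup>T"
proof -
  have *: "(U * S * V\<^sup>T)\<^sup>T = V * S\<^sup>T * U\<^sup>T"
    if "U \<in> carrier_mat m k" "S \<in> carrier_mat k k" "V \<in> carrier_mat n k" for k and U S V :: "real mat"
  proof -
    have "(U * S * V\<^sup>T)\<^sup>T = V * (U * S)\<^sup>T"
      using transpose_mult[of "U * S" m k "V\<^sup>T" n] that by simp
    also have "(U * S)\<^sup>T = S\<^sup>T * U\<^sup>T" by (rule transpose_mult[of _ m k _ k]) (use that in auto)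
    also have "V * (S\<^sup>T * U\<^sup>T) = V * S\<^sup>T * U\<^sup>T"
      by (rule assoc_mult_mat[symmetric, of _ n k _ k _ m]) (use that in auto)
    finally show ?thesis .
  qed
  have "(U * S * V\<^sup>T + U' * S' * V'\<^sup>T)\<^sup>T = (U * S * V\<^sup>T)\<^sup>T + (U' * S' * V'\<^sup>T)\<^sup>T"
    by (rule transpose_add[of _ m n]) (use assms in auto)
  then show ?thesis using *[OF assms(1-3)] *[OF assms(4-6)] by (simp only:)
qed

lemma transpose_mat_diag [simp]: "(mat_diag n d)\<^sup>T = mat_diag n d"
  by (auto simp: mat_diag_def)

lemma cross_zero_transpose:
  assumes "U \<in> carrier_mat m k" "U' \<in> carrier_mat m r" "U\<^sup>T * U' = 0\<^sub>m k r"
  shows "U'\<^sup>T * U = (0\<^sub>m r k :: real mat)"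
proof -
  have "U'\<^sup>T * U = (U\<^sup>T * U')\<^sup>T"
    using transpose_mult[of "U\<^sup>T" k m U' r] assms by simp
  then show ?thesis using assms by simp
qed

lemma two_block_action:
  assumes U: "U \<in> carrier_mat m k" and UU: "U\<^sup>T * U = 1\<^sub>m k" and U': "U' \<in> carrier_mat m r"
    and x: "U\<^sup>T * U' = 0\<^sub>m k r" and a: "a \<in> carrier_vec k" and b: "b \<in> carrier_vec r"
  shows "U\<^sup>T *\<^sub>v (U *\<^sub>v a + U' *\<^sub>v b) = (a :: real vec)"
proof -
  have "U\<^sup>T *\<^sub>v (U *\<^sub>v a + U' *\<^sub>v b) = U\<^sup>T *\<^sub>v (U *\<^sub>v a) + U\<^sup>T *\<^sub>v (U' *\<^sub>v b)"
    by (rule mult_add_distrib_mat_vec[of _ k m]) (use U U' a b in auto)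
  also have "U\<^sup>T *\<^sub>v (U *\<^sub>v a) = (U\<^sup>T * U) *\<^sub>v a"
    by (rule assoc_mult_mat_vec[symmetric, of _ k m _ k]) (use U a in auto)
  also have "U\<^sup>T *\<^sub>v (U' *\<^sub>v b) = (U\<^sup>T * U') *\<^sub>v b"
    by (rule assoc_mult_mat_vec[symmetric, of _ k m _ r]) (use U U' b in auto)
  also have "(U\<^sup>T * U) *\<^sub>v a + (U\<^sup>T * U') *\<^sub>v b = a"
    unfolding UU x using a b by (auto intro!: eq_vecI)
  finally show ?thesis .
qed

text \<open>The blocks need not fill the space, since \<open>k + r\<close> may be smaller than
  \<open>m\<close>. Combining columns preserves lengths, but reading off coefficients obeys only
  Bessel's inequality.\<close>

locale two_blocks =
  fixes U U' :: "real mat" and m k r :: nat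
  assumes U: "U \<in> carrier_mat m k" and U': "U' \<in> carrier_mat m r"
    and UU: "U\<^sup>T * U = 1\<^sub>m k" and UU': "U'\<^sup>T * U' = 1\<^sub>m r" and cross: "U\<^sup>T * U' = 0\<^sub>m k r"
begin

lemma first: "a \<in> carrier_vec k \<Longrightarrow> b \<in> carrier_vec r \<Longrightarrow> U\<^sup>T *\<^sub>v (U *\<^sub>v a + U' *\<^sub>v b) = a"
  by (rule two_block_action[OF U UU U' cross])

lemma second:
  assumes a: "a \<in> carrier_vec k" and b: "b \<in> carrier_vec r"
  shows "U'\<^sup>T *\<^sub>v (U *\<^sub>v a + U' *\<^sub>v b) = b"
proof -
  have "U *\<^sub>v a + U' *\<^sub>v b = U' *\<^sub>v b + U *\<^sub>v a"
    using U U' a b by (intro comm_add_vec[of _ m]) auto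
  then show ?thesis
    using two_block_action[OF U' UU' U cross_zero_transpose[OF U U' cross] b a] by simp
qed

lemma norm:
  assumes a: "a \<in> carrier_vec k" and b: "b \<in> carrier_vec r"
  shows "(U *\<^sub>v a + U' *\<^sub>v b) \<bullet> (U *\<^sub>v a + U' *\<^sub>v b) = a \<bullet> a + b \<bullet> b"
proof -
  let ?x = "U *\<^sub>v a + U' *\<^sub>v b"
  have c: "U *\<^sub>v a \<in> carrier_vec m" "U' *\<^sub>v b \<in> carrier_vec m" "?x \<in> carrier_vec m" using U U' a b by auto
  have "?x \<bullet> ?x = (U *\<^sub>v a) \<bullet> ?x + (U' *\<^sub>v b) \<bullet> ?x"
    by (rule add_scalar_prod_distrib[OF c(1,2,3)])
  also have "(U *\<^sub>v a) \<bullet> ?x = a \<bullet> (U\<^sup>T *\<^sub>v ?x)" by (rule scalar_prod_mult_mat_vec[OF U a c(3)])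
  also have "(U' *\<^sub>v b) \<bullet> ?x = b \<bullet> (U'\<^sup>T *\<^sub>v ?x)" by (rule scalar_prod_mult_mat_vec[OF U' b c(3)])
  finally show ?thesis by (simp add: first[OF a b] second[OF a b])
qed

lemma bessel:
  assumes x: "x \<in> carrier_vec m"
  shows "(U\<^sup>T *\<^sub>v x) \<bullet> (U\<^sup>T *\<^sub>v x) + (U'\<^sup>T *\<^sub>v x) \<bullet> (U'\<^sup>T *\<^sub>v x) \<le> x \<bullet> x"
proof -
  define a b where "a = U\<^sup>T *\<^sub>v x" and "b = U'\<^sup>T *\<^sub>v x"
  have a: "a \<in> carrier_vec k" and b: "b \<in> carrier_vec r" using U U' x by (auto simp: a_def b_def)
  let ?y = "U *\<^sub>v a + U' *\<^sub>v b"
  have c: "U *\<^sub>v a \<in> carrier_vec m" "U' *\<^sub>v b \<in> carrier_vec m" "?y \<in> carrier_vec m" using U U' a b by auto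
  have 1: "?y \<bullet> x = a \<bullet> a + b \<bullet> b"
    using add_scalar_prod_distrib[OF c(1,2) x] scalar_prod_mult_mat_vec[OF U a x]
      scalar_prod_mult_mat_vec[OF U' b x] by (simp add: a_def b_def)
  have 2: "x \<bullet> ?y = a \<bullet> a + b \<bullet> b" using 1 comm_scalar_prod[OF x c(3)] by simp
  have "(x - ?y) \<bullet> (x - ?y) = x \<bullet> x - (a \<bullet> a + b \<bullet> b)"
    using minus_scalar_prod_distrib[of x m ?y "x - ?y"] scalar_prod_minus_distrib[of x m x ?y]
      scalar_prod_minus_distrib[of ?y m x ?y] x c 1 2 norm[OF a b] by simp
  then show ?thesis using scalar_prod_self_nonneg[of "x - ?y"] by (simp add: a_def b_def)
qed

end

section \<open>The deterministic error bound for a sketch\<close>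

lemma svd_splitD:
  assumes "svd_split k M U S V U' S' V'" "M \<in> carrier_mat m n"
  defines "r \<equiv> min m n - k"
  shows "two_blocks U U' m k r" "two_blocks V V' n k r"
    "S = mat_diag k (\<lambda>i. sing_val M (i + 1))" "S' = mat_diag r (\<lambda>i. sing_val M (k + i + 1))"
    "M = U * S * V\<^sup>T + U' * S' * V'\<^sup>T"
proof -
  have dims: "dim_row M = m" "dim_col M = n" using assms(2) by auto
  note * = assms(1)[unfolded svd_split_def Let_def dims orthonormal_cols_def, folded r_def]
  have c: "U \<in> carrier_mat m k" "V \<in> carrier_mat n k" "U' \<in> carrier_mat m r" "V' \<in> carrier_mat n r"
    using * by blast+
  have d: "dim_col U = k" "dim_col V = k" "dim_col U' = r" "dim_col V' = r" using c by auto
  note ** = *[unfolded d]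
  show "two_blocks U U' m k r" "two_blocks V V' n k r" using ** unfolding two_blocks_def by blast+
  show "S = mat_diag k (\<lambda>i. sing_val M (i + 1))" "S' = mat_diag r (\<lambda>i. sing_val M (k + i + 1))"
    "M = U * S * V\<^sup>T + U' * S' * V'\<^sup>T" using ** by blast+
qed

text \<open>The entries have to be bounded only where \<open>a\<close> is nonzero. Thus a vector
  whose leading coordinates vanish sees only the later, smaller diagonal entries.\<close>

lemma diag_norm_le:
  assumes "a \<in> carrier_vec k" "\<And>i. i < k \<Longrightarrow> a $ i \<noteq> 0 \<Longrightarrow> \<bar>d i\<bar> \<le> t"
  shows "(mat_diag k d *\<^sub>v a) \<bullet> (mat_diag k d *\<^sub>v a) \<le> t\<^sup>2 * (a \<bullet> (a :: real vec))"
proof -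
  have "(mat_diag k d *\<^sub>v a) \<bullet> (mat_diag k d *\<^sub>v a) = (\<Sum>i<k. (d i)\<^sup>2 * (a $ i)\<^sup>2)"
    using assms(1)
    by (simp add: mat_diag_mult_vec scalar_prod_def atLeast0LessThan power2_eq_square ac_simps)
  also have "\<dots> \<le> (\<Sum>i<k. t\<^sup>2 * (a $ i)\<^sup>2)"
  proof (intro sum_mono)
    fix i assume i: "i \<in> {..<k}"
    show "(d i)\<^sup>2 * (a $ i)\<^sup>2 \<le> t\<^sup>2 * (a $ i)\<^sup>2"
    proof (cases "a $ i = 0")
      case False
      then have "\<bar>d i\<bar> \<le> t" using assms(2) i by simp
      then have "\<bar>d i\<bar>\<^sup>2 \<le> t\<^sup>2" by (intro power_mono) auto
      then show ?thesis by (intro mult_right_mono) auto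
    qed simp
  qed
  also have "\<dots> = t\<^sup>2 * (a \<bullet> a)"
    using assms(1) by (simp add: scalar_prod_def atLeast0LessThan power2_eq_square sum_distrib_left)
  finally show ?thesis .
qed

lemma diag_norm_ge:
  assumes "a \<in> carrier_vec k" "\<And>i. i < k \<Longrightarrow> t \<le> d i" "t \<ge> 0"
  shows "(mat_diag k d *\<^sub>v a) \<bullet> (mat_diag k d *\<^sub>v a) \<ge> t\<^sup>2 * (a \<bullet> (a :: real vec))"
proof -
  have "t\<^sup>2 * (a \<bullet> a) = (\<Sum>i<k. t\<^sup>2 * (a $ i)\<^sup>2)"
    using assms(1) by (simp add: scalar_prod_def atLeast0LessThan power2_eq_square sum_distrib_left)
  also have "\<dots> \<le> (\<Sum>i<k. (d i)\<^sup>2 * (a $ i)\<^sup>2)"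
    using assms by (intro sum_mono mult_right_mono power_mono) auto
  also have "\<dots> = (mat_diag k d *\<^sub>v a) \<bullet> (mat_diag k d *\<^sub>v a)"
    using assms(1)
    by (simp add: mat_diag_mult_vec scalar_prod_def atLeast0LessThan power2_eq_square ac_simps)
  finally show ?thesis .
qed

text \<open>The range of \<open>U\<close> has dimension \<open>k\<close>, so it contains a unit
  vector orthogonal to the first \<open>k - 1\<close> left singular vectors of \<open>Y\<close>.
  There \<open>Y\<^sup>T\<close> stretches by at most the \<open>k\<close>-th singular value, and by
  hypothesis by at least \<open>t\<close>.\<close>

lemma sing_val_ge_of_compression:
  assumes svd: "svd_split k Y Uh Sh Vh Uh' Sh' Vh'" and Y: "Y \<in> carrier_mat m n"
    and k: "k \<ge> 1" and U: "U \<in> carrier_mat m k" and UU: "U\<^sup>T * U = 1\<^sub>m k" and t: "t \<ge> 0"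
    and ge: "\<And>x. x \<in> carrier_vec k \<Longrightarrow> t\<^sup>2 * (x \<bullet> x) \<le> (Y\<^sup>T *\<^sub>v (U *\<^sub>v x)) \<bullet> (Y\<^sup>T *\<^sub>v (U *\<^sub>v x))"
  shows "t \<le> sing_val Y k"
proof -
  define r where "r = min m n - k"
  note D = svd_splitD[OF svd Y, folded r_def]
  interpret L: two_blocks Uh Uh' m k r by (rule D(1))
  interpret R: two_blocks Vh Vh' n k r by (rule D(2))
  have cU: "U\<^sup>T *\<^sub>v col Uh l \<in> carrier_vec k" if "l < k - 1" for l
    using that U L.U by auto
  from orthogonal_vector_exists[of "k - 1" "\<lambda>l. U\<^sup>T *\<^sub>v col Uh l" k, OF cU] k obtain x where
    x: "x \<in> carrier_vec k" "x \<bullet> x = 1" "\<And>l. l < k - 1 \<Longrightarrow> (U\<^sup>T *\<^sub>v col Uh l) \<bullet> x = 0" by auto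
  define u where "u = U *\<^sub>v x"
  have u: "u \<in> carrier_vec m" using U x by (simp add: u_def)
  have uu: "u \<bullet> u = 1" using orthonormal_cols_isometry[OF U UU x(1) x(1)] x by (simp add: u_def)
  define a b where "a = Uh\<^sup>T *\<^sub>v u" and "b = Uh'\<^sup>T *\<^sub>v u"
  have a: "a \<in> carrier_vec k" and b: "b \<in> carrier_vec r" using L.U L.U' u by (auto simp: a_def b_def)
  have a0: "a $ l = 0" if "l < k - 1" for l
  proof -
    have "a $ l = col Uh l \<bullet> u" using that L.U by (simp add: a_def)
    also have "\<dots> = (U\<^sup>T *\<^sub>v col Uh l) \<bullet> x"
      unfolding u_def by (rule transpose_vec_mult_scalar[symmetric, OF U x(1)]) (use L.U that in auto)
    finally show ?thesis using x(3)[OF that] by simp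
  qed
  have S: "Sh \<in> carrier_mat k k" "Sh' \<in> carrier_mat r r" by (simp_all add: D(3,4))
  have ST: "Sh\<^sup>T = Sh" "Sh'\<^sup>T = Sh'" unfolding D(3,4) by simp_all
  have "Y\<^sup>T = (Uh * Sh * Vh\<^sup>T + Uh' * Sh' * Vh'\<^sup>T)\<^sup>T" by (rule arg_cong[OF D(5)])
  also have "\<dots> = Vh * Sh * Uh\<^sup>T + Vh' * Sh' * Uh'\<^sup>T"
    using svd_form_transpose[OF L.U S(1) R.U L.U' S(2) R.U'] unfolding ST .
  finally have "Y\<^sup>T *\<^sub>v u = Vh *\<^sub>v (Sh *\<^sub>v a) + Vh' *\<^sub>v (Sh' *\<^sub>v b)"
    using svd_form_mult_vec[OF R.U S(1) L.U R.U' S(2) L.U' u] by (simp add: a_def b_def)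
  then have "(Y\<^sup>T *\<^sub>v u) \<bullet> (Y\<^sup>T *\<^sub>v u) = (Sh *\<^sub>v a) \<bullet> (Sh *\<^sub>v a) + (Sh' *\<^sub>v b) \<bullet> (Sh' *\<^sub>v b)"
    using R.norm[of "Sh *\<^sub>v a" "Sh' *\<^sub>v b"] S a b by simp
  also have "(Sh *\<^sub>v a) \<bullet> (Sh *\<^sub>v a) \<le> (sing_val Y k)\<^sup>2 * (a \<bullet> a)"
    unfolding D(3)
  proof (rule diag_norm_le[OF a])
    fix i assume "i < k" "a $ i \<noteq> 0"
    \<comment> \<open>Only the last coordinate of \<open>a\<close> can be nonzero, so the first
      block contributes no more than the \<open>k\<close>-th singular value.\<close>
    then have "i + 1 = k" using a0[of i] k by linarith
    then show "\<bar>sing_val Y (i + 1)\<bar> \<le> sing_val Y k" by (simp add: sing_val_nonneg)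
  qed
  also have "(Sh' *\<^sub>v b) \<bullet> (Sh' *\<^sub>v b) \<le> (sing_val Y k)\<^sup>2 * (b \<bullet> b)"
    unfolding D(4) using k by (intro diag_norm_le[OF b]) (simp add: sing_val_nonneg sing_val_antimono)
  also have "(sing_val Y k)\<^sup>2 * (a \<bullet> a) + (sing_val Y k)\<^sup>2 * (b \<bullet> b) \<le> (sing_val Y k)\<^sup>2 * 1"
    using L.bessel[OF u] uu unfolding a_def b_def distrib_left[symmetric]
    by (intro mult_left_mono) auto
  finally have "t\<^sup>2 \<le> (sing_val Y k)\<^sup>2" using ge[OF x(1)] x(2) by (simp add: u_def)
  then show ?thesis by (rule power2_le_imp_le) (rule sing_val_nonneg)
qed

text \<open>\<open>Z\<close> and \<open>Z'\<close> are the transposes of \<Omega>_1 and \<Omega>_2.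
  The number \<open>s\<close> bounds the smallest singular value of the first from below,
  \<open>b\<close> the norm of the second from above. Keeping the index \<open>i\<close> in the
  conclusion is what later gives every unitarily invariant norm at once.\<close>

theorem sin_theta_sketch_bound:
  assumes UB: "two_blocks U U' m k r" and Z: "Z \<in> carrier_mat n k" and Z': "Z' \<in> carrier_mat n r"
    and Y: "Y = U * mat_diag k d * Z\<^sup>T + U' * mat_diag r d' * Z'\<^sup>T"
    and lead: "leading_left_singular_vectors k Y Uh"
    and k: "k \<ge> 1" and s: "s > 0" and dk: "dk > 0" and b: "b \<ge> 0"
    and d: "\<And>i. i < k \<Longrightarrow> dk \<le> d i"
    and d': "\<And>i. i < r \<Longrightarrow> d' i \<ge> 0" "\<And>i j. i \<le> j \<Longrightarrow> j < r \<Longrightarrow> d' j \<le> d' i"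
    and Zs: "\<And>x. x \<in> carrier_vec k \<Longrightarrow> s\<^sup>2 * (x \<bullet> x) \<le> (Z *\<^sub>v x) \<bullet> (Z *\<^sub>v x)"
    and Zb: "\<And>z. z \<in> carrier_vec n \<Longrightarrow> (Z'\<^sup>T *\<^sub>v z) \<bullet> (Z'\<^sup>T *\<^sub>v z) \<le> b\<^sup>2 * (z \<bullet> z)"
  shows "Uh \<in> carrier_mat m k" "Uh\<^sup>T * Uh = 1\<^sub>m k"
    "sing_val ((1\<^sub>m m - Uh * Uh\<^sup>T) * U) (i + 1) \<le> (if i < r then d' i else 0) * (b / (s * dk))"
proof -
  interpret B: two_blocks U U' m k r by (rule UB)
  let ?D = "mat_diag k d" and ?D' = "mat_diag r d'"
  have Yc: "Y \<in> carrier_mat m n" using B.U B.U' Z Z' by (auto simp: Y)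
  obtain Sh Vh Uh' Sh' Vh' where svd: "svd_split k Y Uh Sh Vh Uh' Sh' Vh'"
    using lead by (auto simp: leading_left_singular_vectors_def)
  define r' where "r' = min m n - k"
  note D = svd_splitD[OF svd Yc, folded r'_def]
  interpret L: two_blocks Uh Uh' m k r' by (rule D(1))
  interpret R: two_blocks Vh Vh' n k r' by (rule D(2))
  show Uh: "Uh \<in> carrier_mat m k" and UhUh: "Uh\<^sup>T * Uh = 1\<^sub>m k" by (rule L.U L.UU)+
  define \<sigma> where "\<sigma> = sing_val Y k"
  have Yact: "Y *\<^sub>v z = U *\<^sub>v (?D *\<^sub>v (Z\<^sup>T *\<^sub>v z)) + U' *\<^sub>v (?D' *\<^sub>v (Z'\<^sup>T *\<^sub>v z))"
    if "z \<in> carrier_vec n" for z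
    unfolding Y by (rule svd_form_mult_vec[OF B.U _ Z B.U' _ Z' that]) auto
  have YT: "Y\<^sup>T = Z * ?D * U\<^sup>T + Z' * ?D' * U'\<^sup>T"
    unfolding Y using svd_form_transpose[OF B.U _ Z B.U' _ Z', of ?D ?D'] by simp
  have "s * dk \<le> \<sigma>"
    unfolding \<sigma>_def
  proof (rule sing_val_ge_of_compression[OF svd Yc k B.U B.UU])
    show "0 \<le> s * dk" using s dk by simp
    fix x :: "real vec" assume x: "x \<in> carrier_vec k"
    have Ux: "U *\<^sub>v x \<in> carrier_vec m" using B.U x by simp
    \<comment> \<open>A zero second coefficient brings the vector into the form that
      \<open>B.first\<close> and \<open>B.second\<close> read.\<close>
    have "U *\<^sub>v x = U *\<^sub>v x + U' *\<^sub>v 0\<^sub>v r" using B.U B.U' Ux by (auto intro!: eq_vecI)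
    then have 1: "U\<^sup>T *\<^sub>v (U *\<^sub>v x) = x" and 2: "U'\<^sup>T *\<^sub>v (U *\<^sub>v x) = 0\<^sub>v r"
      using B.first[OF x, of "0\<^sub>v r"] B.second[OF x, of "0\<^sub>v r"] by auto
    have "Y\<^sup>T *\<^sub>v (U *\<^sub>v x) = Z *\<^sub>v (?D *\<^sub>v (U\<^sup>T *\<^sub>v (U *\<^sub>v x))) + Z' *\<^sub>v (?D' *\<^sub>v (U'\<^sup>T *\<^sub>v (U *\<^sub>v x)))"
      unfolding YT by (rule svd_form_mult_vec[OF Z _ B.U Z' _ B.U' Ux]) auto
    also have "?D' *\<^sub>v (U'\<^sup>T *\<^sub>v (U *\<^sub>v x)) = 0\<^sub>v r"
      by (auto simp: 2 mat_diag_mult_vec)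
    also have "Z' *\<^sub>v 0\<^sub>v r = 0\<^sub>v n" using Z' by (auto intro!: eq_vecI)
    also have "Z *\<^sub>v (?D *\<^sub>v (U\<^sup>T *\<^sub>v (U *\<^sub>v x))) = Z *\<^sub>v (?D *\<^sub>v x)" by (simp add: 1)
    finally have eq: "Y\<^sup>T *\<^sub>v (U *\<^sub>v x) = Z *\<^sub>v (?D *\<^sub>v x)" using Z by (auto intro!: eq_vecI)
    have Dx: "?D *\<^sub>v x \<in> carrier_vec k" using x by (simp add: mat_diag_mult_vec)
    have "(s * dk)\<^sup>2 * (x \<bullet> x) = s\<^sup>2 * (dk\<^sup>2 * (x \<bullet> x))" by (simp add: power_mult_distrib)
    also have "\<dots> \<le> s\<^sup>2 * ((?D *\<^sub>v x) \<bullet> (?D *\<^sub>v x))"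
      using dk d by (intro mult_left_mono diag_norm_ge[OF x]) auto
    also have "\<dots> \<le> (Z *\<^sub>v (?D *\<^sub>v x)) \<bullet> (Z *\<^sub>v (?D *\<^sub>v x))" by (rule Zs[OF Dx])
    finally show "(s * dk)\<^sup>2 * (x \<bullet> x) \<le> (Y\<^sup>T *\<^sub>v (U *\<^sub>v x)) \<bullet> (Y\<^sup>T *\<^sub>v (U *\<^sub>v x))" by (simp add: eq)
  qed
  moreover have sdk: "s * dk > 0" using s dk by simp
  ultimately have \<sigma>: "\<sigma> > 0" "b / \<sigma> \<le> b / (s * dk)"
    using b by (simp, intro divide_left_mono) auto
  define E where "E = mat_diag k (\<lambda>i. 1 / sing_val Y (i + 1))"
  have E: "E \<in> carrier_mat k k" by (simp add: E_def)
  have S: "Sh \<in> carrier_mat k k" "Sh' \<in> carrier_mat r' r'" by (simp_all add: D(3,4))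
  have pos: "sing_val Y (i + 1) \<ge> \<sigma>" if "i < k" for i
    unfolding \<sigma>_def using that by (intro sing_val_antimono) auto
  have SE: "Sh *\<^sub>v (E *\<^sub>v y) = y" if y: "y \<in> carrier_vec k" for y
  proof -
    have "sing_val Y (Suc i) \<noteq> 0" if "i < k" for i using pos[OF that] \<sigma> by auto
    then show ?thesis using y by (auto simp: D(3) E_def mat_diag_mult_vec intro!: eq_vecI)
  qed
  \<comment> \<open>\<open>K\<close> is \<open>V S\<inverse>\<close> of the overview:
    \<open>Y\<close> maps its columns to those of \<open>Uh\<close>, and its norm is at most
    \<open>1 / \<sigma>\<close>.\<close>
  define K where "K = Vh * E"
  have K: "K \<in> carrier_mat n k" using R.U E by (simp add: K_def)
  have Ky: "K *\<^sub>v y = Vh *\<^sub>v (E *\<^sub>v y)" if "y \<in> carrier_vec k" for y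
    unfolding K_def by (rule assoc_mult_mat_vec[of _ n k _ k]) (use R.U E that in auto)
  have YK: "Y *\<^sub>v (K *\<^sub>v y) = Uh *\<^sub>v y" if y: "y \<in> carrier_vec k" for y
  proof -
    have Ey: "E *\<^sub>v y \<in> carrier_vec k" using E y by simp
    have VE: "Vh *\<^sub>v (E *\<^sub>v y) \<in> carrier_vec n" using R.U Ey by simp
    have "Vh *\<^sub>v (E *\<^sub>v y) = Vh *\<^sub>v (E *\<^sub>v y) + Vh' *\<^sub>v 0\<^sub>v r'" using R.U R.U' VE by (auto intro!: eq_vecI)
    then have 1: "Vh\<^sup>T *\<^sub>v (Vh *\<^sub>v (E *\<^sub>v y)) = E *\<^sub>v y" and 2: "Vh'\<^sup>T *\<^sub>v (Vh *\<^sub>v (E *\<^sub>v y)) = 0\<^sub>v r'"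
      using R.first[OF Ey, of "0\<^sub>v r'"] R.second[OF Ey, of "0\<^sub>v r'"] by auto
    have 3: "Y *\<^sub>v (K *\<^sub>v y) = (Uh * Sh * Vh\<^sup>T + Uh' * Sh' * Vh'\<^sup>T) *\<^sub>v (Vh *\<^sub>v (E *\<^sub>v y))"
      unfolding Ky[OF y] by (rule arg_cong[OF D(5)])
    also note svd_form_mult_vec[OF L.U S(1) R.U L.U' S(2) R.U' VE, unfolded 1 2]
    also have "Uh *\<^sub>v (Sh *\<^sub>v (E *\<^sub>v y)) + Uh' *\<^sub>v (Sh' *\<^sub>v 0\<^sub>v r') = Uh *\<^sub>v y"
    proof -
      have "Sh' *\<^sub>v 0\<^sub>v r' = 0\<^sub>v r'" using S by (auto intro!: eq_vecI)
      then show ?thesis using L.U L.U' y unfolding SE[OF y] by (auto intro!: eq_vecI)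
    qed
    finally show ?thesis .
  qed
  have Kn: "(K *\<^sub>v y) \<bullet> (K *\<^sub>v y) \<le> (1 / \<sigma>)\<^sup>2 * (y \<bullet> y)" if y: "y \<in> carrier_vec k" for y
  proof -
    have Ey: "E *\<^sub>v y \<in> carrier_vec k" using E y by simp
    have "(K *\<^sub>v y) \<bullet> (K *\<^sub>v y) = (E *\<^sub>v y) \<bullet> (E *\<^sub>v y)"
      unfolding Ky[OF y] by (rule orthonormal_cols_isometry[OF R.U R.UU Ey Ey])
    also have "\<dots> \<le> (1 / \<sigma>)\<^sup>2 * (y \<bullet> y)"
      unfolding E_def
    proof (rule diag_norm_le[OF y])
      fix i assume "i < k"
      from pos[OF this] \<sigma>(1) show "\<bar>1 / sing_val Y (i + 1)\<bar> \<le> 1 / \<sigma>"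
        by (simp add: sing_val_nonneg frac_le)
    qed
    finally show ?thesis .
  qed
  define w where "w y = Z'\<^sup>T *\<^sub>v (K *\<^sub>v y)" for y
  have w: "w y \<in> carrier_vec r" if "y \<in> carrier_vec k" for y
    using that Z' K by (simp add: w_def)
  \<comment> \<open>Past the \<open>r\<close> entries of \<open>?D'\<close> nothing remains and the
    bound is 0.\<close>
  define t where "t = (if i < r then d' i else 0)"
  have t: "t \<ge> 0" using d' by (simp add: t_def)
  have R1: "(1\<^sub>m m - U * U\<^sup>T) \<in> carrier_mat m m" using B.U by (simp add: minus_carrier_mat)
  have "sing_val ((1\<^sub>m m - U * U\<^sup>T) * Uh) (i + 1) \<le> t * (b / \<sigma>)"
  proof (rule sing_val_le)
    show "(1\<^sub>m m - U * U\<^sup>T) * Uh \<in> carrier_mat m k" using R1 Uh by simp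
    show "0 \<le> t * (b / \<sigma>)" using t b \<sigma> by simp
    fix l
    \<comment> \<open>These \<open>i\<close> conditions make the first \<open>i\<close> coordinates
      of \<open>w y\<close> vanish, so that \<open>?D'\<close> scales the others by at most
      \<open>t\<close>. The zero vector fills up the family if \<open>i\<close> exceeds
      \<open>r\<close>.\<close>
    show "(if l < r then K\<^sup>T *\<^sub>v col Z' l else 0\<^sub>v k) \<in> carrier_vec k" using K Z' by simp
  next
    fix y :: "real vec" assume y: "y \<in> carrier_vec k"
      and orth: "\<And>l. l < i \<Longrightarrow> (if l < r then K\<^sup>T *\<^sub>v col Z' l else 0\<^sub>v k) \<bullet> y = 0"
    have Kyc: "K *\<^sub>v y \<in> carrier_vec n" using K y by simp
    have w0: "w y $ l = 0" if "l < i" "l < r" for l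
    proof -
      have "w y $ l = col Z' l \<bullet> (K *\<^sub>v y)" using that Z' by (simp add: w_def)
      also have "\<dots> = (K\<^sup>T *\<^sub>v col Z' l) \<bullet> y"
        by (rule transpose_vec_mult_scalar[symmetric, OF K y]) (use Z' that in auto)
      finally show ?thesis using orth[OF that(1)] that(2) by simp
    qed
    let ?a = "?D *\<^sub>v (Z\<^sup>T *\<^sub>v (K *\<^sub>v y))" and ?b = "?D' *\<^sub>v w y"
    have ab: "?a \<in> carrier_vec k" "?b \<in> carrier_vec r"
      using Z Kyc w[OF y] by (simp_all add: mat_diag_mult_vec)
    have Uhy: "Uh *\<^sub>v y = U *\<^sub>v ?a + U' *\<^sub>v ?b"
      using YK[OF y] Yact[OF Kyc] by (simp add: w_def)
    have Uhc: "Uh *\<^sub>v y \<in> carrier_vec m" using Uh y by simp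
    have "((1\<^sub>m m - U * U\<^sup>T) * Uh) *\<^sub>v y = (1\<^sub>m m - U * U\<^sup>T) *\<^sub>v (Uh *\<^sub>v y)"
      by (rule assoc_mult_mat_vec[OF R1 Uh y])
    then have "(((1\<^sub>m m - U * U\<^sup>T) * Uh) *\<^sub>v y) \<bullet> (((1\<^sub>m m - U * U\<^sup>T) * Uh) *\<^sub>v y)
        = (Uh *\<^sub>v y) \<bullet> (Uh *\<^sub>v y) - (U\<^sup>T *\<^sub>v (Uh *\<^sub>v y)) \<bullet> (U\<^sup>T *\<^sub>v (Uh *\<^sub>v y))"
      using proj_complement_norm[OF B.U B.UU Uhc] by simp
    also have "\<dots> = ?b \<bullet> ?b"
      unfolding Uhy B.first[OF ab] B.norm[OF ab] by simp
    also have "\<dots> \<le> t\<^sup>2 * (w y \<bullet> w y)"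
    proof (rule diag_norm_le[OF w[OF y]])
      fix l assume l: "l < r" "w y $ l \<noteq> 0"
      then have "i \<le> l" using w0[of l] by force
      then show "\<bar>d' l\<bar> \<le> t" using d' l by (simp add: t_def)
    qed
    also have "\<dots> \<le> t\<^sup>2 * (b\<^sup>2 * ((1 / \<sigma>)\<^sup>2 * (y \<bullet> y)))"
      using order_trans[OF Zb[OF Kyc] mult_left_mono[OF Kn[OF y], of "b\<^sup>2"]]
      by (intro mult_left_mono) (auto simp: w_def)
    also have "\<dots> = (t * (b / \<sigma>))\<^sup>2 * (y \<bullet> y)" by (simp add: power_mult_distrib power_divide)
    finally show "(((1\<^sub>m m - U * U\<^sup>T) * Uh) *\<^sub>v y) \<bullet> (((1\<^sub>m m - U * U\<^sup>T) * Uh) *\<^sub>v y)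
        \<le> (t * (b / \<sigma>))\<^sup>2 * (y \<bullet> y)" .
  qed
  also have "t * (b / \<sigma>) \<le> t * (b / (s * dk))" using \<sigma> t by (intro mult_left_mono) auto
  finally show "sing_val ((1\<^sub>m m - Uh * Uh\<^sup>T) * U) (i + 1) \<le> (if i < r then d' i else 0) * (b / (s * dk))"
    using sing_val_proj_complement_commute[OF Uh UhUh B.U B.UU] by (simp add: t_def)
qed

section \<open>Matrix powers and the sketch in two-block form\<close>

lemma eq_mat_by_mult_vec:
  assumes A: "A \<in> carrier_mat m n" and B: "B \<in> carrier_mat m n"
    and eq: "\<And>x. x \<in> carrier_vec n \<Longrightarrow> A *\<^sub>v x = B *\<^sub>v x"
  shows "A = (B :: real mat)"
proof (intro eq_matI)
  fix i j assume ij: "i < dim_row B" "j < dim_col B"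
  then have "(A *\<^sub>v unit_vec n j) $ i = (B *\<^sub>v unit_vec n j) $ i" using eq[of "unit_vec n j"] by simp
  then show "A $$ (i, j) = B $$ (i, j)"
    using ij A B by (simp add: scalar_prod_right_unit)
qed (use A B in auto)

text \<open>The middle frames cancel: \<open>V.first\<close> and \<open>V.second\<close> recover
  both coefficient vectors from the inner space, even if the blocks do not fill it.\<close>

lemma svd_form_mult:
  assumes V: "two_blocks V V' n k r"
    and "U \<in> carrier_mat m k" "A \<in> carrier_mat k k" "U' \<in> carrier_mat m r" "A' \<in> carrier_mat r r"
    and "W \<in> carrier_mat p k" "B \<in> carrier_mat k k" "W' \<in> carrier_mat p r" "B' \<in> carrier_mat r r"
  shows "(U * A * V\<^sup>T + U' * A' * V'\<^sup>T) * (V * B * W\<^sup>T + V' * B' * W'\<^sup>T)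
    = U * (A * B) * W\<^sup>T + U' * (A' * B') * W'\<^sup>T"
proof -
  interpret V: two_blocks V V' n k r by (rule V)
  let ?L = "U * A * V\<^sup>T + U' * A' * V'\<^sup>T" and ?R = "V * B * W\<^sup>T + V' * B' * W'\<^sup>T"
  have L: "?L \<in> carrier_mat m n" and R: "?R \<in> carrier_mat n p"
    using assms V.U V.U' by (auto intro!: add_carrier_mat mult_carrier_mat)
  show ?thesis
  proof (rule eq_mat_by_mult_vec)
    show "?L * ?R \<in> carrier_mat m p" using L R by (rule mult_carrier_mat)
    show "U * (A * B) * W\<^sup>T + U' * (A' * B') * W'\<^sup>T \<in> carrier_mat m p"
      using assms by (auto intro!: add_carrier_mat mult_carrier_mat)
    fix x :: "real vec" assume x: "x \<in> carrier_vec p"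
    define a b where "a = B *\<^sub>v (W\<^sup>T *\<^sub>v x)" and "b = B' *\<^sub>v (W'\<^sup>T *\<^sub>v x)"
    have a: "a \<in> carrier_vec k" and b: "b \<in> carrier_vec r" using assms x by (auto simp: a_def b_def)
    have Vab: "V *\<^sub>v a + V' *\<^sub>v b \<in> carrier_vec n" using V.U V.U' a b by simp
    have "(?L * ?R) *\<^sub>v x = ?L *\<^sub>v (?R *\<^sub>v x)" by (rule assoc_mult_mat_vec[OF L R x])
    also have "?R *\<^sub>v x = V *\<^sub>v a + V' *\<^sub>v b"
      unfolding a_def b_def by (rule svd_form_mult_vec) (use assms V.U V.U' x in auto)
    also have "?L *\<^sub>v (V *\<^sub>v a + V' *\<^sub>v b) = U *\<^sub>v (A *\<^sub>v (V\<^sup>T *\<^sub>v (V *\<^sub>v a + V' *\<^sub>v b)))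
        + U' *\<^sub>v (A' *\<^sub>v (V'\<^sup>T *\<^sub>v (V *\<^sub>v a + V' *\<^sub>v b)))"
      by (rule svd_form_mult_vec) (use assms V.U V.U' Vab in auto)
    also have "\<dots> = U *\<^sub>v (A *\<^sub>v a) + U' *\<^sub>v (A' *\<^sub>v b)"
      by (simp only: V.first[OF a b] V.second[OF a b])
    also have "A *\<^sub>v a = (A * B) *\<^sub>v (W\<^sup>T *\<^sub>v x)"
      unfolding a_def by (rule assoc_mult_mat_vec[symmetric]) (use assms x in auto)
    also have "A' *\<^sub>v b = (A' * B') *\<^sub>v (W'\<^sup>T *\<^sub>v x)"
      unfolding b_def by (rule assoc_mult_mat_vec[symmetric]) (use assms x in auto)
    also have "U *\<^sub>v ((A * B) *\<^sub>v (W\<^sup>T *\<^sub>v x)) + U' *\<^sub>v ((A' * B') *\<^sub>v (W'\<^sup>T *\<^sub>v x))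
        = (U * (A * B) * W\<^sup>T + U' * (A' * B') * W'\<^sup>T) *\<^sub>v x"
      by (rule svd_form_mult_vec[symmetric]) (use assms x in auto)
    finally show "(?L * ?R) *\<^sub>v x = (U * (A * B) * W\<^sup>T + U' * (A' * B') * W'\<^sup>T) *\<^sub>v x" .
  qed
qed

definition svd_form :: "real mat \<Rightarrow> real mat \<Rightarrow> (nat \<Rightarrow> real) \<Rightarrow> (nat \<Rightarrow> real) \<Rightarrow> real mat \<Rightarrow> real mat \<Rightarrow> real mat" where
  "svd_form U U' d d' V V' = U * mat_diag (dim_col U) d * V\<^sup>T + U' * mat_diag (dim_col U') d' * V'\<^sup>T"

lemma svd_form_diag_mult:
  assumes U: "two_blocks U U' m k r" and V: "two_blocks V V' n k r" and W: "two_blocks W W' p k r"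
  shows "svd_form U U' a a' V V' * svd_form V V' b b' W W'
    = svd_form U U' (\<lambda>i. a i * b i) (\<lambda>i. a' i * b' i) W W'"
proof -
  interpret U: two_blocks U U' m k r by (rule U)
  interpret V: two_blocks V V' n k r by (rule V)
  interpret W: two_blocks W W' p k r by (rule W)
  have d: "dim_col U = k" "dim_col U' = r" "dim_col V = k" "dim_col V' = r"
    using U.U U.U' V.U V.U' by auto
  show ?thesis
    unfolding svd_form_def d
    by (subst svd_form_mult[OF V U.U _ U.U' _ W.U _ W.U']) simp_all
qed

lemma svd_form_diag_transpose:
  assumes U: "two_blocks U U' m k r" and V: "two_blocks V V' n k r"
  shows "(svd_form U U' a a' V V')\<^sup>T = svd_form V V' a a' U U'"
proof -
  interpret U: two_blocks U U' m k r by (rule U)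
  interpret V: two_blocks V V' n k r by (rule V)
  have d: "dim_col U = k" "dim_col U' = r" "dim_col V = k" "dim_col V' = r"
    using U.U U.U' V.U V.U' by auto
  show ?thesis
    unfolding svd_form_def d
    by (subst svd_form_transpose[OF U.U _ V.U U.U' _ V.U']) simp_all
qed

text \<open>A symmetric matrix may have negative eigenvalues, so its left and right singular vectors
  can differ. But \<open>M = M\<^sup>T\<close> also has the form with both frames exchanged, and
  multiplying by whichever form fits makes the right frame alternate: \<open>V\<close> for odd
  exponents \<open>Suc g\<close>, \<open>U\<close> for even ones.\<close>

lemma symmetric_power_svd_form:
  assumes U: "two_blocks U U' m k r" and V: "two_blocks V V' m k r"
    and M: "M = svd_form U U' a a' V V'" and Mc: "M \<in> carrier_mat m m" and sym: "M\<^sup>T = M"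
  shows "M ^\<^sub>m Suc g = svd_form U U' (\<lambda>i. a i ^ Suc g) (\<lambda>i. a' i ^ Suc g)
    (if even g then V else U) (if even g then V' else U')"
proof (induction g)
  case 0
  then show ?case using M Mc by simp
next
  case (Suc g)
  have M': "M = svd_form V V' a a' U U'"
    using sym svd_form_diag_transpose[OF U V, of a a'] M by simp
  have "M ^\<^sub>m Suc (Suc g) = M ^\<^sub>m Suc g * M" by simp
  also have "\<dots> = svd_form U U' (\<lambda>i. a i ^ Suc g * a i) (\<lambda>i. a' i ^ Suc g * a' i)
    (if even g then U else V) (if even g then U' else V')"
  proof (cases "even g")
    case True
    then have "M ^\<^sub>m Suc g = svd_form U U' (\<lambda>i. a i ^ Suc g) (\<lambda>i. a' i ^ Suc g) V V'" using Suc by simp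
    then show ?thesis
      using True svd_form_diag_mult[OF U V U, of "\<lambda>i. a i ^ Suc g" "\<lambda>i. a' i ^ Suc g" a a']
      by (simp only: M'[symmetric] if_True)
  next
    case False
    then have "M ^\<^sub>m Suc g = svd_form U U' (\<lambda>i. a i ^ Suc g) (\<lambda>i. a' i ^ Suc g) U U'" using Suc by simp
    then show ?thesis
      using False svd_form_diag_mult[OF U U V, of "\<lambda>i. a i ^ Suc g" "\<lambda>i. a' i ^ Suc g" a a']
      by (simp only: M[symmetric] if_False)
  qed
  also have "(\<lambda>i. a i ^ Suc g * a i) = (\<lambda>i. a i ^ Suc (Suc g))" by (simp add: mult.commute)
  also have "(\<lambda>i. a' i ^ Suc g * a' i) = (\<lambda>i. a' i ^ Suc (Suc g))" by (simp add: mult.commute)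
  finally show ?case by simp
qed

text \<open>Each further factor \<open>M\<^sup>T * M\<close> is diagonal in the frame
  \<open>V\<close>, \<open>V'\<close> with squared entries, so it raises the exponent by 2.\<close>

lemma gram_power_svd_form:
  assumes U: "two_blocks U U' m k r" and V: "two_blocks V V' n k r"
    and M: "M = svd_form U U' a a' V V'" and Mc: "M \<in> carrier_mat m n"
  shows "M * (M\<^sup>T * M) ^\<^sub>m g = svd_form U U' (\<lambda>i. a i ^ (2 * g + 1)) (\<lambda>i. a' i ^ (2 * g + 1)) V V'"
proof (induction g)
  case 0
  then show ?case using M Mc by simp
next
  case (Suc g)
  define H where "H = M\<^sup>T * M"
  have H: "H \<in> carrier_mat n n" using Mc by (simp add: H_def)
  have HM: "H = svd_form V V' (\<lambda>i. a i * a i) (\<lambda>i. a' i * a' i) V V'"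
    using svd_form_diag_mult[OF V U V, of a a' a a'] svd_form_diag_transpose[OF U V, of a a']
    by (simp add: H_def M)
  have "M * H ^\<^sub>m Suc g = M * (H ^\<^sub>m g * H)" by simp
  also have "\<dots> = M * H ^\<^sub>m g * H"
    using Mc H by (intro assoc_mult_mat[symmetric, of _ m n _ n _ n]) auto
  also have "\<dots> = svd_form U U' (\<lambda>i. a i ^ (2 * g + 1)) (\<lambda>i. a' i ^ (2 * g + 1)) V V'
      * svd_form V V' (\<lambda>i. a i * a i) (\<lambda>i. a' i * a' i) V V'"
    using Suc by (simp only: H_def[symmetric] HM[symmetric])
  also have "\<dots> = svd_form U U' (\<lambda>i. a i ^ (2 * g + 1) * (a i * a i)) (\<lambda>i. a' i ^ (2 * g + 1) * (a' i * a' i)) V V'"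
    by (rule svd_form_diag_mult[OF U V V])
  also have "(\<lambda>i. a i ^ (2 * g + 1) * (a i * a i)) = (\<lambda>i. a i ^ (2 * Suc g + 1))" by (simp add: mult_ac)
  also have "(\<lambda>i. a' i ^ (2 * g + 1) * (a' i * a' i)) = (\<lambda>i. a' i ^ (2 * Suc g + 1))" by (simp add: mult_ac)
  finally show ?case by (simp only: H_def)
qed

text \<open>Removes the case distinction of the algorithm. The right frame \<open>W\<close>,
  \<open>W'\<close> depends on symmetry and parity, but all that matters afterwards is that it is
  orthonormal and does not depend on \<open>G\<close>.\<close>

lemma rsvd_sketch_svd_form:
  assumes svd: "svd_split k M U S V U' S' V'" and M: "M \<in> carrier_mat m n" and g: "g \<ge> 1"
    and gt: "gt = (if symmetric_mat M then g else 2 * g + 1)"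
  defines "r \<equiv> min m n - k"
  obtains W W' where "two_blocks W W' n k r" "two_blocks U U' m k r"
    "\<And>G l. G \<in> carrier_mat n l \<Longrightarrow> rsvd_sketch g M G =
      U * mat_diag k (\<lambda>i. sing_val M (i + 1) ^ gt) * (G\<^sup>T * W)\<^sup>T
      + U' * mat_diag r (\<lambda>i. sing_val M (k + i + 1) ^ gt) * (G\<^sup>T * W')\<^sup>T"
proof -
  note D = svd_splitD[OF svd M, folded r_def]
  interpret U: two_blocks U U' m k r by (rule D(1))
  interpret V: two_blocks V V' n k r by (rule D(2))
  have dU: "dim_col U = k" "dim_col U' = r" using U.U U.U' by auto
  let ?a = "\<lambda>i. sing_val M (i + 1)" and ?a' = "\<lambda>i. sing_val M (k + i + 1)"
  have Mf: "M = svd_form U U' ?a ?a' V V'"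
    unfolding svd_form_def dU using D(5) unfolding D(3,4) .
  define B where "B = (if symmetric_mat M then M ^\<^sub>m g else M * (M\<^sup>T * M) ^\<^sub>m g)"
  have "\<exists>W W'. two_blocks W W' n k r \<and> B = svd_form U U' (\<lambda>i. ?a i ^ gt) (\<lambda>i. ?a' i ^ gt) W W'"
  proof (cases "symmetric_mat M")
    case True
    then have sym: "M\<^sup>T = M" by (simp add: symmetric_mat_def)
    then have mn: "m = n" using M by (metis carrier_matD index_transpose_mat(2))
    obtain g' where g': "g = Suc g'" using g by (cases g) auto
    have V: "two_blocks V V' m k r" and Mc: "M \<in> carrier_mat m m" using D(2) M mn by auto
    have "B = svd_form U U' (\<lambda>i. ?a i ^ gt) (\<lambda>i. ?a' i ^ gt) (if even g' then V else U) (if even g' then V' else U')"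
      using symmetric_power_svd_form[OF D(1) V Mf Mc sym, of g'] True by (simp only: B_def gt g' if_True)
    moreover have "two_blocks (if even g' then V else U) (if even g' then V' else U') n k r"
      using D(1,2) mn by simp
    ultimately show ?thesis by blast
  next
    case False
    then have "B = svd_form U U' (\<lambda>i. ?a i ^ gt) (\<lambda>i. ?a' i ^ gt) V V'"
      using gram_power_svd_form[OF D(1,2) Mf M, of g] by (simp only: B_def gt if_False)
    then show ?thesis using D(2) by blast
  qed
  then obtain W W' where W: "two_blocks W W' n k r"
    and B: "B = svd_form U U' (\<lambda>i. ?a i ^ gt) (\<lambda>i. ?a' i ^ gt) W W'" by blast
  interpret W: two_blocks W W' n k r by (rule W)
  let ?D = "mat_diag k (\<lambda>i. ?a i ^ gt)" and ?D' = "mat_diag r (\<lambda>i. ?a' i ^ gt)"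
  have sk: "rsvd_sketch g M G = U * ?D * (G\<^sup>T * W)\<^sup>T + U' * ?D' * (G\<^sup>T * W')\<^sup>T" if G: "G \<in> carrier_mat n l" for G l
  proof -
    have "rsvd_sketch g M G = B * G" by (simp add: rsvd_sketch_def B_def)
    also have "\<dots> = (U * ?D * W\<^sup>T + U' * ?D' * W'\<^sup>T) * G" by (simp only: B svd_form_def dU)
    also have "\<dots> = U * ?D * W\<^sup>T * G + U' * ?D' * W'\<^sup>T * G"
      by (rule add_mult_distrib_mat[of _ m n _ _ l]) (use U.U U.U' W.U W.U' G in auto)
    also have "U * ?D * W\<^sup>T * G = U * ?D * (W\<^sup>T * G)"
      by (rule assoc_mult_mat[of _ m k _ n _ l]) (use U.U W.U G in auto)
    also have "U' * ?D' * W'\<^sup>T * G = U' * ?D' * (W'\<^sup>T * G)"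
      by (rule assoc_mult_mat[of _ m r _ n _ l]) (use U.U' W.U' G in auto)
    also have "W\<^sup>T * G = (G\<^sup>T * W)\<^sup>T" using transpose_mult[of "G\<^sup>T" l n W k] G W.U by simp
    also have "W'\<^sup>T * G = (G\<^sup>T * W')\<^sup>T" using transpose_mult[of "G\<^sup>T" l n W' r] G W.U' by simp
    finally show ?thesis .
  qed
  show ?thesis by (rule that[OF W D(1) sk])
qed

section \<open>Gaussian integrals\<close>

abbreviation std_gauss :: "real measure" where
  "std_gauss \<equiv> density lborel (\<lambda>x. ennreal (std_normal_density x))"

abbreviation gauss :: "'i set \<Rightarrow> ('i \<Rightarrow> real) measure" where
  "gauss I \<equiv> PiM I (\<lambda>_. std_gauss)"

lemma prob_space_std_gauss: "prob_space std_gauss"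
  using prob_space_normal_density[of 1 0] by simp

interpretation std_gauss: prob_space std_gauss by (rule prob_space_std_gauss)
interpretation gauss: product_prob_space "\<lambda>_. std_gauss" I for I :: "'i set" ..

lemma prob_space_gauss: "prob_space (gauss I)"
  by (rule prob_space_PiM) (rule prob_space_std_gauss)

text \<open>Completing the square: an exponential factor shifts the mean to
  \<open>c\<close>.\<close>

lemma std_normal_density_times_exp:
  "std_normal_density x * exp (c * x) = exp (c\<^sup>2 / 2) * normal_density c 1 x"
proof -
  have "exp (- x\<^sup>2 / 2) * exp (c * x) = exp (c\<^sup>2 / 2) * exp (- (x - c)\<^sup>2 / 2)"
    by (simp add: power2_eq_square field_simps flip: exp_add)
  then show ?thesis by (simp add: normal_density_def)
qed

lemma has_bochner_integral_exp_std_gauss: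
  "has_bochner_integral std_gauss (\<lambda>x. exp (c * x)) (exp (c\<^sup>2 / 2))"
proof -
  have "has_bochner_integral lborel (\<lambda>x. exp (c\<^sup>2 / 2) * normal_density c 1 x) (exp (c\<^sup>2 / 2) * 1)"
    by (intro has_bochner_integral_mult_right) (simp add: has_bochner_integral_iff)
  then show ?thesis
    by (intro has_bochner_integral_density) (auto simp: std_normal_density_times_exp)
qed

lemma integrable_exp_abs_std_gauss: "integrable std_gauss (\<lambda>x. exp (K * \<bar>x\<bar>))"
proof (rule Bochner_Integration.integrable_bound)
  show "integrable std_gauss (\<lambda>x. exp (K * x) + exp (- K * x))"
  proof (rule Bochner_Integration.integrable_add)
    show "integrable std_gauss (\<lambda>x. exp (K * x))" "integrable std_gauss (\<lambda>x. exp (- K * x))"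
      using has_bochner_integral_exp_std_gauss[of K] has_bochner_integral_exp_std_gauss[of "- K"]
      by (simp_all add: has_bochner_integral_iff)
  qed
  show "AE x in std_gauss. norm (exp (K * \<bar>x\<bar>)) \<le> norm (exp (K * x) + exp (- K * x))"
  proof (rule AE_I2)
    fix x
    have "exp (K * \<bar>x\<bar>) \<le> exp (K * x) + exp (- K * x)" by (cases "x \<ge> 0") auto
    then show "norm (exp (K * \<bar>x\<bar>)) \<le> norm (exp (K * x) + exp (- K * x))"
      using abs_ge_self[of "exp (K * x) + exp (- K * x)"] by simp
  qed
qed auto

lemma integrable_exp_abs_gauss:
  "finite I \<Longrightarrow> integrable (gauss I) (\<lambda>z. C * exp (K * (\<Sum>i\<in>I. \<bar>z i\<bar>)))"
  using gauss.product_integrable_prod[of I "\<lambda>_ x. exp (K * \<bar>x\<bar>)"]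
  by (simp add: integrable_exp_abs_std_gauss sum_distrib_left exp_sum)

text \<open>Exponentials of the sum of absolute values serve as common dominating functions. The
  integrands of the interpolation grow no faster, as do their products with single entries.\<close>

lemma integrable_gauss_bound:
  assumes "finite I" "f \<in> borel_measurable (gauss I)"
    "\<And>z. \<bar>f z\<bar> \<le> C * exp (K * (\<Sum>i\<in>I. \<bar>z i\<bar>))"
  shows "integrable (gauss I) (f :: _ \<Rightarrow> real)"
  using integrable_exp_abs_gauss[OF assms(1), of C K] assms(2)
  by (rule Bochner_Integration.integrable_bound) (use assms(3) order_trans[OF _ abs_ge_self] in auto)

lemma abs_le_exp: "K \<ge> 1 \<Longrightarrow> \<bar>x\<bar> \<le> exp (K * \<bar>x :: real\<bar>)"
proof -
  assume "K \<ge> 1"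
  then have "\<bar>x\<bar> \<le> K * \<bar>x\<bar>" using mult_right_mono[of 1 K "\<bar>x\<bar>"] by simp
  also have "\<dots> \<le> exp (K * \<bar>x\<bar>)" using exp_ge_add_one_self[of "K * \<bar>x\<bar>"] by linarith
  finally show ?thesis .
qed

text \<open>The derivative of \<open>f\<close> times the Gaussian density \<phi> is
  \<open>(f' x - x * f x) * \<phi> x\<close>. Its integral over the line is 0, because the product
  vanishes at both ends.\<close>

lemma gaussian_integration_by_parts:
  fixes f f' :: "real \<Rightarrow> real"
  assumes deriv: "\<And>x. (f has_real_derivative f' x) (at x)" and cont: "\<And>x. isCont f' x"
    and bound: "\<And>x. \<bar>f x\<bar> \<le> C * exp (K * \<bar>x\<bar>)" "\<And>x. \<bar>f' x\<bar> \<le> C * exp (K * \<bar>x\<bar>)"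
    and K: "K \<ge> 0"
  shows "(\<integral>x. x * f x \<partial>std_gauss) = (\<integral>x. f' x \<partial>std_gauss)"
proof -
  have f_meas [measurable]: "f \<in> borel_measurable borel"
    using deriv by (intro borel_measurable_continuous_onI)
      (auto simp: continuous_on_eq_continuous_within intro: DERIV_isCont continuous_at_imp_continuous_within)
  have f'_meas [measurable]: "f' \<in> borel_measurable borel"
    using cont by (intro borel_measurable_continuous_onI)
      (auto simp: continuous_on_eq_continuous_within intro: continuous_at_imp_continuous_within)
  have C: "C \<ge> 0" using bound(1)[of 0] by simp
  have int1: "integrable std_gauss f'"
    using integrable_mult_right[OF integrable_exp_abs_std_gauss[of K], of C]
    by (rule Bochner_Integration.integrable_bound) (use bound(2) order_trans[OF _ abs_ge_self] in auto)
  have int2: "integrable std_gauss (\<lambda>x. x * f x)"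
  proof (rule Bochner_Integration.integrable_bound)
    show "integrable std_gauss (\<lambda>x. C * exp ((K + 1) * \<bar>x\<bar>))"
      by (intro integrable_mult_right integrable_exp_abs_std_gauss)
    have "\<bar>x * f x\<bar> \<le> C * exp ((K + 1) * \<bar>x\<bar>)" for x
    proof -
      have "\<bar>x * f x\<bar> \<le> exp (1 * \<bar>x\<bar>) * (C * exp (K * \<bar>x\<bar>))"
        unfolding abs_mult using bound(1)[of x] abs_le_exp[of 1 x] by (intro mult_mono) auto
      then show ?thesis by (simp add: algebra_simps exp_add)
    qed
    then show "AE x in std_gauss. norm (x * f x) \<le> norm (C * exp ((K + 1) * \<bar>x\<bar>))"
      using order_trans[OF _ abs_ge_self] by auto
  qed auto
  define F where "F x = f x * std_normal_density x" for x
  define F' where "F' x = f' x * std_normal_density x - x * f x * std_normal_density x" for x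
  have d: "(std_normal_density has_real_derivative (- x * std_normal_density x)) (at x)" for x
  proof -
    have "((\<lambda>x. c * exp (- x\<^sup>2 / 2)) has_real_derivative (- x * (c * exp (- x\<^sup>2 / 2)))) (at x)" for c
      by (auto intro!: derivative_eq_intros)
    then show ?thesis unfolding std_normal_density_def[abs_def] .
  qed
  have dF: "(F has_real_derivative F' x) (at x)" for x
    unfolding F_def F'_def using DERIV_mult[OF deriv d, of x] by (simp add: algebra_simps)
  have contF': "isCont F' x" for x
    unfolding F'_def using cont DERIV_isCont[OF deriv] DERIV_isCont[OF d]
    by (intro continuous_intros) auto
  have i1: "integrable lborel (\<lambda>x. std_normal_density x * f' x)"
    using int1 by (subst (asm) integrable_density) auto
  have i2: "integrable lborel (\<lambda>x. std_normal_density x * (x * f x))"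
    using int2 by (subst (asm) integrable_density) auto
  have F'_eq: "F' = (\<lambda>x. std_normal_density x * f' x - std_normal_density x * (x * f x))"
    by (auto simp: F'_def fun_eq_iff)
  have intF': "integrable lborel F'"
    unfolding F'_eq using i1 i2 by (rule Bochner_Integration.integrable_diff)
  have Fb: "\<bar>F x\<bar> \<le> C * exp (K\<^sup>2) * exp (- (x\<^sup>2) / 4)" for x
  proof -
    \<comment> \<open>Half of the exponent \<open>- x\<^sup>2 / 2\<close> absorbs the exponential
      growth of \<open>f\<close>; the other half provides the decay at infinity.\<close>
    have "K * \<bar>x\<bar> \<le> K\<^sup>2 + x\<^sup>2 / 4"
      using zero_le_power2[of "K - \<bar>x\<bar> / 2"] by (simp add: power2_diff field_simps)
    then have "exp (K * \<bar>x\<bar>) * exp (- x\<^sup>2 / 2) \<le> exp (K\<^sup>2) * exp (- (x\<^sup>2) / 4)"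
      by (simp add: field_simps flip: exp_add)
    moreover have "std_normal_density x \<le> exp (- x\<^sup>2 / 2)"
    proof -
      have "1 \<le> sqrt (2 * pi)" using pi_gt3 by simp
      then show ?thesis by (simp add: std_normal_density_def divide_le_eq mult_le_cancel_left1)
    qed
    ultimately have "exp (K * \<bar>x\<bar>) * std_normal_density x \<le> exp (K\<^sup>2) * exp (- (x\<^sup>2) / 4)"
      by (meson exp_ge_zero mult_left_mono order_trans)
    then have "C * (exp (K * \<bar>x\<bar>) * std_normal_density x) \<le> C * (exp (K\<^sup>2) * exp (- (x\<^sup>2) / 4))"
      using C by (rule mult_left_mono)
    moreover have "\<bar>F x\<bar> \<le> C * exp (K * \<bar>x\<bar>) * std_normal_density x"
      unfolding F_def abs_mult using bound(1)[of x] by (simp add: mult_right_mono)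
    ultimately show ?thesis by (simp add: mult.assoc)
  qed
  have l1: "((\<lambda>x. C * exp (K\<^sup>2) * exp (- (x\<^sup>2) / 4)) \<longlongrightarrow> 0) at_top"
    by (rule tendsto_mult_right_zero) real_asymp
  have l2: "((\<lambda>x. C * exp (K\<^sup>2) * exp (- (x\<^sup>2) / 4)) \<longlongrightarrow> 0) at_bot"
    by (rule tendsto_mult_right_zero) real_asymp
  have lim: "(F \<longlongrightarrow> 0) at_top" "(F \<longlongrightarrow> 0) at_bot"
    using Fb by (auto intro!: Lim_null_comparison[OF _ l1] Lim_null_comparison[OF _ l2])
  have "(LBINT x=-\<infinity>..\<infinity>. F' x) = 0 - 0"
    by (rule interval_integral_FTC_integrable[where F = F])
      (use dF contF' intF' lim in \<open>auto simp: ereal_tendsto_simps set_integrable_def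
        has_real_derivative_iff_has_vector_derivative\<close>)
  then have "(\<integral>x. F' x \<partial>lborel) = 0"
    by (simp add: interval_lebesgue_integral_def set_lebesgue_integral_def)
  then have "(\<integral>x. std_normal_density x * f' x \<partial>lborel) = (\<integral>x. std_normal_density x * (x * f x) \<partial>lborel)"
    unfolding F'_eq using i1 i2 by simp
  then show ?thesis by (subst (1 2) integral_density) auto
qed

text \<open>Fubini isolates the coordinate \<open>a\<close>. With the others frozen, their part of
  the exponential bound is absorbed into the constant of the one-dimensional lemma.\<close>

lemma gaussian_integration_by_parts_PiM:
  fixes f f' :: "('i \<Rightarrow> real) \<Rightarrow> real"
  assumes I: "finite I" "a \<in> I"
    and [measurable]: "f \<in> borel_measurable (gauss I)" "f' \<in> borel_measurable (gauss I)"
    and deriv: "\<And>z y. ((\<lambda>y. f (z(a := y))) has_real_derivative f' (z(a := y))) (at y)"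
    and cont: "\<And>z y. isCont (\<lambda>y. f' (z(a := y))) y"
    and bound: "\<And>z. \<bar>f z\<bar> \<le> C * exp (K * (\<Sum>i\<in>I. \<bar>z i\<bar>))"
      "\<And>z. \<bar>f' z\<bar> \<le> C * exp (K * (\<Sum>i\<in>I. \<bar>z i\<bar>))"
    and K: "K \<ge> 0"
  shows "(\<integral>z. z a * f z \<partial>gauss I) = (\<integral>z. f' z \<partial>gauss I)"
proof -
  define J where "J = I - {a}"
  have J: "finite J" "a \<notin> J" "insert a J = I" using I by (auto simp: J_def)
  have C: "C \<ge> 0"
    using bound(1)[of "\<lambda>_. 0"] by simp
  have int1: "integrable (gauss I) f'" by (rule integrable_gauss_bound[OF I(1) _ bound(2)]) simp
  have int2: "integrable (gauss I) (\<lambda>z. z a * f z)"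
  proof (rule integrable_gauss_bound[OF I(1)])
    show "(\<lambda>z. z a * f z) \<in> borel_measurable (gauss I)" using I by measurable
    fix z :: "'i \<Rightarrow> real"
    have "\<bar>z a\<bar> \<le> (\<Sum>i\<in>I. \<bar>z i\<bar>)" using I by (intro member_le_sum) auto
    also have "\<dots> \<le> exp (\<Sum>i\<in>I. \<bar>z i\<bar>)" using exp_ge_add_one_self[of "\<Sum>i\<in>I. \<bar>z i\<bar>"] by linarith
    finally have "\<bar>z a * f z\<bar> \<le> exp (\<Sum>i\<in>I. \<bar>z i\<bar>) * (C * exp (K * (\<Sum>i\<in>I. \<bar>z i\<bar>)))"
      unfolding abs_mult using bound(1)[of z] by (intro mult_mono) auto
    then show "\<bar>z a * f z\<bar> \<le> C * exp ((K + 1) * (\<Sum>i\<in>I. \<bar>z i\<bar>))"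
      by (simp add: algebra_simps exp_add)
  qed
  have sum_upd: "(\<Sum>i\<in>I. \<bar>(z(a := y)) i\<bar>) = \<bar>y\<bar> + (\<Sum>i\<in>J. \<bar>z i\<bar>)" for z and y :: real
  proof -
    have "(\<Sum>i\<in>J. \<bar>(z(a := y)) i\<bar>) = (\<Sum>i\<in>J. \<bar>z i\<bar>)" using J by (intro sum.cong) auto
    then have "(\<Sum>i\<in>insert a J. \<bar>(z(a := y)) i\<bar>) = \<bar>y\<bar> + (\<Sum>i\<in>J. \<bar>z i\<bar>)" using J(1,2) by simp
    then show ?thesis by (simp only: J(3))
  qed
  have "(\<integral>z. z a * f z \<partial>gauss I) = (\<integral>z. (\<integral>y. y * f (z(a := y)) \<partial>std_gauss) \<partial>gauss J)"
    using gauss.product_integral_insert[OF J(1,2), of "\<lambda>z. z a * f z"] int2 J(3) by simp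
  also have "\<dots> = (\<integral>z. (\<integral>y. f' (z(a := y)) \<partial>std_gauss) \<partial>gauss J)"
  proof (rule Bochner_Integration.integral_cong[OF refl])
    fix z :: "'i \<Rightarrow> real"
    have "\<bar>f (z(a := y))\<bar> \<le> (C * exp (K * (\<Sum>i\<in>J. \<bar>z i\<bar>))) * exp (K * \<bar>y\<bar>)"
      "\<bar>f' (z(a := y))\<bar> \<le> (C * exp (K * (\<Sum>i\<in>J. \<bar>z i\<bar>))) * exp (K * \<bar>y\<bar>)" for y
      using bound[of "z(a := y)"] unfolding sum_upd by (simp_all add: algebra_simps exp_add)
    from gaussian_integration_by_parts[OF deriv cont this K]
    show "(\<integral>y. y * f (z(a := y)) \<partial>std_gauss) = (\<integral>y. f' (z(a := y)) \<partial>std_gauss)" .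
  qed
  also have "\<dots> = (\<integral>z. f' z \<partial>gauss I)"
    using gauss.product_integral_insert[OF J(1,2), of f'] int1 J(3) by simp
  finally show ?thesis .
qed

text \<open>Dominated convergence for difference quotients; the mean value theorem bounds each
  quotient by \<open>g\<close>, on either side of \<open>s\<close>. Domination is required only near
  \<open>s\<close>, so an initial segment of the sequence is dropped.\<close>

lemma has_real_derivative_integral:
  fixes f f' :: "real \<Rightarrow> 'a \<Rightarrow> real"
  assumes r: "r > 0"
    and int: "\<And>t. \<bar>t - s\<bar> < r \<Longrightarrow> integrable M (f t)"
    and meas: "f' s \<in> borel_measurable M"
    and deriv: "\<And>t x. \<bar>t - s\<bar> < r \<Longrightarrow> x \<in> space M \<Longrightarrow> ((\<lambda>t. f t x) has_real_derivative f' t x) (at t)"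
    and bound: "\<And>t x. \<bar>t - s\<bar> < r \<Longrightarrow> x \<in> space M \<Longrightarrow> \<bar>f' t x\<bar> \<le> g x"
    and g: "integrable M g"
  shows "((\<lambda>t. \<integral>x. f t x \<partial>M) has_real_derivative (\<integral>x. f' s x \<partial>M)) (at s)"
proof -
  have "((\<lambda>y. ((\<integral>x. f y x \<partial>M) - (\<integral>x. f s x \<partial>M)) / (y - s)) \<longlongrightarrow> (\<integral>x. f' s x \<partial>M)) (at s)"
    unfolding tendsto_at_iff_sequentially comp_def
  proof (intro allI impI)
    fix X assume X: "\<forall>i. X i \<in> UNIV - {s}" and lim: "X \<longlonglongrightarrow> s"
    from lim r have "eventually (\<lambda>i. \<bar>X i - s\<bar> < r) sequentially"
      by (auto simp: tendsto_iff dist_real_def)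
    then obtain n0 where n0: "\<And>i. i \<ge> n0 \<Longrightarrow> \<bar>X i - s\<bar> < r" by (auto simp: eventually_sequentially)
    define Y where "Y i = X (i + n0)" for i
    have Y: "Y i \<noteq> s" "\<bar>Y i - s\<bar> < r" for i using X n0 by (auto simp: Y_def)
    have Ylim: "Y \<longlonglongrightarrow> s" unfolding Y_def using lim by (rule LIMSEQ_ignore_initial_segment)
    have fs: "integrable M (f s)" using int r by simp
    have "(\<lambda>i. \<integral>x. (f (Y i) x - f s x) / (Y i - s) \<partial>M) \<longlonglongrightarrow> (\<integral>x. f' s x \<partial>M)"
    proof (rule integral_dominated_convergence[where w = g])
      show "AE x in M. (\<lambda>i. (f (Y i) x - f s x) / (Y i - s)) \<longlonglongrightarrow> f' s x"
      proof (rule AE_I2)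
        fix x assume x: "x \<in> space M"
        have "((\<lambda>y. (f y x - f s x) / (y - s)) \<longlongrightarrow> f' s x) (at s)"
          using deriv[of s x] r x by (simp add: has_field_derivative_iff)
        then show "(\<lambda>i. (f (Y i) x - f s x) / (Y i - s)) \<longlonglongrightarrow> f' s x"
          unfolding tendsto_at_iff_sequentially comp_def using Y(1) Ylim by auto
      qed
      fix i
      show "(\<lambda>x. (f (Y i) x - f s x) / (Y i - s)) \<in> borel_measurable M"
        using int[OF Y(2)[of i]] fs by auto
      show "AE x in M. norm ((f (Y i) x - f s x) / (Y i - s)) \<le> g x"
      proof (rule AE_I2)
        fix x assume x: "x \<in> space M"
        show "norm ((f (Y i) x - f s x) / (Y i - s)) \<le> g x"
        proof (cases "s < Y i")
          case True
          have "\<exists>z. s < z \<and> z < Y i \<and> f (Y i) x - f s x = (Y i - s) * f' z x"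
            by (rule MVT2[OF True]) (use Y(2)[of i] x in \<open>auto intro!: deriv\<close>)
          then obtain z where "s < z" "z < Y i" "f (Y i) x - f s x = (Y i - s) * f' z x" by auto
          then show ?thesis using bound[of z x] Y(2)[of i] x by simp
        next
          case False
          then have lt: "Y i < s" using Y(1)[of i] by simp
          have "\<exists>z. Y i < z \<and> z < s \<and> f s x - f (Y i) x = (s - Y i) * f' z x"
            by (rule MVT2[OF lt]) (use Y(2)[of i] x in \<open>auto intro!: deriv\<close>)
          then obtain z where z: "Y i < z" "z < s" "f s x - f (Y i) x = (s - Y i) * f' z x" by auto
          have "(f (Y i) x - f s x) / (Y i - s) = (f s x - f (Y i) x) / (s - Y i)"
            by (metis minus_diff_eq minus_divide_divide)
          then show ?thesis using bound[of z x] Y(2)[of i] x z by simp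
        qed
      qed
    qed (use meas g in auto)
    moreover have "(\<integral>x. (f (Y i) x - f s x) / (Y i - s) \<partial>M)
        = ((\<integral>x. f (Y i) x \<partial>M) - (\<integral>x. f s x \<partial>M)) / (Y i - s)" for i
      using int[OF Y(2)[of i]] fs by simp
    ultimately have "(\<lambda>i. ((\<integral>x. f (Y i) x \<partial>M) - (\<integral>x. f s x \<partial>M)) / (Y i - s)) \<longlonglongrightarrow> (\<integral>x. f' s x \<partial>M)"
      by (simp only:)
    then show "(\<lambda>i. ((\<integral>x. f (X i) x \<partial>M) - (\<integral>x. f s x \<partial>M)) / (X i - s)) \<longlonglongrightarrow> (\<integral>x. f' s x \<partial>M)"
      unfolding Y_def by (rule LIMSEQ_offset)
  qed
  then show ?thesis by (simp add: has_field_derivative_iff)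
qed

text \<open>Independence of disjoint groups of coordinates; coordinates in neither group integrate
  out.\<close>

lemma nn_integral_gauss_factor:
  assumes I: "finite I" "J \<subseteq> I" "L \<subseteq> I" "J \<inter> L = {}"
    and [measurable]: "f \<in> borel_measurable (gauss J)" "h \<in> borel_measurable (gauss L)"
  shows "(\<integral>\<^sup>+z. f (restrict z J) * h (restrict z L) \<partial>gauss I) = (\<integral>\<^sup>+z. f z \<partial>gauss J) * (\<integral>\<^sup>+z. h z \<partial>gauss L)"
proof -
  have fin: "finite J" "finite L" using finite_subset[OF I(2,1)] finite_subset[OF I(3,1)] by auto
  define H where "H = (\<lambda>z. f (restrict z J) * h (restrict z L))"
  have rJ [measurable]: "(\<lambda>z. restrict z J) \<in> measurable (gauss (J \<union> L)) (gauss J)"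
    by (rule measurable_restrict_subset) auto
  have rL [measurable]: "(\<lambda>z. restrict z L) \<in> measurable (gauss (J \<union> L)) (gauss L)"
    by (rule measurable_restrict_subset) auto
  have H [measurable]: "H \<in> borel_measurable (gauss (J \<union> L))" unfolding H_def by measurable
  have rJL: "(\<lambda>z. restrict z (J \<union> L)) \<in> measurable (gauss I) (gauss (J \<union> L))"
    by (rule measurable_restrict_subset) (use I in auto)
  have "(\<integral>\<^sup>+z. H z \<partial>gauss I) = (\<integral>\<^sup>+z. H (restrict z (J \<union> L)) \<partial>gauss I)"
    by (auto simp: H_def Int_absorb1 Int_absorb2 intro!: nn_integral_cong)
  also have "\<dots> = (\<integral>\<^sup>+z. H z \<partial>distr (gauss I) (gauss (J \<union> L)) (\<lambda>z. restrict z (J \<union> L)))"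
    by (rule nn_integral_distr[symmetric, OF rJL]) simp
  also have "\<dots> = (\<integral>\<^sup>+z. H z \<partial>gauss (J \<union> L))"
    using I fin by (subst gauss.distr_PiM_restrict_finite) auto
  also have "\<dots> = (\<integral>\<^sup>+x. (\<integral>\<^sup>+y. H (merge J L (x, y)) \<partial>gauss L) \<partial>gauss J)"
    by (rule gauss.product_nn_integral_fold[OF I(4) fin H])
  also have "\<dots> = (\<integral>\<^sup>+x. (\<integral>\<^sup>+y. f x * h y \<partial>gauss L) \<partial>gauss J)"
    using I(4)
    by (intro nn_integral_cong) (auto simp: H_def space_PiM PiE_def extensional_restrict)
  also have "\<dots> = (\<integral>\<^sup>+z. f z \<partial>gauss J) * (\<integral>\<^sup>+z. h z \<partial>gauss L)"
    by (simp add: nn_integral_cmult nn_integral_multc)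
  finally show ?thesis by (simp add: H_def)
qed

section \<open>Gordon's comparison inequality\<close>

text \<open>
  Gordon's inequality compares \<open>\<parallel>G\<^sup>T a\<^sub>u\<parallel> + \<gamma>\<close> with \<open>\<parallel>h\<parallel> + g \<bullet> b\<^sub>u\<close>, where the vectors \<open>a\<^sub>u\<close> and \<open>b\<^sub>u\<close> have the
  same Gram matrix. A single Gaussian matrix \<open>z\<close> with \<open>n + 1\<close> rows and \<open>N + 1\<close> columns drives both
  sides: \<open>G\<close> is the upper left block, \<open>\<gamma>\<close> the corner \<open>z (n, N)\<close>, \<open>h\<close> the rest of the last row and \<open>g\<close> the
  rest of the last column. The path \<open>zeta s z\<close> runs from the right side at \<open>s = 0\<close> to the left side at
  \<open>s = \<pi>/2\<close>. The norm is smoothed by \<open>e\<close>, and the maximum of \<open>exp (lam * rho \<zeta> u)\<close> over \<open>u\<close> by a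
  power sum, which is recovered as \<open>q \<rightarrow> \<plusminus>\<infinity>\<close>.
\<close>

locale gordon_interpolation =
  fixes T :: "'u set" and A B :: "'u \<Rightarrow> nat \<Rightarrow> real" and n N :: nat and e q lam :: real
  assumes T: "finite T" "T \<noteq> {}"
    and unit: "\<And>u. u \<in> T \<Longrightarrow> (\<Sum>i<n. A u i * A u i) = 1"
    and gram: "\<And>u v. u \<in> T \<Longrightarrow> v \<in> T \<Longrightarrow> (\<Sum>i<n. B u i * B v i) = (\<Sum>i<n. A u i * A v i)"
    and e: "e > 0" and q: "q \<noteq> 0" and lam: "0 < lam / q" "lam / q \<le> 1"
begin

definition "S \<zeta> u = sqrt (e\<^sup>2 + (\<Sum>l<N. (\<zeta> u l)\<^sup>2))" for \<zeta> :: "'u \<Rightarrow> nat \<Rightarrow> real"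
definition "rho \<zeta> u = S \<zeta> u + \<zeta> u N" for \<zeta> :: "'u \<Rightarrow> nat \<Rightarrow> real"
definition "Phi \<zeta> = (\<Sum>u\<in>T. exp (q * rho \<zeta> u))"
text \<open>This is the \<open>p\<close>-norm of the family \<open>exp (lam * rho \<zeta> u)\<close>
  for \<open>p = q / lam\<close>; the condition \<open>0 < lam / q \<le> 1\<close> says
  \<open>p \<ge> 1\<close>. Negative \<open>lam\<close> goes with negative \<open>q\<close>.\<close>

definition "F \<zeta> = Phi \<zeta> powr (lam / q)"
definition "wt \<zeta> u = exp (q * rho \<zeta> u) / Phi \<zeta>"
text \<open>The derivative of \<open>rho\<close> in coordinate \<open>j\<close>. \<open>Rdd\<close>
  below is the second derivative in the same coordinate.\<close>

definition "Rd \<zeta> u j = (if j < N then \<zeta> u j / S \<zeta> u else 1)"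
definition "Rdd \<zeta> u j = (if j < N then (1 - (Rd \<zeta> u j)\<^sup>2) / S \<zeta> u else 0)"

lemma S_ge: "S \<zeta> u \<ge> e"
  unfolding S_def using e by (intro real_le_rsqrt) (simp add: sum_nonneg)

lemma S_pos: "S \<zeta> u > 0"
  using S_ge[of \<zeta> u] e by linarith

lemma S_sq: "(S \<zeta> u)\<^sup>2 = e\<^sup>2 + (\<Sum>l<N. (\<zeta> u l)\<^sup>2)"
  unfolding S_def by (intro real_sqrt_pow2 add_nonneg_nonneg sum_nonneg) auto

lemma Phi_pos: "Phi \<zeta> > 0"
  unfolding Phi_def using T by (intro sum_pos) auto

lemma F_pos: "F \<zeta> > 0"
  using Phi_pos[of \<zeta>] by (simp add: F_def)

lemma wt_nonneg: "wt \<zeta> u \<ge> 0"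
  using Phi_pos[of \<zeta>] by (simp add: wt_def)

lemma wt_sum: "(\<Sum>u\<in>T. wt \<zeta> u) = 1"
  using Phi_pos[of \<zeta>] by (simp add: wt_def Phi_def flip: sum_divide_distrib)

lemma wt_le_1: "u \<in> T \<Longrightarrow> wt \<zeta> u \<le> 1"
  using T wt_nonneg by (subst wt_sum[of \<zeta>, symmetric]) (intro member_le_sum, auto)

lemma sum_Rd_sq: "(\<Sum>j<N. (Rd \<zeta> u j)\<^sup>2) \<le> 1"
proof -
  have "(\<Sum>j<N. (Rd \<zeta> u j)\<^sup>2) = (\<Sum>j<N. (\<zeta> u j)\<^sup>2) / (S \<zeta> u)\<^sup>2"
    by (simp add: Rd_def power_divide sum_divide_distrib)
  also have "\<dots> \<le> 1"
  proof -
    have "(S \<zeta> u)\<^sup>2 > 0" using S_pos[of \<zeta> u] by simp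
    moreover have "(\<Sum>j<N. (\<zeta> u j)\<^sup>2) \<le> (S \<zeta> u)\<^sup>2" by (simp add: S_sq)
    ultimately show ?thesis by (simp add: divide_le_eq_1)
  qed
  finally show ?thesis .
qed

lemma abs_Rd_le: "\<bar>Rd \<zeta> u j\<bar> \<le> 1"
proof (cases "j < N")
  case True
  have "(Rd \<zeta> u j)\<^sup>2 \<le> (\<Sum>j<N. (Rd \<zeta> u j)\<^sup>2)" using True by (intro member_le_sum) auto
  also note sum_Rd_sq
  finally show ?thesis by (simp add: abs_square_le_1)
qed (simp add: Rd_def)

lemma abs_Rdd_le: "\<bar>Rdd \<zeta> u j\<bar> \<le> 1 / e"
proof (cases "j < N")
  case True
  have "(Rd \<zeta> u j)\<^sup>2 \<le> 1" using abs_Rd_le by (simp add: abs_square_le_1)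
  then have "\<bar>1 - (Rd \<zeta> u j)\<^sup>2\<bar> \<le> 1" by (simp add: abs_le_iff)
  then have "\<bar>Rdd \<zeta> u j\<bar> \<le> 1 / S \<zeta> u"
    using True S_pos[of \<zeta> u] by (simp add: Rdd_def abs_divide divide_right_mono)
  also have "\<dots> \<le> 1 / e" using S_ge e by (intro divide_left_mono) (auto simp: S_pos)
  finally show ?thesis .
qed (use e in \<open>simp add: Rdd_def\<close>)

text \<open>Gradients of the smoothed norm are no longer than unit vectors. Together with
  \<open>A_inner_le\<close> this decides the sign of the drift.\<close>

lemma Rd_inner_le: "(\<Sum>j<N. Rd \<zeta> u j * Rd \<zeta> v j) \<le> 1"
proof -
  have "Rd \<zeta> u j * Rd \<zeta> v j \<le> ((Rd \<zeta> u j)\<^sup>2 + (Rd \<zeta> v j)\<^sup>2) / 2" for j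
    using zero_le_power2[of "Rd \<zeta> u j - Rd \<zeta> v j"] by (simp add: power2_diff)
  then have "(\<Sum>j<N. Rd \<zeta> u j * Rd \<zeta> v j) \<le> (\<Sum>j<N. ((Rd \<zeta> u j)\<^sup>2 + (Rd \<zeta> v j)\<^sup>2) / 2)"
    by (intro sum_mono)
  also have "\<dots> = ((\<Sum>j<N. (Rd \<zeta> u j)\<^sup>2) + (\<Sum>j<N. (Rd \<zeta> v j)\<^sup>2)) / 2"
    by (simp add: sum.distrib flip: sum_divide_distrib)
  also have "\<dots> \<le> 1" using sum_Rd_sq[of \<zeta> u] sum_Rd_sq[of \<zeta> v] by simp
  finally show ?thesis .
qed

lemma A_inner_le: "u \<in> T \<Longrightarrow> v \<in> T \<Longrightarrow> (\<Sum>i<n. A u i * A v i) \<le> 1"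
proof -
  assume uv: "u \<in> T" "v \<in> T"
  have "A u i * A v i \<le> (A u i * A u i + A v i * A v i) / 2" for i
    using zero_le_power2[of "A u i - A v i"] by (simp add: power2_eq_square algebra_simps)
  then have "(\<Sum>i<n. A u i * A v i) \<le> (\<Sum>i<n. (A u i * A u i + A v i * A v i) / 2)"
    by (intro sum_mono)
  also have "\<dots> = 1" using uv by (simp add: sum.distrib unit flip: sum_divide_distrib)
  finally show ?thesis .
qed

lemma A_le: "u \<in> T \<Longrightarrow> i < n \<Longrightarrow> \<bar>A u i\<bar> \<le> 1" and B_le: "u \<in> T \<Longrightarrow> i < n \<Longrightarrow> \<bar>B u i\<bar> \<le> 1"
proof -
  assume u: "u \<in> T" "i < n"
  have "A u i * A u i \<le> (\<Sum>i<n. A u i * A u i)" "B u i * B u i \<le> (\<Sum>i<n. B u i * B u i)"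
    using u by (intro member_le_sum; auto)+
  then have "(A u i)\<^sup>2 \<le> 1" "(B u i)\<^sup>2 \<le> 1"
    using u by (simp_all add: unit gram power2_eq_square)
  then show "\<bar>A u i\<bar> \<le> 1" "\<bar>B u i\<bar> \<le> 1" by (simp_all add: abs_square_le_1)
qed

context
  fixes Z :: "real \<Rightarrow> 'u \<Rightarrow> nat \<Rightarrow> real" and D :: "'u \<Rightarrow> nat \<Rightarrow> real" and t :: real
  assumes Z: "\<And>u j. u \<in> T \<Longrightarrow> j \<le> N \<Longrightarrow> ((\<lambda>t. Z t u j) has_real_derivative D u j) (at t)"
begin

text \<open>The calculus is set up along an arbitrary curve \<open>Z\<close> because it is applied
  twice: in the path parameter \<open>s\<close>, and in a single Gaussian entry when integrating by
  parts.\<close>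

lemma deriv_S:
  assumes u: "u \<in> T"
  shows "((\<lambda>t. S (Z t) u) has_real_derivative (\<Sum>j<N. Rd (Z t) u j * D u j)) (at t)"
proof -
  have d: "((\<lambda>t. e\<^sup>2 + (\<Sum>l<N. (Z t u l)\<^sup>2)) has_real_derivative (\<Sum>l<N. 2 * Z t u l * D u l)) (at t)"
  proof -
    have "((\<lambda>t. (Z t u l)\<^sup>2) has_real_derivative 2 * Z t u l * D u l) (at t)" if "l \<in> {..<N}" for l
      using DERIV_power[OF Z[OF u, of l], of 2] that by (simp add: mult_ac)
    then have "((\<lambda>t. \<Sum>l<N. (Z t u l)\<^sup>2) has_real_derivative (\<Sum>l<N. 2 * Z t u l * D u l)) (at t)"
      by (intro DERIV_sum) auto
    from DERIV_add[OF DERIV_const[of "e\<^sup>2"] this] show ?thesis by simp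
  qed
  have pos: "e\<^sup>2 + (\<Sum>l<N. (Z t u l)\<^sup>2) > 0" using e by (simp add: add_pos_nonneg sum_nonneg)
  have "((\<lambda>t. sqrt (e\<^sup>2 + (\<Sum>l<N. (Z t u l)\<^sup>2))) has_real_derivative
      inverse (sqrt (e\<^sup>2 + (\<Sum>l<N. (Z t u l)\<^sup>2))) / 2 * (\<Sum>l<N. 2 * Z t u l * D u l)) (at t)"
    by (rule DERIV_chain2[where f = sqrt, OF DERIV_real_sqrt[OF pos] d])
  moreover have "inverse (sqrt (e\<^sup>2 + (\<Sum>l<N. (Z t u l)\<^sup>2))) / 2 * (\<Sum>l<N. 2 * Z t u l * D u l)
      = (\<Sum>j<N. Rd (Z t) u j * D u j)"
    unfolding sum_distrib_left S_def[of "Z t" u, symmetric] using S_pos[of "Z t" u]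
    by (intro sum.cong) (simp_all add: Rd_def field_simps)
  ultimately show ?thesis by (simp add: S_def)
qed

lemma deriv_rho:
  assumes u: "u \<in> T"
  shows "((\<lambda>t. rho (Z t) u) has_real_derivative (\<Sum>j\<le>N. Rd (Z t) u j * D u j)) (at t)"
  unfolding rho_def using DERIV_add[OF deriv_S[OF u] Z[OF u order_refl]]
  by (simp add: Rd_def lessThan_Suc_atMost[symmetric])

definition "drho u = (\<Sum>j\<le>N. Rd (Z t) u j * D u j)"

lemma deriv_Phi:
  "(Phi \<circ> Z has_real_derivative q * Phi (Z t) * (\<Sum>u\<in>T. wt (Z t) u * drho u)) (at t)"
proof -
  have "((\<lambda>t. \<Sum>u\<in>T. exp (q * rho (Z t) u)) has_real_derivative
      (\<Sum>u\<in>T. exp (q * rho (Z t) u) * (q * drho u))) (at t)"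
    unfolding drho_def by (auto intro!: derivative_eq_intros deriv_rho sum.cong)
  moreover have "(\<Sum>u\<in>T. exp (q * rho (Z t) u) * (q * drho u))
      = q * Phi (Z t) * (\<Sum>u\<in>T. wt (Z t) u * drho u)"
    unfolding sum_distrib_left using Phi_pos[of "Z t"] by (intro sum.cong) (auto simp: wt_def)
  ultimately show ?thesis by (simp add: Phi_def[abs_def] comp_def)
qed

lemma deriv_F:
  "((\<lambda>t. F (Z t)) has_real_derivative lam * F (Z t) * (\<Sum>u\<in>T. wt (Z t) u * drho u)) (at t)"
proof -
  have "((\<lambda>t. Phi (Z t) powr (lam / q)) has_real_derivative
      (lam / q * Phi (Z t) powr (lam / q - 1)) * (q * Phi (Z t) * (\<Sum>u\<in>T. wt (Z t) u * drho u))) (at t)"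
    using DERIV_chain2[where f = "\<lambda>x. x powr (lam / q)" and g = "\<lambda>t. Phi (Z t)" and x = t and s = UNIV,
        OF has_real_derivative_powr[OF Phi_pos] deriv_Phi[unfolded comp_def]] .
  moreover have "Phi (Z t) powr (lam / q - 1) * Phi (Z t) = F (Z t)"
    using Phi_pos[of "Z t"] by (simp add: F_def powr_diff)
  moreover have "lam / q * p * (q * P * x) = lam * (p * P) * x" for p P x :: real using q by simp
  ultimately show ?thesis unfolding F_def[symmetric] by simp
qed

lemma deriv_wt:
  assumes u: "u \<in> T"
  shows "((\<lambda>t. wt (Z t) u) has_real_derivative
    q * wt (Z t) u * (drho u - (\<Sum>v\<in>T. wt (Z t) v * drho v))) (at t)"
proof -
  have "((\<lambda>t. exp (q * rho (Z t) u)) has_real_derivative exp (q * rho (Z t) u) * (q * drho u)) (at t)"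
    unfolding drho_def by (auto intro!: derivative_eq_intros deriv_rho u)
  from DERIV_divide[OF this deriv_Phi[unfolded comp_def]] Phi_pos[of "Z t"]
  have "((\<lambda>t. wt (Z t) u) has_real_derivative
     (exp (q * rho (Z t) u) * (q * drho u) * Phi (Z t) - exp (q * rho (Z t) u) *
       (q * Phi (Z t) * (\<Sum>v\<in>T. wt (Z t) v * drho v))) / (Phi (Z t) * Phi (Z t))) (at t)"
    by (simp add: wt_def[abs_def])
  moreover have "(exp (q * rho (Z t) u) * (q * drho u) * Phi (Z t) - exp (q * rho (Z t) u) *
       (q * Phi (Z t) * (\<Sum>v\<in>T. wt (Z t) v * drho v))) / (Phi (Z t) * Phi (Z t))
     = q * wt (Z t) u * (drho u - (\<Sum>v\<in>T. wt (Z t) v * drho v))"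
    using Phi_pos[of "Z t"] by (simp add: wt_def[of "Z t" u] field_simps)
  ultimately show ?thesis by simp
qed

text \<open>A Gaussian entry \<open>z (i, j)\<close> moves only coordinate \<open>j\<close> of
  \<open>zeta\<close>, so the diagonal second derivative is the one that enters.\<close>

lemma deriv_Rd:
  assumes u: "u \<in> T" and j: "j \<le> N" and D0: "\<And>l. l \<le> N \<Longrightarrow> l \<noteq> j \<Longrightarrow> D u l = 0"
  shows "((\<lambda>t. Rd (Z t) u j) has_real_derivative Rdd (Z t) u j * D u j) (at t)"
proof (cases "j < N")
  case True
  have "(\<Sum>l<N. Rd (Z t) u l * D u l) = (\<Sum>l<N. if l = j then Rd (Z t) u j * D u j else 0)"
    using D0 by (intro sum.cong) auto
  also have "\<dots> = Rd (Z t) u j * D u j" using True by simp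
  finally have dS: "((\<lambda>t. S (Z t) u) has_real_derivative Rd (Z t) u j * D u j) (at t)"
    using deriv_S[OF u] by simp
  have "((\<lambda>t. Z t u j / S (Z t) u) has_real_derivative
      (D u j * S (Z t) u - Z t u j * (Rd (Z t) u j * D u j)) / (S (Z t) u * S (Z t) u)) (at t)"
    by (rule DERIV_divide[OF Z[OF u j] dS]) (use S_pos[of "Z t" u] in simp)
  moreover have "(D u j * S (Z t) u - Z t u j * (Rd (Z t) u j * D u j)) / (S (Z t) u * S (Z t) u)
      = Rdd (Z t) u j * D u j"
    using True S_pos[of "Z t" u] by (simp add: Rdd_def Rd_def field_simps power2_eq_square)
  ultimately show ?thesis using True by (simp add: Rd_def)
qed (simp add: Rd_def Rdd_def)

lemma deriv_F_wt_Rd: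
  assumes u: "u \<in> T" and j: "j \<le> N" and D0: "\<And>u l. u \<in> T \<Longrightarrow> l \<le> N \<Longrightarrow> l \<noteq> j \<Longrightarrow> D u l = 0"
  defines "m \<equiv> (\<Sum>v\<in>T. wt (Z t) v * (Rd (Z t) v j * D v j))"
  shows "((\<lambda>t. F (Z t) * wt (Z t) u * Rd (Z t) u j) has_real_derivative
     F (Z t) * (lam * wt (Z t) u * Rd (Z t) u j * m
       + q * wt (Z t) u * (Rd (Z t) u j * D u j - m) * Rd (Z t) u j
       + wt (Z t) u * Rdd (Z t) u j * D u j)) (at t)"
proof -
  have dr: "drho v = Rd (Z t) v j * D v j" if v: "v \<in> T" for v
  proof -
    have "drho v = (\<Sum>l\<le>N. if l = j then Rd (Z t) v j * D v j else 0)"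
      unfolding drho_def using D0[OF v] by (intro sum.cong) auto
    then show ?thesis using j by simp
  qed
  have m: "(\<Sum>v\<in>T. wt (Z t) v * drho v) = m"
    unfolding m_def by (intro sum.cong) (auto simp: dr)
  show ?thesis
    using DERIV_mult[OF DERIV_mult[OF deriv_F deriv_wt[OF u]] deriv_Rd[OF u j D0[OF u]]]
    unfolding m dr[OF u] by (simp add: algebra_simps)
qed

end

context
  fixes Z :: "real \<Rightarrow> 'u \<Rightarrow> nat \<Rightarrow> real" and t :: real
  assumes Z: "\<And>u j. u \<in> T \<Longrightarrow> j \<le> N \<Longrightarrow> isCont (\<lambda>t. Z t u j) t"
begin

lemma cont_S: "u \<in> T \<Longrightarrow> isCont (\<lambda>t. S (Z t) u) t"
  unfolding S_def by (intro continuous_intros Z) auto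

lemma cont_rho: "u \<in> T \<Longrightarrow> isCont (\<lambda>t. rho (Z t) u) t"
  unfolding rho_def by (intro continuous_intros Z cont_S) auto

lemma cont_Phi: "isCont (\<lambda>t. Phi (Z t)) t"
  unfolding Phi_def by (intro continuous_intros cont_rho) auto

lemma cont_F: "isCont (\<lambda>t. F (Z t)) t"
  unfolding F_def using Phi_pos[of "Z t"] by (intro continuous_intros cont_Phi) auto

lemma cont_wt: "u \<in> T \<Longrightarrow> isCont (\<lambda>t. wt (Z t) u) t"
  unfolding wt_def using Phi_pos[of "Z t"] by (intro continuous_intros cont_Phi cont_rho) auto

lemma cont_Rd: "u \<in> T \<Longrightarrow> j \<le> N \<Longrightarrow> isCont (\<lambda>t. Rd (Z t) u j) t"
  unfolding Rd_def using S_pos[of "Z t" u]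
  by (cases "j < N") (auto intro!: continuous_intros cont_S Z)

lemma cont_Rdd: "u \<in> T \<Longrightarrow> j \<le> N \<Longrightarrow> isCont (\<lambda>t. Rdd (Z t) u j) t"
  unfolding Rdd_def using S_pos[of "Z t" u]
  by (cases "j < N") (auto intro!: continuous_intros cont_S cont_Rd)

end

definition "K s u i j =
  (if j < N then (if i < n then sin s * A u i else cos s) else (if i < n then cos s * B u i else sin s))"

definition "K' s u i j =
  (if j < N then (if i < n then cos s * A u i else - sin s) else (if i < n then - sin s * B u i else cos s))"

definition "zeta s z u j = (\<Sum>i\<le>n. K s u i j * z (i, j))" for z :: "nat \<times> nat \<Rightarrow> real"

abbreviation "I \<equiv> {..n} \<times> {..N}"

lemma abs_mult_le_1: "\<bar>a\<bar> \<le> 1 \<Longrightarrow> \<bar>b\<bar> \<le> 1 \<Longrightarrow> \<bar>a * b\<bar> \<le> (1 :: real)"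
  using mult_mono[of "\<bar>a\<bar>" 1 "\<bar>b\<bar>" 1] by (simp add: abs_mult)

lemma K_le: "u \<in> T \<Longrightarrow> \<bar>K s u i j\<bar> \<le> 1"
  by (auto simp: K_def intro!: abs_mult_le_1 A_le B_le)

lemma K'_le: "u \<in> T \<Longrightarrow> \<bar>K' s u i j\<bar> \<le> 1"
  using abs_mult_le_1[of "- sin s" "B u i"] by (auto simp: K'_def intro!: abs_mult_le_1 A_le B_le)

lemma zeta_deriv_s:
  "((\<lambda>s. zeta s z u j) has_real_derivative (\<Sum>i\<le>n. K' s u i j * z (i, j))) (at s)"
proof -
  have "((\<lambda>s. K s u i j) has_real_derivative K' s u i j) (at s)" for i
    by (auto simp: K_def K'_def intro!: derivative_eq_intros)
  then show ?thesis unfolding zeta_def by (auto intro!: derivative_eq_intros)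
qed

lemma zeta_upd:
  assumes "i \<le> n"
  shows "zeta s (z((i, j) := y)) u l
    = (if l = j then K s u i j * y + (\<Sum>i'\<in>{..n} - {i}. K s u i' j * z (i', j)) else zeta s z u l)"
proof (cases "l = j")
  case True
  have "zeta s (z((i, j) := y)) u j = (\<Sum>i'\<in>insert i ({..n} - {i}). K s u i' j * (z((i, j) := y)) (i', j))"
    unfolding zeta_def using assms by (intro sum.cong) auto
  also have "\<dots> = K s u i j * y + (\<Sum>i'\<in>{..n} - {i}. K s u i' j * z (i', j))"
    by (subst sum.insert) auto
  finally show ?thesis using True by simp
qed (simp add: zeta_def)

lemma zeta_deriv_z:
  assumes "i \<le> n"
  shows "((\<lambda>y. zeta s (z((i, j) := y)) u l) has_real_derivative (if l = j then K s u i j else 0)) (at y)"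
  unfolding zeta_upd[OF assms] by (auto intro!: derivative_eq_intros)

lemma zeta_meas: "j \<le> N \<Longrightarrow> (\<lambda>z. zeta s z u j) \<in> borel_measurable (gauss I)"
  unfolding zeta_def by (intro borel_measurable_sum borel_measurable_times measurable_component_singleton) auto

lemma S_meas: "(\<lambda>z. S (zeta s z) u) \<in> borel_measurable (gauss I)"
  unfolding S_def using zeta_meas by measurable

lemma rho_meas: "(\<lambda>z. rho (zeta s z) u) \<in> borel_measurable (gauss I)"
  unfolding rho_def by (intro borel_measurable_add S_meas zeta_meas) auto

lemma Phi_meas: "(\<lambda>z. Phi (zeta s z)) \<in> borel_measurable (gauss I)"
  unfolding Phi_def using rho_meas by measurable

lemma F_meas: "(\<lambda>z. F (zeta s z)) \<in> borel_measurable (gauss I)"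
  unfolding F_def using Phi_meas by measurable

lemma wt_meas: "(\<lambda>z. wt (zeta s z) u) \<in> borel_measurable (gauss I)"
  unfolding wt_def using Phi_meas rho_meas by measurable

lemma Rd_meas: "j \<le> N \<Longrightarrow> (\<lambda>z. Rd (zeta s z) u j) \<in> borel_measurable (gauss I)"
  unfolding Rd_def using S_meas zeta_meas by (cases "j < N") auto

lemma Rdd_meas: "j \<le> N \<Longrightarrow> (\<lambda>z. Rdd (zeta s z) u j) \<in> borel_measurable (gauss I)"
  unfolding Rdd_def using S_meas Rd_meas by (cases "j < N") auto

definition "mm s z i j = (\<Sum>v\<in>T. wt (zeta s z) v * (Rd (zeta s z) v j * K s v i j))"

text \<open>Up to the factor \<open>lam\<close> this is the derivative of \<open>F\<close> in
  coordinate \<open>j\<close> at the point \<open>u\<close>. \<open>H'\<close> is its derivative in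
  the entry \<open>z (i, j)\<close>.\<close>

definition "H s z u j = F (zeta s z) * wt (zeta s z) u * Rd (zeta s z) u j"

definition "H' s z u i j = F (zeta s z) * (lam * wt (zeta s z) u * Rd (zeta s z) u j * mm s z i j
   + q * wt (zeta s z) u * (Rd (zeta s z) u j * K s u i j - mm s z i j) * Rd (zeta s z) u j
   + wt (zeta s z) u * Rdd (zeta s z) u j * K s u i j)"

lemma H_meas: "j \<le> N \<Longrightarrow> (\<lambda>z. H s z u j) \<in> borel_measurable (gauss I)"
  unfolding H_def by (intro borel_measurable_times F_meas wt_meas Rd_meas)

lemma mm_meas: "j \<le> N \<Longrightarrow> (\<lambda>z. mm s z i j) \<in> borel_measurable (gauss I)"
  unfolding mm_def by (intro borel_measurable_sum borel_measurable_times wt_meas Rd_meas) auto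

lemma H'_meas: "j \<le> N \<Longrightarrow> (\<lambda>z. H' s z u i j) \<in> borel_measurable (gauss I)"
  unfolding H'_def
  by (intro borel_measurable_times borel_measurable_add borel_measurable_diff
      F_meas wt_meas Rd_meas Rdd_meas mm_meas) auto

lemma H_deriv:
  assumes "u \<in> T" "i \<le> n" "j \<le> N"
  shows "((\<lambda>y. H s (z((i, j) := y)) u j) has_real_derivative H' s (z((i, j) := y)) u i j) (at y)"
  unfolding H_def H'_def mm_def
  using deriv_F_wt_Rd[of "\<lambda>y. zeta s (z((i, j) := y))" "\<lambda>u l. if l = j then K s u i j else 0" y u j]
    zeta_deriv_z[OF assms(2)] assms by simp

lemma H'_cont:
  assumes "u \<in> T" "i \<le> n" "j \<le> N"
  shows "isCont (\<lambda>y. H' s (z((i, j) := y)) u i j) y"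
proof -
  have Z: "isCont (\<lambda>y. zeta s (z((i, j) := y)) u l) y" for u l
    by (rule DERIV_isCont[OF zeta_deriv_z[OF assms(2)]])
  show ?thesis
    unfolding H'_def mm_def
    by (intro continuous_intros cont_F cont_wt cont_Rd cont_Rdd Z assms)
qed

definition "X z = (\<Sum>a\<in>I. \<bar>z a\<bar>)" for z :: "nat \<times> nat \<Rightarrow> real"

lemma sum_zeta_le: "u \<in> T \<Longrightarrow> (\<Sum>j\<le>N. \<bar>zeta s z u j\<bar>) \<le> X z"
proof -
  assume u: "u \<in> T"
  have "(\<Sum>j\<le>N. \<bar>zeta s z u j\<bar>) \<le> (\<Sum>j\<le>N. \<Sum>i\<le>n. \<bar>z (i, j)\<bar>)"
  proof (intro sum_mono)
    fix j
    have "\<bar>zeta s z u j\<bar> \<le> (\<Sum>i\<le>n. \<bar>K s u i j * z (i, j)\<bar>)" unfolding zeta_def by (rule sum_abs)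
    also have "\<dots> \<le> (\<Sum>i\<le>n. \<bar>z (i, j)\<bar>)"
      using K_le[OF u] by (intro sum_mono) (simp add: abs_mult mult_left_le_one_le)
    finally show "\<bar>zeta s z u j\<bar> \<le> (\<Sum>i\<le>n. \<bar>z (i, j)\<bar>)" .
  qed
  also have "\<dots> = X z"
    unfolding X_def by (subst sum.swap) (simp add: sum.cartesian_product)
  finally show ?thesis .
qed

lemma S_le: "S \<zeta> u \<le> e + sqrt (\<Sum>l<N. (\<zeta> u l)\<^sup>2)"
  unfolding S_def using sqrt_add_le_add_sqrt[of "e\<^sup>2" "\<Sum>l<N. (\<zeta> u l)\<^sup>2"] e
  by (simp add: sum_nonneg)

lemma abs_rho_le: "u \<in> T \<Longrightarrow> \<bar>rho (zeta s z) u\<bar> \<le> e + X z"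
proof -
  assume u: "u \<in> T"
  have "sqrt (\<Sum>l<N. (zeta s z u l)\<^sup>2) \<le> (\<Sum>l<N. \<bar>zeta s z u l\<bar>)"
    using L2_set_le_sum_abs[of "zeta s z u" "{..<N}"] by (simp add: L2_set_def)
  then have "\<bar>rho (zeta s z) u\<bar> \<le> e + ((\<Sum>l<N. \<bar>zeta s z u l\<bar>) + \<bar>zeta s z u N\<bar>)"
    using S_le[of "zeta s z" u] S_pos[of "zeta s z" u] unfolding rho_def by linarith
  also have "(\<Sum>l<N. \<bar>zeta s z u l\<bar>) + \<bar>zeta s z u N\<bar> = (\<Sum>l\<le>N. \<bar>zeta s z u l\<bar>)"
    by (simp add: lessThan_Suc_atMost[symmetric])
  finally show ?thesis using sum_zeta_le[OF u, of s z] by linarith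
qed

lemma F_le: "F (zeta s z) \<le> (real (card T) powr (lam / q) * exp (\<bar>lam\<bar> * e)) * exp (\<bar>lam\<bar> * X z)"
proof -
  have "Phi (zeta s z) \<le> (\<Sum>u\<in>T. exp (\<bar>q\<bar> * (e + X z)))"
    unfolding Phi_def
  proof (intro sum_mono)
    fix u assume u: "u \<in> T"
    have "q * rho (zeta s z) u \<le> \<bar>q\<bar> * \<bar>rho (zeta s z) u\<bar>" by (simp flip: abs_mult)
    also have "\<dots> \<le> \<bar>q\<bar> * (e + X z)" using abs_rho_le[OF u] by (intro mult_left_mono) auto
    finally show "exp (q * rho (zeta s z) u) \<le> exp (\<bar>q\<bar> * (e + X z))" by simp
  qed
  also have "\<dots> = real (card T) * exp (\<bar>q\<bar> * (e + X z))" by simp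
  finally have "F (zeta s z) \<le> (real (card T) * exp (\<bar>q\<bar> * (e + X z))) powr (lam / q)"
    unfolding F_def using Phi_pos[of "zeta s z"] lam by (intro powr_mono2) auto
  also have "\<dots> = real (card T) powr (lam / q) * exp (\<bar>q\<bar> * (e + X z)) powr (lam / q)"
    by (rule powr_mult)
  also have "exp (\<bar>q\<bar> * (e + X z)) powr (lam / q) = exp (lam / q * (\<bar>q\<bar> * (e + X z)))"
    by (simp add: powr_def)
  \<comment> \<open>\<open>lam\<close> and \<open>q\<close> have the same sign, so \<open>q\<close>
    cancels from the growth rate.\<close>
  also have "lam / q * (\<bar>q\<bar> * (e + X z)) = \<bar>lam\<bar> * e + \<bar>lam\<bar> * X z"
  proof -
    have "lam / q * \<bar>q\<bar> = \<bar>lam\<bar>" using lam(1) q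
      by (auto simp: abs_if zero_less_divide_iff)
    then show ?thesis by (metis distrib_left mult.assoc)
  qed
  finally show ?thesis by (simp add: exp_add mult.assoc)
qed

definition "C0 = real (card T) powr (lam / q) * exp (\<bar>lam\<bar> * e)"

lemma abs_F_mult_le: "\<bar>x\<bar> \<le> c \<Longrightarrow> \<bar>F (zeta s z) * x\<bar> \<le> C0 * c * exp (\<bar>lam\<bar> * X z)"
proof -
  assume x: "\<bar>x\<bar> \<le> c"
  have "\<bar>F (zeta s z) * x\<bar> \<le> (C0 * exp (\<bar>lam\<bar> * X z)) * c"
    unfolding abs_mult using x F_le[of s z] F_pos[of "zeta s z"]
    by (intro mult_mono) (auto simp: C0_def)
  then show ?thesis by (simp add: mult_ac)
qed

lemma abs_mm_le: "\<bar>mm s z i j\<bar> \<le> 1"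
proof -
  have "\<bar>mm s z i j\<bar> \<le> (\<Sum>v\<in>T. \<bar>wt (zeta s z) v * (Rd (zeta s z) v j * K s v i j)\<bar>)"
    unfolding mm_def by (rule sum_abs)
  also have "\<dots> \<le> (\<Sum>v\<in>T. wt (zeta s z) v)"
  proof (intro sum_mono)
    fix v assume v: "v \<in> T"
    have "\<bar>wt (zeta s z) v * (Rd (zeta s z) v j * K s v i j)\<bar>
        = wt (zeta s z) v * \<bar>Rd (zeta s z) v j * K s v i j\<bar>"
      using wt_nonneg by (simp add: abs_mult)
    also have "\<dots> \<le> wt (zeta s z) v * 1"
      by (intro mult_left_mono abs_mult_le_1 abs_Rd_le K_le v wt_nonneg)
    finally show "\<bar>wt (zeta s z) v * (Rd (zeta s z) v j * K s v i j)\<bar> \<le> wt (zeta s z) v" by simp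
  qed
  finally show ?thesis by (simp add: wt_sum)
qed

lemma abs_wt_le: "u \<in> T \<Longrightarrow> \<bar>wt \<zeta> u\<bar> \<le> 1"
  using wt_le_1[of u \<zeta>] wt_nonneg[of \<zeta> u] by simp

lemma H_bound: "u \<in> T \<Longrightarrow> \<bar>H s z u j\<bar> \<le> C0 * 1 * exp (\<bar>lam\<bar> * X z)"
  unfolding H_def mult.assoc[of "F (zeta s z)"]
  by (rule abs_F_mult_le) (intro abs_mult_le_1 abs_wt_le abs_Rd_le)

text \<open>The term \<open>1 / e\<close> bounds the second derivative of the smoothed norm; the
  norm itself has no bounded second derivative near 0.\<close>

lemma H'_bound:
  assumes u: "u \<in> T"
  shows "\<bar>H' s z u i j\<bar> \<le> C0 * (\<bar>lam\<bar> + 2 * \<bar>q\<bar> + 1 / e) * exp (\<bar>lam\<bar> * X z)"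
  unfolding H'_def
proof (rule abs_F_mult_le)
  let ?w = "wt (zeta s z) u" and ?R = "Rd (zeta s z) u j" and ?m = "mm s z i j"
  have w: "\<bar>?w\<bar> \<le> 1" and R: "\<bar>?R\<bar> \<le> 1" and m: "\<bar>?m\<bar> \<le> 1" and k: "\<bar>K s u i j\<bar> \<le> 1"
    using abs_wt_le[OF u] abs_Rd_le abs_mm_le K_le[OF u] by auto
  have 1: "\<bar>lam * ?w * ?R * ?m\<bar> \<le> \<bar>lam\<bar>"
    using abs_mult_le_1[OF abs_mult_le_1[OF w R] m] mult_left_mono[of _ 1 "\<bar>lam\<bar>"]
    by (simp add: abs_mult mult.assoc)
  have RK: "\<bar>(?R * K s u i j - ?m) / 2\<bar> \<le> 1"
    using abs_mult_le_1[OF R k] m by (simp add: abs_le_iff)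
  have 2: "\<bar>q * ?w * (?R * K s u i j - ?m) * ?R\<bar> \<le> 2 * \<bar>q\<bar>"
    using mult_left_mono[OF abs_mult_le_1[OF abs_mult_le_1[OF w RK] R], of "2 * \<bar>q\<bar>"]
    by (simp add: abs_mult mult_ac)
  have "\<bar>Rdd (zeta s z) u j * e\<bar> \<le> 1"
    using mult_right_mono[OF abs_Rdd_le[of "zeta s z" u j], of e] e by (simp add: abs_mult)
  then have "\<bar>?w * (Rdd (zeta s z) u j * e) * K s u i j\<bar> \<le> 1"
    using abs_mult_le_1[OF abs_mult_le_1[OF w] k] by blast
  moreover have "\<bar>?w * (Rdd (zeta s z) u j * e) * K s u i j\<bar> = \<bar>?w * Rdd (zeta s z) u j * K s u i j\<bar> * e"
    using e by (simp add: abs_mult)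
  ultimately have 3: "\<bar>?w * Rdd (zeta s z) u j * K s u i j\<bar> \<le> 1 / e"
    using e by (simp only: pos_le_divide_eq)
  show "\<bar>lam * ?w * ?R * ?m + q * ?w * (?R * K s u i j - ?m) * ?R
      + ?w * Rdd (zeta s z) u j * K s u i j\<bar> \<le> \<bar>lam\<bar> + 2 * \<bar>q\<bar> + 1 / e"
    using 1 2 3 by linarith
qed

text \<open>The chain rule, arranged as a linear combination of terms \<open>z a * H\<close>, the
  shape to which integration by parts in the entry \<open>a\<close> applies.\<close>

definition "dF s z = lam * (\<Sum>u\<in>T. \<Sum>a\<in>I. K' s u (fst a) (snd a) * (z a * H s z u (snd a)))"

lemma F_deriv_s: "((\<lambda>s. F (zeta s z)) has_real_derivative dF s z) (at s)"
proof -
  have "((\<lambda>s. F (zeta s z)) has_real_derivative lam * F (zeta s z) * (\<Sum>u\<in>T. wt (zeta s z) u *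
      (\<Sum>j\<le>N. Rd (zeta s z) u j * (\<Sum>i\<le>n. K' s u i j * z (i, j))))) (at s)"
    using deriv_F[of "\<lambda>s. zeta s z" "\<lambda>u j. \<Sum>i\<le>n. K' s u i j * z (i, j)" s] zeta_deriv_s
    by (simp add: drho_def[of "\<lambda>s. zeta s z" "\<lambda>u j. \<Sum>i\<le>n. K' s u i j * z (i, j)" s])
  moreover have "lam * F (zeta s z) * (\<Sum>u\<in>T. wt (zeta s z) u *
      (\<Sum>j\<le>N. Rd (zeta s z) u j * (\<Sum>i\<le>n. K' s u i j * z (i, j)))) = dF s z"
  proof -
    have "(\<Sum>a\<in>I. K' s u (fst a) (snd a) * (z a * H s z u (snd a)))
        = F (zeta s z) * (wt (zeta s z) u * (\<Sum>j\<le>N. Rd (zeta s z) u j * (\<Sum>i\<le>n. K' s u i j * z (i, j))))" for u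
    proof -
      have "(\<Sum>a\<in>I. K' s u (fst a) (snd a) * (z a * H s z u (snd a)))
          = (\<Sum>i\<le>n. \<Sum>j\<le>N. K' s u i j * (z (i, j) * H s z u j))"
        by (simp add: sum.cartesian_product split_def)
      also have "\<dots> = (\<Sum>j\<le>N. \<Sum>i\<le>n. K' s u i j * (z (i, j) * H s z u j))" by (rule sum.swap)
      finally show ?thesis by (simp add: H_def sum_distrib_left mult_ac)
    qed
    then show ?thesis by (simp add: dF_def sum_distrib_left mult_ac)
  qed
  ultimately show ?thesis by simp
qed

lemma dF_bound:
  "\<bar>dF s z\<bar> \<le> (\<bar>lam\<bar> * (real (card T) * (real (card I) * C0))) * exp ((\<bar>lam\<bar> + 1) * X z)"
proof -
  have "\<bar>\<Sum>u\<in>T. \<Sum>a\<in>I. K' s u (fst a) (snd a) * (z a * H s z u (snd a))\<bar>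
      \<le> (\<Sum>u\<in>T. \<Sum>a\<in>I. C0 * exp ((\<bar>lam\<bar> + 1) * X z))"
  proof (intro order_trans[OF sum_abs] sum_mono)
    fix u a assume u: "u \<in> T" and a: "a \<in> I"
    have "\<bar>z a\<bar> \<le> X z" unfolding X_def using a by (intro member_le_sum) auto
    also have "\<dots> \<le> exp (X z)" using exp_ge_add_one_self[of "X z"] by linarith
    finally have za: "\<bar>z a\<bar> \<le> exp (X z)" .
    have "\<bar>K' s u (fst a) (snd a) * (z a * H s z u (snd a))\<bar> \<le> 1 * (exp (X z) * (C0 * 1 * exp (\<bar>lam\<bar> * X z)))"
      unfolding abs_mult by (intro mult_mono K'_le u za H_bound mult_nonneg_nonneg) auto
    also have "\<dots> = C0 * exp ((\<bar>lam\<bar> + 1) * X z)" by (simp add: algebra_simps exp_add)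
    finally show "\<bar>K' s u (fst a) (snd a) * (z a * H s z u (snd a))\<bar> \<le> C0 * exp ((\<bar>lam\<bar> + 1) * X z)" .
  qed
  then have "\<bar>lam\<bar> * \<bar>\<Sum>u\<in>T. \<Sum>a\<in>I. K' s u (fst a) (snd a) * (z a * H s z u (snd a))\<bar>
      \<le> \<bar>lam\<bar> * (\<Sum>u\<in>T. \<Sum>a\<in>I. C0 * exp ((\<bar>lam\<bar> + 1) * X z))"
    by (intro mult_left_mono) auto
  then show ?thesis by (simp add: dF_def abs_mult mult_ac)
qed

text \<open>Half the rate of change of the covariance of \<open>zeta s z u j\<close> and
  \<open>zeta s z v j\<close> along the path. Equality of the Gram matrices gives column
  \<open>N\<close> the same rate as the others with opposite sign, and this produces the factor one
  minus the inner product of gradients in the drift.\<close>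

lemma K_gram:
  assumes u: "u \<in> T" and v: "v \<in> T"
  shows "(\<Sum>i\<le>n. K' s u i j * K s v i j)
    = (if j < N then - 1 else 1) * (sin s * cos s * (1 - (\<Sum>i<n. A u i * A v i)))"
proof -
  have "(\<Sum>i\<le>n. K' s u i j * K s v i j) = (\<Sum>i<n. K' s u i j * K s v i j) + K' s u n j * K s v n j"
    by (simp add: lessThan_Suc_atMost[symmetric])
  also have "\<dots> = (if j < N then - 1 else 1) * (sin s * cos s * (1 - (\<Sum>i<n. A u i * A v i)))"
  proof (cases "j < N")
    case True
    have "(\<Sum>i<n. K' s u i j * K s v i j) = (\<Sum>i<n. sin s * cos s * (A u i * A v i))"
      using True by (intro sum.cong) (auto simp: K_def K'_def)
    then show ?thesis using True by (simp add: K_def K'_def algebra_simps flip: sum_distrib_left)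
  next
    case False
    have "(\<Sum>i<n. K' s u i j * K s v i j) = (\<Sum>i<n. - (sin s * cos s) * (B u i * B v i))"
      using False by (intro sum.cong) (auto simp: K_def K'_def)
    also have "\<dots> = - (sin s * cos s) * (\<Sum>i<n. A u i * A v i)"
      by (simp only: sum_distrib_left[symmetric] gram[OF u v])
    finally show ?thesis using False by (simp add: K_def K'_def algebra_simps)
  qed
  finally show ?thesis .
qed

text \<open>
  The diagonal terms \<open>u = v\<close>, and with them all terms in \<open>Rdd\<close>, vanish because the columns of \<open>K s u\<close>
  have constant length along the path.
\<close>

lemma drift_eq:
  "(\<Sum>u\<in>T. \<Sum>a\<in>I. K' s u (fst a) (snd a) * H' s z u (fst a) (snd a))
    = F (zeta s z) * ((lam - q) * (sin s * cos s) * (\<Sum>u\<in>T. \<Sum>v\<in>T. wt (zeta s z) u * wt (zeta s z) v *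
        ((1 - (\<Sum>i<n. A u i * A v i)) * (1 - (\<Sum>j<N. Rd (zeta s z) u j * Rd (zeta s z) v j)))))"
proof -
  define w R where "w = wt (zeta s z)" and "R = Rd (zeta s z)"
  define g where "g u v j = (if j < N then - 1 else 1) * (sin s * cos s * (1 - (\<Sum>i<n. A u i * A v i)))" for u v j
  have inner: "(\<Sum>i\<le>n. K' s u i j * H' s z u i j)
      = F (zeta s z) * ((lam - q) * (\<Sum>v\<in>T. w u * w v * (R u j * R v j * g u v j)))"
    if u: "u \<in> T" for u j
  proof -
    have guu: "g u u j = 0" using unit[OF u] by (simp add: g_def)
    have "K' s u i j * H' s z u i j = F (zeta s z) * ((lam - q) * (w u * R u j * (K' s u i j * mm s z i j))
        + w u * (q * (R u j * R u j) + Rdd (zeta s z) u j) * (K' s u i j * K s u i j))" for i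
      by (simp add: H'_def w_def R_def algebra_simps)
    then have "(\<Sum>i\<le>n. K' s u i j * H' s z u i j)
        = F (zeta s z) * ((lam - q) * (w u * R u j * (\<Sum>i\<le>n. K' s u i j * mm s z i j))
          + w u * (q * (R u j * R u j) + Rdd (zeta s z) u j) * (\<Sum>i\<le>n. K' s u i j * K s u i j))"
      by (simp add: sum.distrib flip: sum_distrib_left)
    also have "(\<Sum>i\<le>n. K' s u i j * K s u i j) = 0" using K_gram[OF u u] guu by (simp add: g_def)
    also have "(\<Sum>i\<le>n. K' s u i j * mm s z i j) = (\<Sum>v\<in>T. w v * (R v j * g u v j))"
    proof -
      have "(\<Sum>i\<le>n. K' s u i j * mm s z i j) = (\<Sum>v\<in>T. \<Sum>i\<le>n. K' s u i j * (w v * (R v j * K s v i j)))"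
        unfolding mm_def sum_distrib_left w_def R_def by (rule sum.swap)
      also have "\<dots> = (\<Sum>v\<in>T. w v * (R v j * (\<Sum>i\<le>n. K' s u i j * K s v i j)))"
        by (simp add: sum_distrib_left mult_ac)
      also have "\<dots> = (\<Sum>v\<in>T. w v * (R v j * g u v j))"
        unfolding g_def by (intro sum.cong refl) (simp add: K_gram[OF u])
      finally show ?thesis .
    qed
    finally show ?thesis by (simp add: sum_distrib_left mult_ac)
  qed
  have "(\<Sum>a\<in>I. K' s u (fst a) (snd a) * H' s z u (fst a) (snd a))
      = F (zeta s z) * ((lam - q) * (\<Sum>v\<in>T. w u * w v * (\<Sum>j\<le>N. R u j * R v j * g u v j)))"
    if u: "u \<in> T" for u
  proof -
    have "(\<Sum>a\<in>I. K' s u (fst a) (snd a) * H' s z u (fst a) (snd a))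
        = (\<Sum>i\<le>n. \<Sum>j\<le>N. K' s u i j * H' s z u i j)"
      by (simp add: sum.cartesian_product split_def)
    also have "\<dots> = (\<Sum>j\<le>N. \<Sum>i\<le>n. K' s u i j * H' s z u i j)" by (rule sum.swap)
    also have "\<dots> = (\<Sum>j\<le>N. F (zeta s z) * ((lam - q) * (\<Sum>v\<in>T. w u * w v * (R u j * R v j * g u v j))))"
      by (simp add: inner[OF u])
    also have "\<dots> = F (zeta s z) * ((lam - q) * (\<Sum>j\<le>N. \<Sum>v\<in>T. w u * w v * (R u j * R v j * g u v j)))"
      by (simp add: sum_distrib_left)
    also have "(\<Sum>j\<le>N. \<Sum>v\<in>T. w u * w v * (R u j * R v j * g u v j))
        = (\<Sum>v\<in>T. \<Sum>j\<le>N. w u * w v * (R u j * R v j * g u v j))" by (rule sum.swap)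
    finally show ?thesis by (simp add: sum_distrib_left)
  qed
  note first = this
  have second: "(\<Sum>j\<le>N. R u j * R v j * g u v j)
      = (sin s * cos s) * ((1 - (\<Sum>i<n. A u i * A v i)) * (1 - (\<Sum>j<N. R u j * R v j)))" for u v
  proof -
    have "(\<Sum>j\<le>N. R u j * R v j * g u v j) = (\<Sum>j<N. R u j * R v j * g u v j) + R u N * R v N * g u v N"
      by (simp add: lessThan_Suc_atMost[symmetric])
    also have "(\<Sum>j<N. R u j * R v j * g u v j)
        = (\<Sum>j<N. - (sin s * cos s * (1 - (\<Sum>i<n. A u i * A v i))) * (R u j * R v j))"
      by (intro sum.cong) (auto simp: g_def)
    also have "\<dots> = - (sin s * cos s * (1 - (\<Sum>i<n. A u i * A v i))) * (\<Sum>j<N. R u j * R v j)"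
      by (rule sum_distrib_left[symmetric])
    finally show ?thesis by (simp add: R_def Rd_def g_def algebra_simps)
  qed
  have "(\<Sum>u\<in>T. \<Sum>a\<in>I. K' s u (fst a) (snd a) * H' s z u (fst a) (snd a))
      = (\<Sum>u\<in>T. F (zeta s z) * ((lam - q) * (\<Sum>v\<in>T. w u * w v * ((sin s * cos s) *
          ((1 - (\<Sum>i<n. A u i * A v i)) * (1 - (\<Sum>j<N. R u j * R v j)))))))"
    by (intro sum.cong refl) (simp only: first second)
  also have "\<dots> = F (zeta s z) * ((lam - q) * (sin s * cos s) * (\<Sum>u\<in>T. \<Sum>v\<in>T. w u * w v *
          ((1 - (\<Sum>i<n. A u i * A v i)) * (1 - (\<Sum>j<N. R u j * R v j)))))"
    unfolding sum_distrib_left by (intro sum.cong refl) (simp only: mult_ac)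
  finally show ?thesis by (simp only: w_def R_def)
qed

text \<open>\<open>lam * (lam - q) = lam * q * (lam / q - 1)\<close> is at most 0 for either sign of
  \<open>lam\<close>, and all other factors are nonnegative. So one computation serves the lower and
  the upper tail.\<close>

lemma drift_nonpos:
  assumes s: "0 \<le> sin s" "0 \<le> cos s"
  shows "lam * (\<Sum>u\<in>T. \<Sum>a\<in>I. K' s u (fst a) (snd a) * H' s z u (fst a) (snd a)) \<le> 0"
proof -
  have "lam * (lam - q) \<le> 0"
  proof -
    have "lam * (lam - q) = lam * q * (lam / q - 1)" using q by (simp add: right_diff_distrib)
    moreover have "lam * q \<ge> 0" using lam(1) by (auto simp: zero_less_divide_iff zero_le_mult_iff)
    ultimately show ?thesis using lam(2) by (simp only:) (intro mult_nonneg_nonpos, auto)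
  qed
  moreover have "0 \<le> F (zeta s z) * (sin s * cos s) * (\<Sum>u\<in>T. \<Sum>v\<in>T. wt (zeta s z) u * wt (zeta s z) v *
        ((1 - (\<Sum>i<n. A u i * A v i)) * (1 - (\<Sum>j<N. Rd (zeta s z) u j * Rd (zeta s z) v j))))"
    using s F_pos[of "zeta s z"]
    by (intro mult_nonneg_nonneg sum_nonneg wt_nonneg) (auto simp: A_inner_le Rd_inner_le)
  ultimately show ?thesis unfolding drift_eq by (smt (verit) mult.assoc mult.commute mult_nonneg_nonpos2)
qed

lemma int_zH:
  assumes "u \<in> T" "a \<in> I"
  shows "integrable (gauss I) (\<lambda>z. z a * H s z u (snd a))"
proof (rule integrable_gauss_bound[where C = C0 and K = "\<bar>lam\<bar> + 1"])
  show "(\<lambda>z. z a * H s z u (snd a)) \<in> borel_measurable (gauss I)"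
    using assms by (intro borel_measurable_times H_meas measurable_component_singleton) auto
  fix z :: "nat \<times> nat \<Rightarrow> real"
  have "\<bar>z a\<bar> \<le> X z" unfolding X_def using assms by (intro member_le_sum) auto
  also have "\<dots> \<le> exp (X z)" using exp_ge_add_one_self[of "X z"] by linarith
  finally have za: "\<bar>z a\<bar> \<le> exp (X z)" .
  have "\<bar>z a * H s z u (snd a)\<bar> \<le> exp (X z) * (C0 * 1 * exp (\<bar>lam\<bar> * X z))"
    unfolding abs_mult by (intro mult_mono za H_bound assms) auto
  then show "\<bar>z a * H s z u (snd a)\<bar> \<le> C0 * exp ((\<bar>lam\<bar> + 1) * (\<Sum>a\<in>I. \<bar>z a\<bar>))"
    by (simp add: X_def algebra_simps exp_add)
qed auto

lemma int_H':
  assumes "u \<in> T" "j \<le> N"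
  shows "integrable (gauss I) (\<lambda>z. H' s z u i j)"
  using H'_bound[OF assms(1)] assms unfolding X_def
  by (intro integrable_gauss_bound H'_meas) auto

lemma int_F: "integrable (gauss I) (\<lambda>z. F (zeta s z))"
  using abs_F_mult_le[of 1 1] unfolding X_def
  by (intro integrable_gauss_bound F_meas) auto

lemma integral_dF_nonpos:
  assumes s: "0 \<le> sin s" "0 \<le> cos s"
  shows "(\<integral>z. dF s z \<partial>gauss I) \<le> 0"
proof -
  have ibp: "(\<integral>z. z a * H s z u (snd a) \<partial>gauss I) = (\<integral>z. H' s z u (fst a) (snd a) \<partial>gauss I)"
    if u: "u \<in> T" and a: "a \<in> I" for u a
  proof (rule gaussian_integration_by_parts_PiM[where K = "\<bar>lam\<bar>"
        and C = "max (C0 * 1) (C0 * (\<bar>lam\<bar> + 2 * \<bar>q\<bar> + 1 / e))"])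
    obtain i j where aij: "a = (i, j)" "i \<le> n" "j \<le> N" using a by auto
    show "finite I" "a \<in> I" using a by auto
    show "(\<lambda>z. H s z u (snd a)) \<in> borel_measurable (gauss I)"
      "(\<lambda>z. H' s z u (fst a) (snd a)) \<in> borel_measurable (gauss I)"
      using aij by (auto intro: H_meas H'_meas)
    show "((\<lambda>y. H s (z(a := y)) u (snd a)) has_real_derivative H' s (z(a := y)) u (fst a) (snd a)) (at y)"
      "isCont (\<lambda>y. H' s (z(a := y)) u (fst a) (snd a)) y" for z y
      using aij u H_deriv H'_cont by auto
    fix z :: "nat \<times> nat \<Rightarrow> real"
    have "\<bar>H s z u (snd a)\<bar> \<le> C0 * 1 * exp (\<bar>lam\<bar> * X z)" by (rule H_bound[OF u])
    also have "\<dots> \<le> max (C0 * 1) (C0 * (\<bar>lam\<bar> + 2 * \<bar>q\<bar> + 1 / e)) * exp (\<bar>lam\<bar> * X z)"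
      by (intro mult_right_mono) auto
    finally show "\<bar>H s z u (snd a)\<bar> \<le> max (C0 * 1) (C0 * (\<bar>lam\<bar> + 2 * \<bar>q\<bar> + 1 / e)) * exp (\<bar>lam\<bar> * (\<Sum>a\<in>I. \<bar>z a\<bar>))"
      by (simp add: X_def)
    have "\<bar>H' s z u (fst a) (snd a)\<bar> \<le> C0 * (\<bar>lam\<bar> + 2 * \<bar>q\<bar> + 1 / e) * exp (\<bar>lam\<bar> * X z)" by (rule H'_bound[OF u])
    also have "\<dots> \<le> max (C0 * 1) (C0 * (\<bar>lam\<bar> + 2 * \<bar>q\<bar> + 1 / e)) * exp (\<bar>lam\<bar> * X z)"
      by (intro mult_right_mono) auto
    finally show "\<bar>H' s z u (fst a) (snd a)\<bar> \<le> max (C0 * 1) (C0 * (\<bar>lam\<bar> + 2 * \<bar>q\<bar> + 1 / e)) * exp (\<bar>lam\<bar> * (\<Sum>a\<in>I. \<bar>z a\<bar>))"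
      by (simp add: X_def)
  qed auto
  have "(\<integral>z. dF s z \<partial>gauss I)
      = lam * (\<Sum>u\<in>T. \<Sum>a\<in>I. K' s u (fst a) (snd a) * (\<integral>z. z a * H s z u (snd a) \<partial>gauss I))"
    unfolding dF_def
    by (simp add: Bochner_Integration.integral_sum Bochner_Integration.integrable_sum int_zH del: mult.assoc)
  also have "\<dots> = lam * (\<Sum>u\<in>T. \<Sum>a\<in>I. K' s u (fst a) (snd a) * (\<integral>z. H' s z u (fst a) (snd a) \<partial>gauss I))"
    by (intro arg_cong[where f = "(*) lam"] sum.cong refl) (simp add: ibp)
  also have "\<dots> = (\<integral>z. lam * (\<Sum>u\<in>T. \<Sum>a\<in>I. K' s u (fst a) (snd a) * H' s z u (fst a) (snd a)) \<partial>gauss I)"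
  proof -
    have "integrable (gauss I) (\<lambda>z. H' s z u (fst a) (snd a))" if "u \<in> T" "a \<in> I" for u a
      using that by (intro int_H') auto
    then show ?thesis
      by (simp add: Bochner_Integration.integral_sum Bochner_Integration.integrable_sum)
  qed
  also have "\<dots> \<le> 0"
  proof -
    let ?f = "\<lambda>z. lam * (\<Sum>u\<in>T. \<Sum>a\<in>I. K' s u (fst a) (snd a) * H' s z u (fst a) (snd a))"
    have "0 \<le> (\<integral>z. - ?f z \<partial>gauss I)"
      by (rule Bochner_Integration.integral_nonneg) (simp only: neg_0_le_iff_le drift_nonpos[OF s])
    also have "\<dots> = - (\<integral>z. ?f z \<partial>gauss I)" by (rule Bochner_Integration.integral_minus)
    finally show ?thesis by simp
  qed
  finally show ?thesis .
qed

text \<open>\<open>sin s\<close> and \<open>cos s\<close> stay nonnegative on the whole path, so the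
  expectation never increases along it.\<close>

theorem gordon_comparison:
  "(\<integral>z. F (zeta (pi / 2) z) \<partial>gauss I) \<le> (\<integral>z. F (zeta 0 z) \<partial>gauss I)"
proof (rule DERIV_nonpos_imp_nonincreasing[where a = 0 and b = "pi / 2"])
  fix s :: real assume s: "0 \<le> s" "s \<le> pi / 2"
  have "((\<lambda>s. \<integral>z. F (zeta s z) \<partial>gauss I) has_real_derivative (\<integral>z. dF s z \<partial>gauss I)) (at s)"
  proof (rule has_real_derivative_integral[where r = 1])
    show "dF s \<in> borel_measurable (gauss I)"
    proof -
      have "(\<lambda>z. lam * (\<Sum>u\<in>T. \<Sum>a\<in>I. K' s u (fst a) (snd a) * (z a * H s z u (snd a)))) \<in> borel_measurable (gauss I)"
        by (intro borel_measurable_times borel_measurable_sum H_meas measurable_component_singleton) auto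
      then show ?thesis by (simp add: dF_def[abs_def])
    qed
    show "integrable (gauss I) (\<lambda>z. (\<bar>lam\<bar> * (real (card T) * (real (card I) * C0))) * exp ((\<bar>lam\<bar> + 1) * X z))"
      unfolding X_def by (rule integrable_exp_abs_gauss) auto
  qed (use int_F F_deriv_s dF_bound in auto)
  moreover have "0 \<le> sin s" "0 \<le> cos s" using s by (auto intro!: sin_ge_zero cos_ge_zero)
  ultimately show "\<exists>y. ((\<lambda>s. \<integral>z. F (zeta s z) \<partial>gauss I) has_real_derivative y) (at s) \<and> y \<le> 0"
    using integral_dF_nonpos by blast
qed simp

end

section \<open>The chi distribution\<close>

text \<open>The unnormalized moment generating function of the chi distribution with
  \<open>m + 1\<close> degrees of freedom. Differentiating in \<open>l\<close> raises
  \<open>m\<close> by 1.\<close>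

definition half_moment :: "nat \<Rightarrow> real \<Rightarrow> real" where
  "half_moment m l = (\<integral>r. indicator {0<..} r * (r ^ m * exp (- r\<^sup>2 / 2 + l * r)) \<partial>lborel)"

lemma power_le_fact_exp: "r \<ge> 0 \<Longrightarrow> r ^ m \<le> fact m * exp (r :: real)"
proof -
  assume r: "r \<ge> 0"
  have "(\<Sum>n\<in>{m}. r ^ n /\<^sub>R fact n) \<le> (\<Sum>n. r ^ n /\<^sub>R fact n)"
    using r by (intro sum_le_suminf summable_exp_generic) auto
  then have "r ^ m / fact m \<le> exp r" by (simp add: exp_def field_simps)
  then show ?thesis by (simp add: field_simps)
qed

text \<open>The power is absorbed by \<open>exp r\<close> up to a factorial, after which a shifted
  normal density dominates.\<close>

lemma integrable_half_moment:
  fixes l :: real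
  shows "integrable lborel (\<lambda>r :: real. indicator {0<..} r * (r ^ m * exp (- r\<^sup>2 / 2 + l * r)))"
proof (rule Bochner_Integration.integrable_bound)
  show "integrable lborel (\<lambda>r. (fact m * sqrt (2 * pi) * exp ((l + 1)\<^sup>2 / 2)) * normal_density (l + 1) 1 r)"
    by (intro integrable_mult_right) auto
  show "AE r in lborel. norm (indicator {0<..} r * (r ^ m * exp (- r\<^sup>2 / 2 + l * r)))
      \<le> norm ((fact m * sqrt (2 * pi) * exp ((l + 1)\<^sup>2 / 2)) * normal_density (l + 1) 1 r)"
  proof (rule AE_I2)
    fix r :: real
    have "normal_density (l + 1) 1 r * exp ((l + 1)\<^sup>2 / 2) = std_normal_density r * exp ((l + 1) * r)"
      by (simp add: std_normal_density_times_exp)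
    also have "\<dots> = exp (- r\<^sup>2 / 2 + (l + 1) * r) / sqrt (2 * pi)"
      by (simp add: std_normal_density_def mult_exp_exp)
    finally have eq: "(fact m * sqrt (2 * pi) * exp ((l + 1)\<^sup>2 / 2)) * normal_density (l + 1) 1 r
        = fact m * exp (- r\<^sup>2 / 2 + (l + 1) * r)" by (simp add: field_simps)
    have "r ^ m * exp (- r\<^sup>2 / 2 + l * r) \<le> fact m * exp r * exp (- r\<^sup>2 / 2 + l * r)" if "r > 0"
      using power_le_fact_exp[of r m] that by (intro mult_right_mono) auto
    then show "norm (indicator {0<..} r * (r ^ m * exp (- r\<^sup>2 / 2 + l * r)))
      \<le> norm ((fact m * sqrt (2 * pi) * exp ((l + 1)\<^sup>2 / 2)) * normal_density (l + 1) 1 r)"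
      unfolding eq by (auto simp: indicator_def algebra_simps simp flip: exp_add)
  qed
qed measurable

lemma half_moment_pos: "half_moment m l > 0"
proof -
  let ?f = "\<lambda>r. indicator {0<..} r * (r ^ m * exp (- r\<^sup>2 / 2 + l * r))"
  have nn: "\<And>r. 0 \<le> ?f r" by (auto simp: indicator_def)
  have "half_moment m l \<noteq> 0"
  proof
    assume "half_moment m l = 0"
    then have "AE r in lborel. ?f r = 0"
      using integral_nonneg_eq_0_iff_AE[OF integrable_half_moment[of m l]] nn
      by (simp add: half_moment_def)
    then have "AE r in lborel. r \<notin> {0<..(1::real)}"
      by eventually_elim (auto simp: indicator_def)
    then have "{0<..(1::real)} \<in> null_sets lborel"
      by (subst AE_iff_null_sets) auto
    then have "emeasure lborel {0<..(1::real)} = 0" by auto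
    then show False by simp
  qed
  moreover have "half_moment m l \<ge> 0"
    unfolding half_moment_def using nn by (intro Bochner_Integration.integral_nonneg)
  ultimately show ?thesis by simp
qed

lemma half_moment_deriv: "(half_moment m has_real_derivative half_moment (Suc m) l) (at l)"
  unfolding half_moment_def[abs_def]
proof (rule has_real_derivative_integral[where r = 1
      and g = "\<lambda>r. indicator {0<..} r * (r ^ Suc m * exp (- r\<^sup>2 / 2 + (\<bar>l\<bar> + 1) * r))"])
  fix t r :: real assume t: "\<bar>t - l\<bar> < 1"
  show "integrable lborel (\<lambda>r. indicator {0<..} r * (r ^ m * exp (- r\<^sup>2 / 2 + t * r)))"
    by (rule integrable_half_moment)
  show "((\<lambda>t. indicator {0<..} r * (r ^ m * exp (- r\<^sup>2 / 2 + t * r))) has_real_derivative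
      indicator {0<..} r * (r ^ Suc m * exp (- r\<^sup>2 / 2 + t * r))) (at t)"
    by (auto intro!: derivative_eq_intros)
  have "t * r \<le> (\<bar>l\<bar> + 1) * r" if "r > 0" using t that by (intro mult_right_mono) auto
  then show "\<bar>indicator {0<..} r * (r ^ Suc m * exp (- r\<^sup>2 / 2 + t * r))\<bar>
      \<le> indicator {0<..} r * (r ^ Suc m * exp (- r\<^sup>2 / 2 + (\<bar>l\<bar> + 1) * r))"
    by (auto simp: indicator_def abs_mult mult_left_mono)
next
  show "integrable lborel (\<lambda>r. indicator {0<..} r * (r ^ Suc m * exp (- r\<^sup>2 / 2 + (\<bar>l\<bar> + 1) * r)))"
    by (rule integrable_half_moment)
  show "(\<lambda>r. indicator {0<..} r * (r ^ Suc m * exp (- r\<^sup>2 / 2 + l * r))) \<in> borel_measurable lborel"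
    using integrable_half_moment by (rule borel_measurable_integrable)
qed simp

text \<open>Integrates the derivative of \<open>r ^ m\<close> times the exponential over the half
  line. The boundary value at 0 is \<open>0 ^ m\<close>, which is 1 exactly for
  \<open>m = 0\<close>; in that case the factor \<open>real m\<close> hides the truncated index
  \<open>m - 1\<close>.\<close>

lemma half_moment_rec:
  "half_moment (Suc m) l = real m * half_moment (m - 1) l + l * half_moment m l + 0 ^ m"
proof -
  define w where "w r = exp (- r\<^sup>2 / 2 + l * r)" for r :: real
  define F where "F r = r ^ m * w r" for r
  define f where "f r = real m * (r ^ (m - 1) * w r) + l * (r ^ m * w r) - r ^ Suc m * w r" for r
  have dF: "(F has_real_derivative f r) (at r)" for r
  proof -
    have "((\<lambda>r. - r\<^sup>2 / 2 + l * r) has_real_derivative (- r + l)) (at r)"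
      using DERIV_add[OF DERIV_cdivide[OF DERIV_minus[OF DERIV_pow[of 2 r]], of 2]
          DERIV_cmult[OF DERIV_ident, of l]] by simp
    then have "(w has_real_derivative w r * (- r + l)) (at r)"
      unfolding w_def by (rule DERIV_fun_exp)
    from DERIV_mult[OF DERIV_pow[of m r] this]
    show ?thesis unfolding F_def[abs_def] f_def by (simp add: algebra_simps)
  qed
  have cont: "isCont f r" for r
    unfolding f_def w_def by (intro continuous_intros) auto
  have i: "integrable lborel (\<lambda>r. indicator {0<..} r * (r ^ j * w r))" for j
    unfolding w_def by (rule integrable_half_moment)
  have eq: "(\<lambda>r. indicator {0<..} r * f r) = (\<lambda>r. real m * (indicator {0<..} r * (r ^ (m - 1) * w r))
      + l * (indicator {0<..} r * (r ^ m * w r)) - indicator {0<..} r * (r ^ Suc m * w r))"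
    by (auto simp: f_def fun_eq_iff algebra_simps)
  have int: "integrable lborel (\<lambda>r. indicator {0<..} r * f r)"
    unfolding eq using i by (intro Bochner_Integration.integrable_diff Bochner_Integration.integrable_add
        integrable_mult_right)
  have lim0: "(F \<longlongrightarrow> 0 ^ m) (at_right 0)"
    using DERIV_isCont[OF dF, of 0] by (auto simp: F_def w_def isCont_def intro: filterlim_at_split[THEN iffD1, THEN conjunct2])
  have lim1: "(F \<longlongrightarrow> 0) at_top"
  proof (rule Lim_null_comparison)
    show "eventually (\<lambda>r. norm (F r) \<le> fact m * exp (- r\<^sup>2 / 2 + (l + 1) * r)) at_top"
      using eventually_ge_at_top[of 0]
    proof eventually_elim
      fix r :: real assume r: "r \<ge> 0"
      have "r ^ m * w r \<le> fact m * exp r * w r"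
        using power_le_fact_exp[OF r, of m] by (intro mult_right_mono) (auto simp: w_def)
      then show "norm (F r) \<le> fact m * exp (- r\<^sup>2 / 2 + (l + 1) * r)"
        using r by (simp add: F_def w_def abs_mult algebra_simps flip: exp_add)
    qed
    show "((\<lambda>r. fact m * exp (- r\<^sup>2 / 2 + (l + 1) * r)) \<longlongrightarrow> 0) at_top"
      by (rule tendsto_mult_right_zero) real_asymp
  qed
  have "(LBINT x=0..\<infinity>. f x) = 0 - 0 ^ m"
  proof (rule interval_integral_FTC_integrable[where F = F])
    have "((F \<circ> real_of_ereal) \<longlongrightarrow> 0 ^ m) (at_right (ereal 0))"
      using lim0 by (simp only: ereal_tendsto_simps1)
    then show "((F \<circ> real_of_ereal) \<longlongrightarrow> 0 ^ m) (at_right 0)" by (simp add: zero_ereal_def)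
    show "((F \<circ> real_of_ereal) \<longlongrightarrow> 0) (at_left \<infinity>)" using lim1 by (simp only: ereal_tendsto_simps1)
    have "einterval 0 \<infinity> = {0<..}" by (auto simp: einterval_def zero_ereal_def)
    then show "set_integrable lborel (einterval 0 \<infinity>) f" using int by (simp add: set_integrable_def)
  qed (use dF cont in \<open>auto simp: has_real_derivative_iff_has_vector_derivative\<close>)
  moreover have "(LBINT x=0..\<infinity>. f x) = (\<integral>r. indicator {0<..} r * f r \<partial>lborel)"
  proof -
    have "einterval 0 \<infinity> = {0<..}" by (auto simp: einterval_def zero_ereal_def)
    then show ?thesis by (simp add: interval_lebesgue_integral_def set_lebesgue_integral_def)
  qed
  moreover have "(\<integral>r. indicator {0<..} r * f r \<partial>lborel)
      = real m * half_moment (m - 1) l + l * half_moment m l - half_moment (Suc m) l"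
    unfolding eq half_moment_def w_def[symmetric] using i
    by (simp add: Bochner_Integration.integrable_diff Bochner_Integration.integrable_add del: power_Suc)
  ultimately show ?thesis by simp
qed

text \<open>Nonnegativity of a variance: \<open>(r - x)\<^sup>2\<close> is integrated against the
  weight, with \<open>x\<close> the mean.\<close>

lemma half_moment_log_convex:
  "(half_moment (Suc m) l)\<^sup>2 \<le> half_moment m l * half_moment (Suc (Suc m)) l"
proof -
  define w where "w r = exp (- r\<^sup>2 / 2 + l * r)" for r :: real
  define x where "x = half_moment (Suc m) l / half_moment m l"
  have i: "integrable lborel (\<lambda>r. indicator {0<..} r * (r ^ j * w r))" for j
    unfolding w_def by (rule integrable_half_moment)
  have "0 \<le> (\<integral>r. indicator {0<..} r * (r ^ m * w r * (r - x)\<^sup>2) \<partial>lborel)"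
    by (intro Bochner_Integration.integral_nonneg) (auto simp: indicator_def w_def)
  also have "(\<lambda>r. indicator {0<..} r * (r ^ m * w r * (r - x)\<^sup>2))
      = (\<lambda>r. indicator {0<..} r * (r ^ Suc (Suc m) * w r) - (2 * x) * (indicator {0<..} r * (r ^ Suc m * w r))
         + x\<^sup>2 * (indicator {0<..} r * (r ^ m * w r)))"
    by (auto simp: fun_eq_iff power2_eq_square algebra_simps)
  also have "(\<integral>r. indicator {0<..} r * (r ^ Suc (Suc m) * w r) - (2 * x) * (indicator {0<..} r * (r ^ Suc m * w r))
         + x\<^sup>2 * (indicator {0<..} r * (r ^ m * w r)) \<partial>lborel)
       = half_moment (Suc (Suc m)) l - 2 * x * half_moment (Suc m) l + x\<^sup>2 * half_moment m l"
    using i by (simp add: half_moment_def w_def del: power_Suc)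
  also have "\<dots> = half_moment (Suc (Suc m)) l - (half_moment (Suc m) l)\<^sup>2 / half_moment m l"
    using half_moment_pos[of m l] by (simp add: x_def power2_eq_square field_simps)
  finally show ?thesis using half_moment_pos[of m l] by (simp add: field_simps)
qed

text \<open>For positive \<open>d\<close> the expected length of a standard Gaussian vector in
  dimension \<open>d\<close>, usually written as
  \<open>sqrt 2 * Gamma ((d + 1) / 2) / Gamma (d / 2)\<close>.\<close>

definition chi_mean :: "nat \<Rightarrow> real" where
  "chi_mean d = half_moment d 0 / half_moment (d - 1) 0"

text \<open>The chi distribution is sub-Gaussian around its mean with variance factor 1. Its log
  moment generating function has as second derivative the variance of the tilted law, and this is at
  most 1. So \<open>f\<close> is concave with \<open>f' 0 = 0\<close>, hence maximal at 0.\<close>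

lemma half_moment_mgf_bound:
  "half_moment m l \<le> half_moment m 0 * exp (l * chi_mean (Suc m) + l\<^sup>2 / 2)"
proof -
  define a where "a = chi_mean (Suc m)"
  define f where "f l = ln (half_moment m l) - l * a - l\<^sup>2 / 2" for l
  define g where "g l = half_moment (Suc m) l / half_moment m l - a - l" for l
  have nz: "half_moment m l \<noteq> 0" for l using half_moment_pos[of m l] by simp
  have df: "(f has_real_derivative g l) (at l)" for l
    unfolding f_def g_def using half_moment_pos[of m l]
    by (auto intro!: derivative_eq_intros half_moment_deriv)
  define g' where "g' l = (half_moment (Suc (Suc m)) l * half_moment m l
      - half_moment (Suc m) l * half_moment (Suc m) l) / (half_moment m l * half_moment m l) - 1" for l
  have dg: "(g has_real_derivative g' l) (at l)" for l
  proof -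
    have "((\<lambda>l. half_moment (Suc m) l / half_moment m l) has_real_derivative (half_moment (Suc (Suc m)) l * half_moment m l
      - half_moment (Suc m) l * half_moment (Suc m) l) / (half_moment m l * half_moment m l)) (at l)"
      by (rule DERIV_divide[OF half_moment_deriv half_moment_deriv nz])
    from DERIV_diff[OF DERIV_diff[OF this DERIV_const] DERIV_ident]
    show ?thesis unfolding g_def[abs_def] g'_def by simp
  qed
  have g': "g' l \<le> 0" for l
  proof -
    let ?Z = "half_moment m l" and ?Z1 = "half_moment (Suc m) l" and ?Z2 = "half_moment (Suc (Suc m)) l"
    \<comment> \<open>The recurrence lowers the variance bound to moments of orders
      \<open>m - 1\<close>, \<open>m\<close> and \<open>m + 1\<close>. For positive \<open>m\<close>
      it is then log-convexity; for \<open>m = 0\<close> the boundary term gives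
      \<open>l * ?Z \<le> ?Z1\<close>.\<close>
    have "?Z2 = (1 + real m) * ?Z + l * ?Z1" using half_moment_rec[of "Suc m" l] by simp
    moreover have "real m * ?Z * ?Z + l * ?Z1 * ?Z \<le> ?Z1 * ?Z1"
    proof (cases m)
      case 0
      then have "?Z1 = l * ?Z + 1" using half_moment_rec[of m l] by simp
      then have "l * ?Z * ?Z1 \<le> ?Z1 * ?Z1"
        using half_moment_pos[of "Suc m" l] by (intro mult_right_mono) auto
      then show ?thesis using 0 by (simp add: mult_ac)
    next
      case (Suc j)
      then have "?Z1 = real m * half_moment j l + l * ?Z" using half_moment_rec[of m l] by simp
      then have "?Z1 * ?Z1 = real m * (half_moment j l * ?Z1) + l * ?Z * ?Z1" by (simp add: algebra_simps)
      moreover have "real m * (?Z * ?Z) \<le> real m * (half_moment j l * ?Z1)"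
        using half_moment_log_convex[of j l] Suc by (intro mult_left_mono) (simp_all add: power2_eq_square)
      ultimately show ?thesis by (simp add: mult_ac)
    qed
    ultimately have "?Z2 * ?Z - ?Z1 * ?Z1 \<le> ?Z * ?Z" by (simp add: algebra_simps)
    then show ?thesis using half_moment_pos[of m l] by (simp add: g'_def divide_le_eq)
  qed
  have g0: "g 0 = 0" by (simp add: g_def a_def chi_mean_def)
  have mono: "g y \<le> g x" if "x \<le> y" for x y
    using that dg g' by (intro DERIV_nonpos_imp_nonincreasing[of x y g]) blast+
  have "f l \<le> f 0"
  proof (cases "l \<ge> 0")
    case True
    then show ?thesis
      by (rule DERIV_nonpos_imp_nonincreasing) (use df mono[of 0] g0 in fastforce)
  next
    case False
    then have "l \<le> 0" by simp
    then show ?thesis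
      by (rule DERIV_nonneg_imp_nondecreasing) (use df mono[of _ 0] g0 in fastforce)
  qed
  then have "ln (half_moment m l) \<le> ln (half_moment m 0) + (l * a + l\<^sup>2 / 2)" by (simp add: f_def)
  then have "exp (ln (half_moment m l)) \<le> exp (ln (half_moment m 0) + (l * a + l\<^sup>2 / 2))" by simp
  then show ?thesis using half_moment_pos by (simp add: exp_add a_def)
qed

lemma divide_le_divide_cross: "0 < b \<Longrightarrow> 0 < d \<Longrightarrow> a * d \<le> c * b \<Longrightarrow> a / b \<le> c / (d :: real)"
  by (simp add: field_simps)

lemma chi_mean_pos: "chi_mean d > 0"
  by (simp add: chi_mean_def half_moment_pos)

lemma chi_mean_rec: "d \<ge> 1 \<Longrightarrow> chi_mean d * chi_mean (Suc d) = real d"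
  using half_moment_rec[of d 0] half_moment_pos[of d 0] half_moment_pos[of "d - 1" 0]
  by (simp add: chi_mean_def power_0_left)

lemma chi_mean_le_sqrt: "d \<ge> 1 \<Longrightarrow> chi_mean d \<le> sqrt (real d)"
proof (rule real_le_rsqrt)
  assume d: "d \<ge> 1"
  have "(half_moment d 0)\<^sup>2 \<le> half_moment (d - 1) 0 * half_moment (Suc d) 0"
    using half_moment_log_convex[of "d - 1" 0] d by simp
  also have "half_moment (Suc d) 0 = real d * half_moment (d - 1) 0"
    using half_moment_rec[of d 0] d by simp
  finally show "(chi_mean d)\<^sup>2 \<le> real d"
    using half_moment_pos[of "d - 1" 0] by (simp add: chi_mean_def power_divide divide_le_eq power2_eq_square mult_ac)
qed

text \<open>The witness \<open>4 d \<surd>d / (4 d + 1)\<close> agrees with \<open>chi_mean d\<close> up to a relative error of order \<open>1/d\<^sup>2\<close>.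
  The quotient of the two is increasing along \<open>d, d + 2, d + 4, \<dots>\<close> and has an upper bound tending
  to 1, so it is at most 1.\<close>

lemma chi_mean_le:
  assumes d: "d \<ge> 1"
  shows "chi_mean d \<le> 4 * real d * sqrt (real d) / (4 * real d + 1)"
proof -
  define b where "b d = 4 * real d * sqrt (real d) / (4 * real d + 1)" for d
  have b_pos: "b d > 0" if "d \<ge> 1" for d using that by (simp add: b_def)
  have step: "b (d + 2) \<le> (real d + 1) / real d * b d" if d: "d \<ge> 1" for d
  proof -
    define x where "x = real d"
    have x: "x \<ge> 1" using d by (simp add: x_def)
    have "(x + 2) ^ 3 * (4 * x + 1)\<^sup>2 \<le> (x + 1)\<^sup>2 * x * (4 * x + 9)\<^sup>2"
    proof -
      have "(x + 1)\<^sup>2 * x * (4 * x + 9)\<^sup>2 - (x + 2) ^ 3 * (4 * x + 1)\<^sup>2 = 4 * x\<^sup>2 + 5 * x - 8"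
        by (simp add: power2_eq_square power3_eq_cube algebra_simps)
      moreover have "x\<^sup>2 \<ge> 1" using x by simp
      ultimately show ?thesis using x by linarith
    qed
    then have "sqrt ((x + 2) ^ 3 * (4 * x + 1)\<^sup>2) \<le> sqrt ((x + 1)\<^sup>2 * x * (4 * x + 9)\<^sup>2)" by simp
    moreover have "sqrt ((x + 2) ^ 3 * (4 * x + 1)\<^sup>2) = (x + 2) * sqrt (x + 2) * (4 * x + 1)"
      using x by (simp add: real_sqrt_mult power3_eq_cube)
    moreover have "sqrt ((x + 1)\<^sup>2 * x * (4 * x + 9)\<^sup>2) = (x + 1) * sqrt x * (4 * x + 9)"
      using x by (simp add: real_sqrt_mult)
    ultimately have "(x + 2) * sqrt (x + 2) * (4 * x + 1) \<le> (x + 1) * sqrt x * (4 * x + 9)" by simp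
    then have "4 * ((x + 2) * sqrt (x + 2) * (4 * x + 1)) \<le> 4 * ((x + 1) * sqrt x * (4 * x + 9))" by linarith
    then have "4 * (x + 2) * sqrt (x + 2) * (4 * x + 1) \<le> 4 * (x + 1) * sqrt x * (4 * x + 9)"
      by (simp only: mult.assoc)
    then have "4 * (x + 2) * sqrt (x + 2) / (4 * x + 9) \<le> 4 * (x + 1) * sqrt x / (4 * x + 1)"
      using x by (intro divide_le_divide_cross) auto
    moreover have "4 * (x + 1) * sqrt x / (4 * x + 1) = (x + 1) / x * (4 * x * sqrt x / (4 * x + 1))"
      using x by simp
    ultimately show ?thesis by (simp add: b_def x_def add_ac)
  qed
  have rec: "chi_mean (d + 2) = (real d + 1) / real d * chi_mean d" if d: "d \<ge> 1" for d
  proof -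
    have "real d * chi_mean (Suc (Suc d)) = chi_mean d * (chi_mean (Suc d) * chi_mean (Suc (Suc d)))"
      using chi_mean_rec[OF d] by (simp add: mult.assoc)
    also have "\<dots> = chi_mean d * real (Suc d)" using chi_mean_rec[of "Suc d"] by simp
    finally show ?thesis using d by (simp add: field_simps)
  qed
  have inc: "chi_mean d / b d \<le> chi_mean (d + 2 * j) / b (d + 2 * j)" for j
  proof (induction j)
    case (Suc j)
    let ?d = "d + 2 * j"
    have d1: "?d \<ge> 1" using d by simp
    have "chi_mean ?d / b ?d = chi_mean (?d + 2) / ((real ?d + 1) / real ?d * b ?d)"
      unfolding rec[OF d1] using d1 by (simp del: of_nat_add of_nat_mult)
    also have "\<dots> \<le> chi_mean (?d + 2) / b (?d + 2)"
      using step[OF d1] b_pos[of "?d + 2"] b_pos[OF d1] chi_mean_pos[of "?d + 2"] d1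
      by (intro divide_left_mono mult_pos_pos) auto
    finally show ?case using Suc by simp
  qed simp
  have "chi_mean d / b d \<le> 1 + 1 / (4 * (real d + 2 * real j))" for j
  proof -
    let ?d = "d + 2 * j"
    have d1: "?d \<ge> 1" using d by simp
    have "chi_mean ?d / b ?d \<le> sqrt (real ?d) / b ?d"
      using chi_mean_le_sqrt[OF d1] b_pos[OF d1] by (intro divide_right_mono) auto
    also have "\<dots> = 1 + 1 / (4 * real ?d)" 
    proof -
      have "s / (4 * y * s / (4 * y + 1)) = 1 + 1 / (4 * y)" if "s > 0" "y > 0" for s y :: real
        using that by (simp add: field_simps)
      from this[of "sqrt (real ?d)" "real ?d"] show ?thesis using d1 unfolding b_def by simp
    qed
    finally show ?thesis using inc[of j] by simp
  qed
  moreover have "(\<lambda>j. 1 + 1 / (4 * (real d + 2 * real j))) \<longlonglongrightarrow> 1" by real_asymp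
  ultimately have "chi_mean d / b d \<le> 1"
    by (intro LIMSEQ_le_const) auto
  then show ?thesis using b_pos[OF d] by (simp add: b_def[symmetric])
qed

text \<open>By \<open>chi_mean_rec\<close> the right side is \<open>d / y - y\<close> at
  \<open>y = chi_mean d\<close>, which decreases in \<open>y\<close>. The bound \<open>b\<close>
  from \<open>chi_mean_le\<close> thus gives a lower estimate, whereas the crude bound
  \<open>sqrt d\<close> would give only 0.\<close>

lemma chi_mean_diff_Suc:
  assumes d: "d \<ge> 1"
  shows "sqrt (real (Suc d)) - sqrt (real d) \<le> chi_mean (Suc d) - chi_mean d"
proof -
  define x where "x = sqrt (real d)"
  have x: "x \<ge> 1" and xx: "real d = x\<^sup>2" using d by (simp_all add: x_def)
  define b where "b = 4 * x\<^sup>2 * x / (4 * x\<^sup>2 + 1)"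
  have pos: "4 * x\<^sup>2 + 1 > 0" by (simp add: add_nonneg_pos)
  have b: "b > 0" using x by (simp add: b_def pos)
  \<comment> \<open>This is \<open>x\<^sup>2 / b - b\<close> over a common denominator.\<close>
  define L where "L = (8 * x\<^sup>2 + 1) / (4 * x * (4 * x\<^sup>2 + 1))"
  have "x\<^sup>2 + 1 \<le> (x + L)\<^sup>2"
  proof -
    \<comment> \<open>The cross term of \<open>(x + L)\<^sup>2\<close> falls short of 1 by exactly
      this fraction, and \<open>L\<^sup>2\<close> makes up for it.\<close>
    have "2 * x * L = 1 - 1 / (2 * (4 * x\<^sup>2 + 1))"
    proof -
      define y where "y = 4 * x\<^sup>2 + 1"
      have e: "8 * x\<^sup>2 + 1 = 2 * y - 1" by (simp add: y_def)
      have "2 * x * L = (2 * y - 1) / (2 * y)"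
        using x pos unfolding L_def e y_def[symmetric] by (simp add: divide_simps)
      also have "\<dots> = 1 - 1 / (2 * y)" 
      proof -
        have "y > 0" using pos by (simp only: y_def)
        then show ?thesis by (simp add: diff_divide_distrib)
      qed
      finally show ?thesis by (simp add: y_def)
    qed
    moreover have "L\<^sup>2 \<ge> 1 / (2 * (4 * x\<^sup>2 + 1))"
    proof -
      have "L\<^sup>2 = (8 * x\<^sup>2 + 1)\<^sup>2 / (16 * x\<^sup>2 * (4 * x\<^sup>2 + 1)\<^sup>2)"
        by (simp add: L_def power_divide power_mult_distrib)
      moreover have "1 * (16 * x\<^sup>2 * (4 * x\<^sup>2 + 1)\<^sup>2) \<le> (8 * x\<^sup>2 + 1)\<^sup>2 * (2 * (4 * x\<^sup>2 + 1))"
      proof -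
        have "16 * x\<^sup>2 * (4 * x\<^sup>2 + 1) \<le> 2 * (8 * x\<^sup>2 + 1)\<^sup>2"
        proof -
          have "2 * (8 * x\<^sup>2 + 1)\<^sup>2 - 16 * x\<^sup>2 * (4 * x\<^sup>2 + 1) = 64 * (x\<^sup>2)\<^sup>2 + 16 * x\<^sup>2 + 2"
            by (simp add: power2_eq_square algebra_simps)
          moreover have "64 * (x\<^sup>2)\<^sup>2 + 16 * x\<^sup>2 + 2 \<ge> 0" by simp
          ultimately show ?thesis by linarith
        qed
        then have "16 * x\<^sup>2 * (4 * x\<^sup>2 + 1) * (4 * x\<^sup>2 + 1) \<le> 2 * (8 * x\<^sup>2 + 1)\<^sup>2 * (4 * x\<^sup>2 + 1)"
          using pos by (intro mult_right_mono) auto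
        moreover have "1 * (a * y\<^sup>2) \<le> p * (2 * y)" if "a * y * y \<le> 2 * p * y" for a y p :: real
          using that by (simp add: power2_eq_square mult_ac)
        ultimately show ?thesis by blast
      qed
      moreover have "16 * x\<^sup>2 * (4 * x\<^sup>2 + 1)\<^sup>2 > 0" using x pos by simp
      ultimately show ?thesis using pos by (simp only:) (rule divide_le_divide_cross, simp_all)
    qed
    ultimately show ?thesis by (simp add: power2_sum)
  qed
  moreover have "x + L \<ge> 0" using x pos by (simp add: L_def)
  ultimately have "sqrt (x\<^sup>2 + 1) \<le> x + L" by (intro real_le_lsqrt) auto
  then have "sqrt (real (Suc d)) - sqrt (real d) \<le> L" by (simp add: xx[symmetric] x_def add.commute)
  also have "L = x\<^sup>2 / b - b"
    using x pos by (simp add: L_def b_def divide_simps) (simp add: power2_eq_square algebra_simps)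
  also have "\<dots> \<le> x\<^sup>2 / chi_mean d - chi_mean d"
  proof -
    have le: "chi_mean d \<le> b" using chi_mean_le[OF d, folded x_def, unfolded xx] by (simp only: b_def)
    have "x\<^sup>2 / b \<le> x\<^sup>2 / chi_mean d"
      by (rule divide_left_mono[OF le]) (use chi_mean_pos[of d] b in auto)
    with le show ?thesis by linarith
  qed
  also have "x\<^sup>2 / chi_mean d = chi_mean (Suc d)"
    using chi_mean_rec[OF d] chi_mean_pos[of d] by (simp add: xx[symmetric] field_simps)
  finally show ?thesis .
qed

text \<open>The unit steps telescope. This converts the natural centre of the comparison, a
  difference of chi means, into the square roots of the sketch size condition.\<close>

lemma chi_mean_diff:
  assumes "1 \<le> k" "k \<le> n"
  shows "sqrt (real n) - sqrt (real k) \<le> chi_mean n - chi_mean k"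
  using assms(2)
proof (induction n rule: dec_induct)
  case (step n)
  then show ?case using chi_mean_diff_Suc[of n] assms(1) by linarith
qed simp

section \<open>The law of the length of a Gaussian vector\<close>

lemma gauss_eq_density:
  assumes I: "finite I"
  shows "gauss I = density (PiM I (\<lambda>_. lborel))
    (\<lambda>z. ennreal ((1 / sqrt (2 * pi)) ^ card I * exp (- (\<Sum>i\<in>I. (z i)\<^sup>2) / 2)))"
proof -
  interpret L: product_sigma_finite "\<lambda>_. lborel :: real measure" by standard
  have prod: "ennreal ((1 / sqrt (2 * pi)) ^ card I * exp (- (\<Sum>i\<in>I. (z i)\<^sup>2) / 2))
      = (\<Prod>i\<in>I. ennreal (std_normal_density (z i)))" for z
  proof -
    have "(\<Prod>i\<in>I. std_normal_density (z i)) = (1 / sqrt (2 * pi)) ^ card I * exp (- (\<Sum>i\<in>I. (z i)\<^sup>2) / 2)"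
      by (simp add: std_normal_density_def prod.distrib prod_dividef exp_sum[OF I, symmetric] sum_negf
          flip: sum_divide_distrib) (simp add: power_divide)
    then show ?thesis by (simp add: prod_ennreal)
  qed
  show ?thesis
    unfolding prod
  proof (rule gauss.PiM_eqI[OF I, symmetric])
    show "sets (density (PiM I (\<lambda>_. lborel)) (\<lambda>z. \<Prod>i\<in>I. ennreal (std_normal_density (z i)))) = sets (gauss I)"
      by (simp cong: sets_PiM_cong)
    fix A :: "'a \<Rightarrow> real set" assume A: "\<And>i. i \<in> I \<Longrightarrow> A i \<in> sets std_gauss"
    have "emeasure (density (PiM I (\<lambda>_. lborel)) (\<lambda>z. \<Prod>i\<in>I. ennreal (std_normal_density (z i)))) (PiE I A)
        = (\<integral>\<^sup>+z. (\<Prod>i\<in>I. ennreal (std_normal_density (z i))) * indicator (PiE I A) z \<partial>PiM I (\<lambda>_. lborel))"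
      using A I by (intro emeasure_density) (auto intro!: sets_PiM_I_finite)
    also have "\<dots> = (\<integral>\<^sup>+z. (\<Prod>i\<in>I. ennreal (std_normal_density (z i)) * indicator (A i) (z i)) \<partial>PiM I (\<lambda>_. lborel))"
    proof (intro nn_integral_cong)
      fix z :: "'a \<Rightarrow> real" assume "z \<in> space (PiM I (\<lambda>_. lborel))"
      then have "indicator (PiE I A) z = (\<Prod>i\<in>I. indicator (A i) (z i) :: ennreal)"
        using I by (auto simp: indicator_def space_PiM PiE_iff prod_zero_iff)
      then show "(\<Prod>i\<in>I. ennreal (std_normal_density (z i))) * indicator (PiE I A) z
          = (\<Prod>i\<in>I. ennreal (std_normal_density (z i)) * indicator (A i) (z i))"
        by (simp add: prod.distrib)
    qed
    also have "\<dots> = (\<Prod>i\<in>I. \<integral>\<^sup>+x. ennreal (std_normal_density x) * indicator (A i) x \<partial>lborel)"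
      using I A by (intro L.product_nn_integral_prod) auto
    also have "\<dots> = (\<Prod>i\<in>I. emeasure std_gauss (A i))"
      using A by (intro prod.cong refl emeasure_density[symmetric]) auto
    finally show "emeasure (density (PiM I (\<lambda>_. lborel)) (\<lambda>z. \<Prod>i\<in>I. ennreal (std_normal_density (z i)))) (PiE I A)
        = (\<Prod>i\<in>I. emeasure std_gauss (A i))" .
  qed
qed

text \<open>Polar coordinates without angles: a ball of radius \<open>r\<close> has volume
  \<open>v * r ^ d\<close>, whose derivative is the density. The two measures are compared on half
  lines.\<close>

lemma distr_norm_lborel:
  assumes I: "finite I" "I \<noteq> {}"
  defines "v \<equiv> unit_ball_vol (real (card I))" and "d \<equiv> card I"
  shows "distr (PiM I (\<lambda>_. lborel)) borel (\<lambda>z. sqrt (\<Sum>i\<in>I. (z i)\<^sup>2))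
    = density lborel (\<lambda>r. ennreal (v * real d * (indicator {0<..} r * r ^ (d - 1))))"
    (is "?M = ?N")
proof (rule measure_eqI_generator_eq[where E = "range atMost" and \<Omega> = UNIV and A = "\<lambda>i. {..real i}"])
  have d: "d \<ge> 1" using I by (simp add: d_def Suc_le_eq card_gt_0_iff)
  have meas [measurable]: "(\<lambda>z. sqrt (\<Sum>i\<in>I. (z i)\<^sup>2)) \<in> borel_measurable (PiM I (\<lambda>_. lborel))"
    by measurable
  show "Int_stable (range (atMost :: real \<Rightarrow> _))"
    by (auto simp: Int_stable_def)
  show "sets ?M = sigma_sets UNIV (range atMost)" "sets ?N = sigma_sets UNIV (range atMost)"
    by (simp_all add: borel_eq_atMost)
  show "range (\<lambda>i. {..real i}) \<subseteq> range atMost" by auto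
  show "(\<Union>i. {..real i}) = UNIV" 
  proof -
    have "\<exists>i. x \<le> real i" for x by (rule real_arch_simple)
    then show ?thesis by auto
  qed
  have M: "emeasure ?M {..r} = emeasure (PiM I (\<lambda>_. lborel))
      ({f. sqrt (\<Sum>i\<in>I. (f i)\<^sup>2) \<le> r} \<inter> space (PiM I (\<lambda>_. lborel)))" for r
    by (subst emeasure_distr) (auto simp: vimage_def)
  have Mpos: "emeasure ?M {..r} = ennreal (v * r ^ d)" if "r > 0" for r
    unfolding M v_def d_def by (rule emeasure_cball_aux[OF I(1) that])
  \<comment> \<open>The ball volume formula is for positive radii; at 0 the mass is squeezed by
    shrinking balls.\<close>
  have M0: "emeasure ?M {..r} = 0" if r: "r \<le> 0" for r
  proof -
    have "(\<lambda>j. ennreal (v * (1 / real (Suc j)) ^ d)) \<longlonglongrightarrow> ennreal (v * 0 ^ d)"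
      by (intro tendsto_ennrealI tendsto_intros LIMSEQ_Suc[OF lim_1_over_n])
    then have lim: "(\<lambda>j. ennreal (v * (1 / real (Suc j)) ^ d)) \<longlonglongrightarrow> 0" using d by (simp add: power_0_left)
    have "emeasure ?M {..r} \<le> ennreal (v * (1 / real (Suc j)) ^ d)" for j
    proof -
      have "emeasure ?M {..r} \<le> emeasure ?M {..1 / real (Suc j)}"
        using r by (intro emeasure_mono) (auto intro: order_trans)
      then show ?thesis using Mpos[of "1 / real (Suc j)"] by simp
    qed
    then have "emeasure ?M {..r} \<le> 0" by (intro LIMSEQ_le_const[OF lim]) auto
    then show ?thesis by simp
  qed
  have v: "v \<ge> 0" by (simp add: v_def)
  have N: "emeasure ?N {..r} = (\<integral>\<^sup>+t. ennreal (v * real d * (indicator {0<..} t * t ^ (d - 1))) * indicator {..r} t \<partial>lborel)" for r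
    by (intro emeasure_density) auto
  have N0: "emeasure ?N {..r} = 0" if "r \<le> 0" for r
    unfolding N using that by (subst nn_integral_0_iff_AE) (auto simp: indicator_def)
  have Npos: "emeasure ?N {..r} = ennreal (v * r ^ d)" if r: "r > 0" for r
  proof -
    have "emeasure ?N {..r} = (\<integral>\<^sup>+t. ennreal (v * real d * t ^ (d - 1)) * indicator {0..r} t \<partial>lborel)"
      unfolding N using AE_lborel_singleton[of 0]
      by (intro nn_integral_cong_AE) (auto simp: indicator_def elim!: eventually_mono)
    also have "\<dots> = ennreal (v * r ^ d - v * 0 ^ d)"
    proof (rule nn_integral_FTC_Icc[where F = "\<lambda>t. v * t ^ d"])
      fix x :: real assume x: "x \<in> {0..r}"
      show "((\<lambda>t. v * t ^ d) has_real_derivative v * real d * x ^ (d - 1)) (at x)"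
        by (auto intro!: derivative_eq_intros)
      show "0 \<le> v * real d * x ^ (d - 1)" using x v by simp
    qed (use r in auto)
    also have "v * r ^ d - v * 0 ^ d = v * r ^ d" using d by (simp add: power_0_left)
    finally show ?thesis .
  qed
  show "emeasure ?M X = emeasure ?N X" if XE: "X \<in> range atMost" for X
  proof -
    obtain r where X: "X = {..r}" using XE by auto
    show ?thesis
    proof (cases "r > 0")
      case True
      show ?thesis by (simp only: X Mpos[OF True] Npos[OF True])
    next
      case False
      then have "r \<le> 0" by simp
      show ?thesis by (simp only: X M0[OF \<open>r \<le> 0\<close>] N0[OF \<open>r \<le> 0\<close>])
    qed
  qed
  show "emeasure ?M {..real i} \<noteq> \<infinity>" for i
    by (cases "real i > 0") (simp_all add: Mpos M0)
qed auto

text \<open>The normalizing constant \<open>c * w\<close> is not evaluated: at \<open>l = 0\<close>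
  the integral is the total mass 1, which fixes it.\<close>

lemma nn_integral_exp_norm_gauss:
  assumes I: "finite I" "I \<noteq> {}"
  shows "(\<integral>\<^sup>+z. ennreal (exp (l * sqrt (\<Sum>i\<in>I. (z i)\<^sup>2))) \<partial>gauss I)
    = ennreal (half_moment (card I - 1) l / half_moment (card I - 1) 0)"
proof -
  define c where "c = (1 / sqrt (2 * pi)) ^ card I"
  define w where "w = unit_ball_vol (real (card I)) * real (card I)"
  have c: "c \<ge> 0" and w: "w \<ge> 0" by (simp_all add: c_def w_def)
  have meas [measurable]: "(\<lambda>z. sqrt (\<Sum>i\<in>I. (z i)\<^sup>2)) \<in> borel_measurable (PiM I (\<lambda>_. lborel))"
    by measurable
  have key: "(\<integral>\<^sup>+z. ennreal (exp (l * sqrt (\<Sum>i\<in>I. (z i)\<^sup>2))) \<partial>gauss I) = ennreal (c * w * half_moment (card I - 1) l)" for l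
  proof -
    have "(\<integral>\<^sup>+z. ennreal (exp (l * sqrt (\<Sum>i\<in>I. (z i)\<^sup>2))) \<partial>gauss I)
        = (\<integral>\<^sup>+z. ennreal (c * exp (- (\<Sum>i\<in>I. (z i)\<^sup>2) / 2)) * ennreal (exp (l * sqrt (\<Sum>i\<in>I. (z i)\<^sup>2))) \<partial>PiM I (\<lambda>_. lborel))"
      unfolding gauss_eq_density[OF I(1)] c_def by (rule nn_integral_density) measurable
    also have "\<dots> = (\<integral>\<^sup>+z. ennreal (c * exp (- (sqrt (\<Sum>i\<in>I. (z i)\<^sup>2))\<^sup>2 / 2 + l * sqrt (\<Sum>i\<in>I. (z i)\<^sup>2))) \<partial>PiM I (\<lambda>_. lborel))"
    proof (intro nn_integral_cong)
      fix z :: "'a \<Rightarrow> real"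
      define t where "t = sqrt (\<Sum>i\<in>I. (z i)\<^sup>2)"
      have "(\<Sum>i\<in>I. (z i)\<^sup>2) = t\<^sup>2" by (simp add: t_def sum_nonneg)
      then have "exp (- (\<Sum>i\<in>I. (z i)\<^sup>2) / 2) * exp (l * t) = exp (- t\<^sup>2 / 2 + l * t)"
        by (simp only: mult_exp_exp)
      then show "ennreal (c * exp (- (\<Sum>i\<in>I. (z i)\<^sup>2) / 2)) * ennreal (exp (l * sqrt (\<Sum>i\<in>I. (z i)\<^sup>2)))
          = ennreal (c * exp (- (sqrt (\<Sum>i\<in>I. (z i)\<^sup>2))\<^sup>2 / 2 + l * sqrt (\<Sum>i\<in>I. (z i)\<^sup>2)))"
        using c by (simp only: t_def[symmetric] mult.assoc ennreal_mult''[symmetric] exp_ge_zero)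
    qed
    also have "\<dots> = (\<integral>\<^sup>+r. ennreal (c * exp (- r\<^sup>2 / 2 + l * r)) \<partial>distr (PiM I (\<lambda>_. lborel)) borel (\<lambda>z. sqrt (\<Sum>i\<in>I. (z i)\<^sup>2)))"
      by (subst nn_integral_distr) auto
    also have "\<dots> = (\<integral>\<^sup>+r. ennreal (w * (indicator {0<..} r * r ^ (card I - 1))) * ennreal (c * exp (- r\<^sup>2 / 2 + l * r)) \<partial>lborel)"
      unfolding distr_norm_lborel[OF I] w_def by (rule nn_integral_density) measurable
    also have "\<dots> = (\<integral>\<^sup>+r. ennreal (c * w * (indicator {0<..} r * (r ^ (card I - 1) * exp (- r\<^sup>2 / 2 + l * r)))) \<partial>lborel)"
      using c w by (intro nn_integral_cong) (auto simp: indicator_def ennreal_mult'[symmetric] mult_ac)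
    also have "\<dots> = ennreal (\<integral>r. c * w * (indicator {0<..} r * (r ^ (card I - 1) * exp (- r\<^sup>2 / 2 + l * r))) \<partial>lborel)"
      using c w by (intro nn_integral_eq_integral integrable_mult_right integrable_half_moment)
        (auto simp: indicator_def)
    also have "\<dots> = ennreal (c * w * half_moment (card I - 1) l)" by (simp add: half_moment_def)
    finally show ?thesis .
  qed
  have "ennreal (c * w * half_moment (card I - 1) 0) = 1"
    using key[of 0] prob_space.emeasure_space_1[OF prob_space_gauss[of I]] by simp
  then have "c * w * half_moment (card I - 1) 0 = 1"
    using ennreal_eq_1 by blast
  then have "c * w = 1 / half_moment (card I - 1) 0"
    using half_moment_pos[of "card I - 1" 0] by (simp add: field_simps)
  then show ?thesis using key[of l] by simp
qed

lemma nn_integral_exp_norm_gauss_le: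
  assumes "finite I" "I \<noteq> {}"
  shows "(\<integral>\<^sup>+z. ennreal (exp (l * sqrt (\<Sum>i\<in>I. (z i)\<^sup>2))) \<partial>gauss I)
    \<le> ennreal (exp (l * chi_mean (card I) + l\<^sup>2 / 2))"
proof -
  have "card I \<ge> 1" using assms by (simp add: Suc_le_eq card_gt_0_iff)
  then show ?thesis
    unfolding nn_integral_exp_norm_gauss[OF assms]
    using half_moment_mgf_bound[of "card I - 1" l] half_moment_pos[of "card I - 1" 0]
    by (intro ennreal_leI) (simp add: divide_le_eq mult_ac)
qed

section \<open>Extreme singular values of Gaussian matrices\<close>

context gordon_interpolation
begin

definition "nrm u z = sqrt (\<Sum>j<N. (\<Sum>i<n. A u i * z (i, j))\<^sup>2)" for z :: "nat \<times> nat \<Rightarrow> real"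

lemma S_bounds: "sqrt (\<Sum>l<N. (\<zeta> u l)\<^sup>2) \<le> S \<zeta> u" "S \<zeta> u \<le> e + sqrt (\<Sum>l<N. (\<zeta> u l)\<^sup>2)"
  using S_le by (auto simp: S_def)

lemma zeta_pi_half:
  "j < N \<Longrightarrow> zeta (pi / 2) z u j = (\<Sum>i<n. A u i * z (i, j))" "zeta (pi / 2) z u N = z (n, N)"
  by (simp_all add: zeta_def K_def lessThan_Suc_atMost[symmetric])

lemma zeta_zero:
  "j < N \<Longrightarrow> zeta 0 z u j = z (n, j)" "zeta 0 z u N = (\<Sum>i<n. B u i * z (i, N))"
  by (simp_all add: zeta_def K_def lessThan_Suc_atMost[symmetric])

lemma F_ge:
  assumes u: "u \<in> T"
  shows "exp (lam * rho \<zeta> u) \<le> F \<zeta>"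
proof -
  have "exp (q * rho \<zeta> u) \<le> Phi \<zeta>"
    unfolding Phi_def using u T by (intro member_le_sum) auto
  then have "exp (q * rho \<zeta> u) powr (lam / q) \<le> F \<zeta>"
    unfolding F_def using lam by (intro powr_mono2) auto
  then show ?thesis using q by (simp add: powr_def)
qed

text \<open>For negative \<open>lam\<close> the condition says that the norm is below \<tau>, so
  both tails are covered. Passing from the norm to \<open>S\<close> costs at most
  \<open>\<bar>lam\<bar> * e\<close> in the exponent.\<close>

lemma F_pi_half_ge:
  assumes u: "u \<in> T" and gt: "lam * nrm u z > lam * \<tau>"
  shows "exp (lam * \<tau> - \<bar>lam\<bar> * e) * exp (lam * z (n, N)) \<le> F (zeta (pi / 2) z)"
proof -
  let ?\<zeta> = "zeta (pi / 2) z"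
  have n: "sqrt (\<Sum>l<N. (?\<zeta> u l)\<^sup>2) = nrm u z" by (simp add: nrm_def zeta_pi_half)
  have "\<bar>S ?\<zeta> u - nrm u z\<bar> \<le> e" using S_bounds[of ?\<zeta> u] n by simp
  then have "\<bar>lam\<bar> * \<bar>S ?\<zeta> u - nrm u z\<bar> \<le> \<bar>lam\<bar> * e" by (intro mult_left_mono) auto
  then have "\<bar>lam * (S ?\<zeta> u - nrm u z)\<bar> \<le> \<bar>lam\<bar> * e" by (simp only: abs_mult)
  then have "lam * nrm u z - \<bar>lam\<bar> * e \<le> lam * S ?\<zeta> u"
    unfolding right_diff_distrib by linarith
  then have "lam * \<tau> - \<bar>lam\<bar> * e + lam * z (n, N) \<le> lam * rho ?\<zeta> u"
    using gt by (simp add: rho_def zeta_pi_half distrib_left)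
  then have "exp (lam * \<tau> - \<bar>lam\<bar> * e + lam * z (n, N)) \<le> exp (lam * rho ?\<zeta> u)" by simp
  also have "\<dots> \<le> F ?\<zeta>" by (rule F_ge[OF u])
  finally show ?thesis by (simp only: exp_add)
qed

text \<open>\<open>B u\<close> is a unit vector supported on the first \<open>k\<close> coordinates,
  so by Cauchy-Schwarz only \<open>k\<close> of the Gaussian variables in the last column enter;
  this is the origin of \<open>chi_mean k\<close>. The power of \<open>card T\<close> compares the
  power sum with its largest term.\<close>

lemma F_zero_le:
  assumes supp: "\<And>u i. u \<in> T \<Longrightarrow> k \<le> i \<Longrightarrow> i < n \<Longrightarrow> B u i = 0" and k: "k \<le> n"
  shows "F (zeta 0 z) \<le> real (card T) powr (lam / q) * exp (\<bar>lam\<bar> * e) *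
    (exp (lam * sqrt (\<Sum>a\<in>{n} \<times> {..<N}. (z a)\<^sup>2)) * exp (\<bar>lam\<bar> * sqrt (\<Sum>a\<in>{..<k} \<times> {N}. (z a)\<^sup>2)))"
proof -
  let ?\<zeta> = "zeta 0 z"
  define h g where "h = sqrt (\<Sum>a\<in>{n} \<times> {..<N}. (z a)\<^sup>2)" and "g = sqrt (\<Sum>a\<in>{..<k} \<times> {N}. (z a)\<^sup>2)"
  have h: "h = sqrt (\<Sum>j<N. (z (n, j))\<^sup>2)"
    using sum.cartesian_product[of "\<lambda>x j. (z (x, j))\<^sup>2" "{..<N}" "{n}"] by (simp add: h_def split_def)
  have g: "g = sqrt (\<Sum>i<k. (z (i, N))\<^sup>2)"
    using sum.cartesian_product[of "\<lambda>x j. (z (x, j))\<^sup>2" "{N}" "{..<k}"] by (simp add: g_def split_def)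
  define V where "V = \<bar>lam\<bar> * e + lam * h + \<bar>lam\<bar> * g"
  have rho: "lam * rho ?\<zeta> u \<le> V" if u: "u \<in> T" for u
  proof -
    have n: "sqrt (\<Sum>l<N. (?\<zeta> u l)\<^sup>2) = h" by (simp add: h zeta_zero)
    have "\<bar>S ?\<zeta> u - h\<bar> \<le> e" using S_bounds[of ?\<zeta> u] n by simp
    then have "\<bar>lam\<bar> * \<bar>S ?\<zeta> u - h\<bar> \<le> \<bar>lam\<bar> * e" by (intro mult_left_mono) auto
    then have "\<bar>lam * (S ?\<zeta> u - h)\<bar> \<le> \<bar>lam\<bar> * e" by (simp only: abs_mult)
    then have 1: "lam * S ?\<zeta> u \<le> \<bar>lam\<bar> * e + lam * h" unfolding right_diff_distrib by linarith
    have split: "(\<Sum>i<n. B u i * f i) = (\<Sum>i<k. B u i * f i)" for f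
      by (rule sum.mono_neutral_right) (use supp[OF u] k in auto)
    have "(\<Sum>i<k. (B u i)\<^sup>2) = 1"
      using gram[OF u u] unit[OF u] split[of "B u"] by (simp add: power2_eq_square)
    moreover have "\<bar>\<Sum>i<k. B u i * z (i, N)\<bar> \<le> sqrt (\<Sum>i<k. (B u i)\<^sup>2) * g"
      using Cauchy_Schwarz_ineq_sum[of "B u" "\<lambda>i. z (i, N)" "{..<k}"]
      by (simp add: g real_sqrt_mult[symmetric] real_le_rsqrt flip: real_sqrt_abs)
    ultimately have "\<bar>?\<zeta> u N\<bar> \<le> g" by (simp add: zeta_zero split)
    then have "\<bar>lam * ?\<zeta> u N\<bar> \<le> \<bar>lam\<bar> * g" unfolding abs_mult by (intro mult_left_mono) auto
    then show ?thesis using 1 unfolding V_def rho_def distrib_left by linarith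
  qed
  have ql: "q / lam > 0" using lam(1) by (auto simp: zero_less_divide_iff)
  have "Phi ?\<zeta> \<le> (\<Sum>u\<in>T. exp (q / lam * V))"
    unfolding Phi_def
  proof (intro sum_mono)
    fix u assume u: "u \<in> T"
    have "q * rho ?\<zeta> u = q / lam * (lam * rho ?\<zeta> u)" using ql by auto
    also have "\<dots> \<le> q / lam * V" using ql rho[OF u] by (intro mult_left_mono) auto
    finally show "exp (q * rho ?\<zeta> u) \<le> exp (q / lam * V)" by simp
  qed
  then have "F ?\<zeta> \<le> (real (card T) * exp (q / lam * V)) powr (lam / q)"
    unfolding F_def using lam Phi_pos[of ?\<zeta>] by (intro powr_mono2) auto
  also have "\<dots> = real (card T) powr (lam / q) * exp (q / lam * V) powr (lam / q)"
    by (rule powr_mult)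
  also have "exp (q / lam * V) powr (lam / q) = exp V"
  proof -
    have "lam / q * (q / lam * V) = V" using ql q by auto
    then show ?thesis by (simp add: powr_def del: times_divide_eq_left times_divide_eq_right)
  qed
  finally show ?thesis by (simp add: V_def h_def[symmetric] g_def[symmetric] exp_add mult_ac)
qed

text \<open>Markov's inequality at one end of the path and the chi bounds at the other. The corner
  variable puts \<open>exp (lam\<^sup>2 / 2)\<close> on the left, and each end pays
  \<open>\<bar>lam\<bar> * e\<close> for the smoothing.\<close>

lemma tail_bound_eq:
  assumes supp: "\<And>u i. u \<in> T \<Longrightarrow> k \<le> i \<Longrightarrow> i < n \<Longrightarrow> B u i = 0" and k: "1 \<le> k" "k \<le> n" and N: "1 \<le> N"
  defines "J \<equiv> {..<n} \<times> {..<N}"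
  shows "measure (gauss J) {z \<in> space (gauss J). \<exists>u\<in>T. lam * nrm u z > lam * \<tau>} * exp (lam * \<tau> + lam\<^sup>2 / 2)
    \<le> real (card T) powr (lam / q) * exp (2 * \<bar>lam\<bar> * e) * exp (lam * chi_mean N + \<bar>lam\<bar> * chi_mean k + lam\<^sup>2)"
proof -
  have em: "emeasure (gauss J) E' = ennreal (measure (gauss J) E')" for E'
    using prob_space.finite_measure[OF prob_space_gauss] by (rule finite_measure.emeasure_eq_measure)
  define E where "E = {z \<in> space (gauss J). \<exists>u\<in>T. lam * nrm u z > lam * \<tau>}"
  have nrm_meas: "nrm u \<in> borel_measurable (gauss J)" for u
  proof -
    have "(\<lambda>z. sqrt (\<Sum>j<N. (\<Sum>i<n. A u i * z (i, j))\<^sup>2)) \<in> borel_measurable (gauss J)"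
      by (intro measurable_compose[OF _ borel_measurable_sqrt] borel_measurable_sum borel_measurable_power borel_measurable_times
          borel_measurable_const measurable_component_singleton) (auto simp: J_def)
    then show ?thesis by (simp add: nrm_def[abs_def])
  qed
  have E: "E \<in> sets (gauss J)"
  proof -
    have "E = (\<Union>u\<in>T. {z \<in> space (gauss J). lam * \<tau> < lam * nrm u z})" by (auto simp: E_def)
    moreover have "{z \<in> space (gauss J). lam * \<tau> < lam * nrm u z} \<in> sets (gauss J)" for u
      by (intro borel_measurable_less borel_measurable_times borel_measurable_const nrm_meas)
    ultimately show ?thesis using T by auto
  qed
  have nrm_restrict: "nrm u (restrict z J) = nrm u z" for u z by (simp add: nrm_def J_def)
  define p where "p = (n, N)"
  let ?L1 = "{n} \<times> {..<N}" and ?L2 = "{..<k} \<times> {N}"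
  let ?h = "\<lambda>z. ennreal (exp (lam * sqrt (\<Sum>a\<in>?L1. (z a)\<^sup>2)))"
    and ?g = "\<lambda>z. ennreal (exp (\<bar>lam\<bar> * sqrt (\<Sum>a\<in>?L2. (z a)\<^sup>2)))"
  have single: "(\<integral>\<^sup>+z. ennreal (exp (lam * z p)) \<partial>gauss {p}) = ennreal (exp (lam\<^sup>2 / 2))"
  proof -
    have "(\<integral>\<^sup>+z. ennreal (exp (lam * z p)) \<partial>gauss {p}) = (\<integral>\<^sup>+x. ennreal (exp (lam * x)) \<partial>std_gauss)"
      by (rule gauss.product_nn_integral_singleton) simp
    also have "\<dots> = ennreal (\<integral>x. exp (lam * x) \<partial>std_gauss)"
      using has_bochner_integral_exp_std_gauss[of lam]
      by (intro nn_integral_eq_integral) (auto simp: has_bochner_integral_iff)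
    also have "(\<integral>x. exp (lam * x) \<partial>std_gauss) = exp (lam\<^sup>2 / 2)"
      using has_bochner_integral_exp_std_gauss[of lam] by (simp add: has_bochner_integral_iff)
    finally show ?thesis .
  qed
  have "ennreal (exp (lam * \<tau> - \<bar>lam\<bar> * e)) * (ennreal (measure (gauss J) E) * ennreal (exp (lam\<^sup>2 / 2)))
      = ennreal (exp (lam * \<tau> - \<bar>lam\<bar> * e)) * ((\<integral>\<^sup>+z. indicator E z \<partial>gauss J) * (\<integral>\<^sup>+z. ennreal (exp (lam * z p)) \<partial>gauss {p}))"
    using E by (simp add: single em)
  \<comment> \<open>The event involves only the block \<open>J\<close>, and the corner
    \<open>p\<close> lies outside it, so independence merges the two expectations.\<close>
  also have "\<dots> = ennreal (exp (lam * \<tau> - \<bar>lam\<bar> * e)) * (\<integral>\<^sup>+z. indicator E (restrict z J) * ennreal (exp (lam * restrict z {p} p)) \<partial>gauss I)"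
    using E by (subst nn_integral_gauss_factor) (auto simp: J_def p_def)
  also have "\<dots> = (\<integral>\<^sup>+z. ennreal (exp (lam * \<tau> - \<bar>lam\<bar> * e)) * (indicator E (restrict z J) * ennreal (exp (lam * restrict z {p} p))) \<partial>gauss I)"
  proof (rule nn_integral_cmult[symmetric])
    have [measurable]: "(\<lambda>z. restrict z J) \<in> measurable (gauss I) (gauss J)"
      by (rule measurable_restrict_subset) (auto simp: J_def)
    have "(\<lambda>z. z p) \<in> measurable (gauss I) std_gauss"
      by (rule measurable_component_singleton) (auto simp: p_def)
    then have [measurable]: "(\<lambda>z. z p) \<in> borel_measurable (gauss I)" by simp
    show "(\<lambda>z. indicator E (restrict z J) * ennreal (exp (lam * restrict z {p} p))) \<in> borel_measurable (gauss I)"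
      using E by simp
  qed
  also have "\<dots> \<le> (\<integral>\<^sup>+z. ennreal (F (zeta (pi / 2) z)) \<partial>gauss I)"
  proof (intro nn_integral_mono)
    fix z :: "nat \<times> nat \<Rightarrow> real"
    show "ennreal (exp (lam * \<tau> - \<bar>lam\<bar> * e)) * (indicator E (restrict z J) * ennreal (exp (lam * restrict z {p} p)))
        \<le> ennreal (F (zeta (pi / 2) z))"
    proof (cases "restrict z J \<in> E")
      case True
      then obtain u where "u \<in> T" "lam * nrm u z > lam * \<tau>" by (auto simp: E_def nrm_restrict)
      from F_pi_half_ge[OF this] True show ?thesis
        by (simp add: p_def ennreal_leI flip: ennreal_mult')
    qed simp
  qed
  also have "\<dots> = ennreal (\<integral>z. F (zeta (pi / 2) z) \<partial>gauss I)"
    using F_pos by (intro nn_integral_eq_integral int_F AE_I2 less_imp_le)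
  also have "\<dots> \<le> ennreal (\<integral>z. F (zeta 0 z) \<partial>gauss I)"
    by (intro ennreal_leI gordon_comparison)
  also have "\<dots> = (\<integral>\<^sup>+z. ennreal (F (zeta 0 z)) \<partial>gauss I)"
    using F_pos by (intro nn_integral_eq_integral[symmetric] int_F AE_I2 less_imp_le)
  also have "\<dots> \<le> (\<integral>\<^sup>+z. ennreal (real (card T) powr (lam / q) * exp (\<bar>lam\<bar> * e)) *
      (?h (restrict z ?L1) *
       ?g (restrict z ?L2)) \<partial>gauss I)"
  proof (intro nn_integral_mono)
    fix z :: "nat \<times> nat \<Rightarrow> real"
    have 1: "(\<Sum>a\<in>L. (restrict z L a)\<^sup>2) = (\<Sum>a\<in>L. (z a)\<^sup>2)" for L by simp
    have "F (zeta 0 z) \<le> real (card T) powr (lam / q) * exp (\<bar>lam\<bar> * e) *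
      (exp (lam * sqrt (\<Sum>a\<in>{n} \<times> {..<N}. (z a)\<^sup>2)) * exp (\<bar>lam\<bar> * sqrt (\<Sum>a\<in>{..<k} \<times> {N}. (z a)\<^sup>2)))"
      using F_zero_le[of k z] supp k(2) by blast
    then show "ennreal (F (zeta 0 z)) \<le> ennreal (real (card T) powr (lam / q) * exp (\<bar>lam\<bar> * e)) *
      (?h (restrict z ?L1) *
       ?g (restrict z ?L2))"
      unfolding 1 by (simp add: ennreal_leI flip: ennreal_mult')
  qed
  also have "\<dots> = ennreal (real (card T) powr (lam / q) * exp (\<bar>lam\<bar> * e)) *
     (\<integral>\<^sup>+z. (?h (restrict z ?L1) *
       ?g (restrict z ?L2)) \<partial>gauss I)"
  proof (rule nn_integral_cmult)
    have m: "(\<lambda>z. sqrt (\<Sum>a\<in>L. (restrict z L a)\<^sup>2)) \<in> borel_measurable (gauss I)" if "L \<subseteq> I" for L :: "(nat \<times> nat) set"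
    proof -
      have "(\<lambda>z. sqrt (\<Sum>a\<in>L. (z a)\<^sup>2)) \<in> borel_measurable (gauss I)"
        by (intro measurable_compose[OF _ borel_measurable_sqrt] borel_measurable_sum borel_measurable_power measurable_component_singleton)
          (use that in auto)
      then show ?thesis by simp
    qed
    have [measurable]: "(\<lambda>z. sqrt (\<Sum>a\<in>{n} \<times> {..<N}. (restrict z ({n} \<times> {..<N}) a)\<^sup>2)) \<in> borel_measurable (gauss I)"
      "(\<lambda>z. sqrt (\<Sum>a\<in>{..<k} \<times> {N}. (restrict z ({..<k} \<times> {N}) a)\<^sup>2)) \<in> borel_measurable (gauss I)"
    proof -
      have "{n} \<times> {..<N} \<subseteq> I" "{..<k} \<times> {N} \<subseteq> I" using k by auto
      from this[THEN m] show "(\<lambda>z. sqrt (\<Sum>a\<in>{n} \<times> {..<N}. (restrict z ({n} \<times> {..<N}) a)\<^sup>2)) \<in> borel_measurable (gauss I)"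
        "(\<lambda>z. sqrt (\<Sum>a\<in>{..<k} \<times> {N}. (restrict z ({..<k} \<times> {N}) a)\<^sup>2)) \<in> borel_measurable (gauss I)" by blast+
    qed
    show "(\<lambda>z. ?h (restrict z ?L1) *
       ?g (restrict z ?L2)) \<in> borel_measurable (gauss I)"
      by measurable
  qed
  also have "(\<integral>\<^sup>+z. (?h (restrict z ?L1) *
       ?g (restrict z ?L2)) \<partial>gauss I)
     = (\<integral>\<^sup>+z. ?h z \<partial>gauss ?L1) *
       (\<integral>\<^sup>+z. ?g z \<partial>gauss ?L2)"
  proof (rule nn_integral_gauss_factor)
    have "(\<lambda>z. ennreal (exp (c * sqrt (\<Sum>a\<in>L. (z a)\<^sup>2)))) \<in> borel_measurable (gauss L)" for c and L :: "(nat \<times> nat) set"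
      by measurable
    then show "(\<lambda>z. ennreal (exp (lam * sqrt (\<Sum>a\<in>{n} \<times> {..<N}. (z a)\<^sup>2)))) \<in> borel_measurable (gauss ({n} \<times> {..<N}))"
      "(\<lambda>z. ennreal (exp (\<bar>lam\<bar> * sqrt (\<Sum>a\<in>{..<k} \<times> {N}. (z a)\<^sup>2)))) \<in> borel_measurable (gauss ({..<k} \<times> {N}))"
      by blast+
  qed (use k in auto)
  also have "\<dots> \<le> ennreal (exp (lam * chi_mean N + lam\<^sup>2 / 2)) * ennreal (exp (\<bar>lam\<bar> * chi_mean k + \<bar>lam\<bar>\<^sup>2 / 2))"
    using nn_integral_exp_norm_gauss_le[of "{n} \<times> {..<N}" lam]
      nn_integral_exp_norm_gauss_le[of "{..<k} \<times> {N}" "\<bar>lam\<bar>"] k N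
    by (intro mult_mono) (auto simp: card_cartesian_product lessThan_empty_iff)
  finally have "ennreal (exp (lam * \<tau> - \<bar>lam\<bar> * e)) * (ennreal (measure (gauss J) E) * ennreal (exp (lam\<^sup>2 / 2)))
    \<le> ennreal (real (card T) powr (lam / q) * exp (\<bar>lam\<bar> * e)) *
      (ennreal (exp (lam * chi_mean N + lam\<^sup>2 / 2)) * ennreal (exp (\<bar>lam\<bar> * chi_mean k + \<bar>lam\<bar>\<^sup>2 / 2)))"
    by (simp add: mult_left_mono)
  then have le: "exp (lam * \<tau> - \<bar>lam\<bar> * e) * (measure (gauss J) E * exp (lam\<^sup>2 / 2))
    \<le> real (card T) powr (lam / q) * exp (\<bar>lam\<bar> * e) *
      (exp (lam * chi_mean N + lam\<^sup>2 / 2) * exp (\<bar>lam\<bar> * chi_mean k + \<bar>lam\<bar>\<^sup>2 / 2))"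
    by (simp add: ennreal_mult'[symmetric] ennreal_mult''[symmetric])
  have "measure (gauss J) E * exp (lam * \<tau> + lam\<^sup>2 / 2)
      = exp (\<bar>lam\<bar> * e) * (exp (lam * \<tau> - \<bar>lam\<bar> * e) * (measure (gauss J) E * exp (lam\<^sup>2 / 2)))"
    by (simp add: exp_add exp_diff)
  also have "\<dots> \<le> exp (\<bar>lam\<bar> * e) * (real (card T) powr (lam / q) * exp (\<bar>lam\<bar> * e) *
      (exp (lam * chi_mean N + lam\<^sup>2 / 2) * exp (\<bar>lam\<bar> * chi_mean k + \<bar>lam\<bar>\<^sup>2 / 2)))"
    by (intro mult_left_mono le) auto
  also have "\<dots> = real (card T) powr (lam / q) * (exp (\<bar>lam\<bar> * e) * exp (\<bar>lam\<bar> * e)) *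
      (exp (lam * chi_mean N + lam\<^sup>2 / 2) * exp (\<bar>lam\<bar> * chi_mean k + \<bar>lam\<bar>\<^sup>2 / 2))"
    by (simp only: mult_ac)
  also have "exp (\<bar>lam\<bar> * e) * exp (\<bar>lam\<bar> * e) = exp (2 * \<bar>lam\<bar> * e)" by (simp add: mult_exp_exp)
  also have "exp (lam * chi_mean N + lam\<^sup>2 / 2) * exp (\<bar>lam\<bar> * chi_mean k + \<bar>lam\<bar>\<^sup>2 / 2)
      = exp (lam * chi_mean N + \<bar>lam\<bar> * chi_mean k + lam\<^sup>2)" by (simp add: mult_exp_exp algebra_simps)
  finally show ?thesis by (simp add: E_def)
qed

end

definition row_norm :: "nat \<Rightarrow> nat \<Rightarrow> (nat \<Rightarrow> real) \<Rightarrow> (nat \<times> nat \<Rightarrow> real) \<Rightarrow> real" where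
  "row_norm n N a z = sqrt (\<Sum>j<N. (\<Sum>i<n. a i * z (i, j))\<^sup>2)"

text \<open>Taking \<open>e = 1 / (j + 1)\<close> and \<open>q = lam * (j + 1)\<close> and letting
  \<open>j\<close> grow removes the smoothing and the power of \<open>card T\<close>. The resulting
  bound is uniform in \<open>T\<close>.\<close>

lemma gauss_tail_bound:
  fixes A B :: "'u \<Rightarrow> nat \<Rightarrow> real"
  assumes T: "finite T" "T \<noteq> {}"
    and unit: "\<And>u. u \<in> T \<Longrightarrow> (\<Sum>i<n. A u i * A u i) = 1"
    and gram: "\<And>u v. u \<in> T \<Longrightarrow> v \<in> T \<Longrightarrow> (\<Sum>i<n. B u i * B v i) = (\<Sum>i<n. A u i * A v i)"
    and supp: "\<And>u i. u \<in> T \<Longrightarrow> k \<le> i \<Longrightarrow> i < n \<Longrightarrow> B u i = 0"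
    and k: "1 \<le> k" "k \<le> n" and N: "1 \<le> N" and lam: "lam \<noteq> 0"
  defines "J \<equiv> {..<n} \<times> {..<N}"
  shows "measure (gauss J) {z \<in> space (gauss J). \<exists>u\<in>T. lam * row_norm n N (A u) z > lam * \<tau>}
    \<le> exp (lam * (chi_mean N - \<tau>) + \<bar>lam\<bar> * chi_mean k + lam\<^sup>2 / 2)"
proof -
  define P where "P = measure (gauss J) {z \<in> space (gauss J). \<exists>u\<in>T. lam * row_norm n N (A u) z > lam * \<tau>}"
  define Y where "Y = exp (lam * chi_mean N + \<bar>lam\<bar> * chi_mean k + lam\<^sup>2)"
  have "P * exp (lam * \<tau> + lam\<^sup>2 / 2)
      \<le> real (card T) powr (1 / real (Suc j)) * exp (2 * \<bar>lam\<bar> * (1 / real (Suc j))) * Y" for j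
  proof -
    have div: "lam / (lam * real (Suc j)) = 1 / real (Suc j)" using lam by simp
    interpret gordon_interpolation T A B n N "1 / real (Suc j)" "lam * real (Suc j)" lam
    proof unfold_locales
      show "lam * real (Suc j) \<noteq> 0" using lam by simp
      show "0 < lam / (lam * real (Suc j))" "lam / (lam * real (Suc j)) \<le> 1" unfolding div by simp_all
    qed (use T unit gram in auto)
    show ?thesis
      using tail_bound_eq[OF supp k N, of \<tau>] unfolding div
      by (simp add: P_def Y_def J_def nrm_def row_norm_def)
  qed
  moreover have "(\<lambda>j. real (card T) powr (1 / real (Suc j)) * exp (2 * \<bar>lam\<bar> * (1 / real (Suc j))) * Y)
      \<longlonglongrightarrow> real (card T) powr 0 * exp (2 * \<bar>lam\<bar> * 0) * Y"
    using T by (intro tendsto_intros LIMSEQ_Suc[OF lim_1_over_n]) auto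
  ultimately have "P * exp (lam * \<tau> + lam\<^sup>2 / 2) \<le> real (card T) powr 0 * exp (2 * \<bar>lam\<bar> * 0) * Y"
    by (intro LIMSEQ_le_const) auto
  also have "\<dots> = Y" using T by simp
  also have "Y = exp (lam * (chi_mean N - \<tau>) + \<bar>lam\<bar> * chi_mean k + lam\<^sup>2 / 2) * exp (lam * \<tau> + lam\<^sup>2 / 2)"
    by (simp add: Y_def mult_exp_exp algebra_simps)
  finally show ?thesis by (simp add: P_def)
qed

text \<open>The choice \<open>lam = - t\<close>, with the chi means replaced by square roots through
  \<open>chi_mean_diff\<close>. For \<open>t = 0\<close> the bound is 1.\<close>

lemma gauss_lower_tail:
  fixes A B :: "'u \<Rightarrow> nat \<Rightarrow> real"
  assumes T: "finite T"
    and unit: "\<And>u. u \<in> T \<Longrightarrow> (\<Sum>i<n. A u i * A u i) = 1"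
    and gram: "\<And>u v. u \<in> T \<Longrightarrow> v \<in> T \<Longrightarrow> (\<Sum>i<n. B u i * B v i) = (\<Sum>i<n. A u i * A v i)"
    and supp: "\<And>u i. u \<in> T \<Longrightarrow> k \<le> i \<Longrightarrow> i < n \<Longrightarrow> B u i = 0"
    and k: "1 \<le> k" "k \<le> n" "k \<le> N" and t: "t \<ge> 0"
    and \<tau>: "\<tau> \<le> sqrt (real N) - sqrt (real k) - t"
  defines "J \<equiv> {..<n} \<times> {..<N}"
  shows "measure (gauss J) {z \<in> space (gauss J). \<exists>u\<in>T. row_norm n N (A u) z < \<tau>} \<le> exp (- t\<^sup>2 / 2)"
proof (cases "t = 0 \<or> T = {}")
  case True
  show ?thesis using True prob_space.prob_le_1[OF prob_space_gauss] by auto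
next
  case False
  then have t: "t > 0" "T \<noteq> {}" using t by auto
  have "measure (gauss J) {z \<in> space (gauss J). \<exists>u\<in>T. - t * row_norm n N (A u) z > - t * \<tau>}
    \<le> exp (- t * (chi_mean N - \<tau>) + \<bar>- t\<bar> * chi_mean k + (- t)\<^sup>2 / 2)"
    unfolding J_def using T t unit gram supp k by (intro gauss_tail_bound[where B = B]) auto
  also have "\<dots> \<le> exp (- t\<^sup>2 / 2)"
  proof -
    have "t * \<tau> \<le> t * (chi_mean N - chi_mean k - t)"
      using \<tau> chi_mean_diff[OF k(1,3)] t by (intro mult_left_mono) auto
    then show ?thesis using t by (simp add: power2_eq_square algebra_simps)
  qed
  finally show ?thesis using t by simp
qed

text \<open>The choice \<open>lam = t\<close> and \<open>B = A\<close>, so that all \<open>n\<close>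
  coordinates count; here \<open>chi_mean_le_sqrt\<close> suffices.\<close>

lemma gauss_upper_tail:
  fixes A :: "'u \<Rightarrow> nat \<Rightarrow> real"
  assumes T: "finite T"
    and unit: "\<And>u. u \<in> T \<Longrightarrow> (\<Sum>i<n. A u i * A u i) = 1"
    and n: "1 \<le> n" "1 \<le> N" and t: "t > 0" and \<tau>: "\<tau> \<ge> sqrt (real N) + sqrt (real n) + t"
  defines "J \<equiv> {..<n} \<times> {..<N}"
  shows "measure (gauss J) {z \<in> space (gauss J). \<exists>u\<in>T. row_norm n N (A u) z > \<tau>} \<le> exp (- t\<^sup>2 / 2)"
proof (cases "T = {}")
  case False
  have "measure (gauss J) {z \<in> space (gauss J). \<exists>u\<in>T. t * row_norm n N (A u) z > t * \<tau>}
    \<le> exp (t * (chi_mean N - \<tau>) + \<bar>t\<bar> * chi_mean n + t\<^sup>2 / 2)"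
    unfolding J_def using T t unit False n
    by (intro gauss_tail_bound[where B = A]) auto
  also have "\<dots> \<le> exp (- t\<^sup>2 / 2)"
  proof -
    have "t * (chi_mean N + chi_mean n + t) \<le> t * \<tau>"
      using \<tau> chi_mean_le_sqrt[OF n(1)] chi_mean_le_sqrt[OF n(2)] t by (intro mult_left_mono) auto
    then show ?thesis using t by (simp add: power2_eq_square algebra_simps)
  qed
  finally show ?thesis using t by simp
qed simp

section \<open>From finitely many directions to all directions\<close>

definition rat_vecs :: "nat \<Rightarrow> real vec set" where
  "rat_vecs k = {x \<in> carrier_vec k. \<forall>i<k. x $ i \<in> \<rat>}"

text \<open>Normalized rational vectors: they have length exactly 1, as the comparison demands, and
  by scaling they inherit density from the rational vectors.\<close>

definition rat_units :: "nat \<Rightarrow> real vec set" where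
  "rat_units k = (\<lambda>x. (1 / sqrt (x \<bullet> x)) \<cdot>\<^sub>v x) ` (rat_vecs k - {0\<^sub>v k})"

lemma countable_rat_units: "countable (rat_units k)"
proof -
  have "rat_vecs k \<subseteq> vec k ` (PiE {..<k} (\<lambda>_. \<rat>))"
  proof
    fix x assume x: "x \<in> rat_vecs k"
    then have "x = vec k (restrict (($) x) {..<k})" by (auto simp: rat_vecs_def intro!: eq_vecI)
    moreover have "restrict (($) x) {..<k} \<in> PiE {..<k} (\<lambda>_. \<rat>)" using x by (auto simp: rat_vecs_def)
    ultimately show "x \<in> vec k ` (PiE {..<k} (\<lambda>_. \<rat>))" by blast
  qed
  moreover have "countable (PiE {..<k} (\<lambda>_. \<rat> :: real set))"
    by (intro countable_PiE countable_rat) auto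
  ultimately have "countable (rat_vecs k)" by (meson countable_image countable_subset)
  then show ?thesis by (simp add: rat_units_def)
qed

lemma rat_units_unit: "u \<in> rat_units k \<Longrightarrow> u \<in> carrier_vec k \<and> u \<bullet> u = 1"
proof -
  assume "u \<in> rat_units k"
  then obtain x where x: "x \<in> carrier_vec k" "x \<noteq> 0\<^sub>v k" "u = (1 / sqrt (x \<bullet> x)) \<cdot>\<^sub>v x"
    by (auto simp: rat_units_def rat_vecs_def)
  have "x \<bullet> x > 0" using x scalar_prod_self_pos by blast
  then show ?thesis using x by (simp add: field_simps)
qed

lemma rational_sequence: "\<exists>q. (\<forall>m. q m \<in> \<rat>) \<and> q \<longlonglongrightarrow> (y :: real)"
proof -
  have "\<forall>m. \<exists>q\<in>\<rat>. y < q \<and> q < y + 1 / real (Suc m)"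
    by (intro allI Rats_dense_in_real) simp
  then obtain q where q: "\<And>m. q m \<in> \<rat>" "\<And>m. y < q m" "\<And>m. q m < y + 1 / real (Suc m)" by metis
  have "(\<lambda>m. y + 1 / real (Suc m)) \<longlonglongrightarrow> y + 0"
    by (intro tendsto_intros LIMSEQ_Suc[OF lim_1_over_n])
  then have lim: "(\<lambda>m. y + 1 / real (Suc m)) \<longlonglongrightarrow> y" by simp
  have "q \<longlonglongrightarrow> y"
    using tendsto_const lim by (rule tendsto_sandwich[rotated 2]) (use q in \<open>auto intro!: always_eventually less_imp_le\<close>)
  with q show ?thesis by blast
qed

text \<open>Homogeneity passes from units to rational vectors, continuity from these to all vectors.
  With \<open>b\<close> equal to 1 or -1 the form covers upper and lower bounds.\<close>

lemma quadratic_ineq_of_rat_units: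
  assumes Z: "Z \<in> carrier_mat p k"
    and ineq: "\<And>u. u \<in> rat_units k \<Longrightarrow> a + b * ((Z *\<^sub>v u) \<bullet> (Z *\<^sub>v u)) \<le> 0"
    and x: "x \<in> carrier_vec k"
  shows "a * (x \<bullet> x) + b * ((Z *\<^sub>v x) \<bullet> (Z *\<^sub>v x)) \<le> (0 :: real)"
proof -
  have rat: "a * (x \<bullet> x) + b * ((Z *\<^sub>v x) \<bullet> (Z *\<^sub>v x)) \<le> 0" if x: "x \<in> rat_vecs k" for x
  proof (cases "x = 0\<^sub>v k")
    case True
    have "Z *\<^sub>v 0\<^sub>v k = 0\<^sub>v p" using Z by (auto intro!: eq_vecI)
    then show ?thesis using True by simp
  next
    case False
    have xc: "x \<in> carrier_vec k" using x by (simp add: rat_vecs_def)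
    have pos: "x \<bullet> x > 0" using scalar_prod_self_pos[OF xc False] .
    define u where "u = (1 / sqrt (x \<bullet> x)) \<cdot>\<^sub>v x"
    have "u \<in> rat_units k" using x False by (auto simp: u_def rat_units_def)
    from ineq[OF this] have "a + b * ((Z *\<^sub>v u) \<bullet> (Z *\<^sub>v u)) \<le> 0" .
    moreover have "(Z *\<^sub>v u) \<bullet> (Z *\<^sub>v u) = ((Z *\<^sub>v x) \<bullet> (Z *\<^sub>v x)) / (x \<bullet> x)"
    proof -
      have "Z *\<^sub>v u = (1 / sqrt (x \<bullet> x)) \<cdot>\<^sub>v (Z *\<^sub>v x)" unfolding u_def by (rule mult_mat_vec[OF Z xc])
      moreover have "Z *\<^sub>v x \<in> carrier_vec p" using Z xc by simp
      ultimately show ?thesis using pos by simp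
    qed
    ultimately have "(a + b * (((Z *\<^sub>v x) \<bullet> (Z *\<^sub>v x)) / (x \<bullet> x))) * (x \<bullet> x) \<le> 0"
      using pos by (simp add: mult_nonpos_nonneg)
    then show ?thesis using pos by (simp add: distrib_right)
  qed
  define f where "f y = a * (\<Sum>i<k. y i * y i)
      + b * (\<Sum>l<p. (\<Sum>i<k. Z $$ (l, i) * y i) * (\<Sum>i<k. Z $$ (l, i) * y i))" for y :: "nat \<Rightarrow> real"
  have f: "a * (v \<bullet> v) + b * ((Z *\<^sub>v v) \<bullet> (Z *\<^sub>v v)) = f (($) v)" if "v \<in> carrier_vec k" for v
    using that Z by (simp add: f_def scalar_prod_def atLeast0LessThan)
  obtain q where q: "\<And>i m. q i m \<in> \<rat>" "\<And>i. q i \<longlonglongrightarrow> x $ i"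
  proof -
    have "\<forall>i. \<exists>q. (\<forall>m. q m \<in> \<rat>) \<and> q \<longlonglongrightarrow> x $ i" by (intro allI rational_sequence)
    from choice[OF this] show ?thesis using that by blast
  qed
  have "(\<lambda>m. f (\<lambda>i. q i m)) \<longlonglongrightarrow> f (($) x)"
    unfolding f_def by (intro tendsto_intros q)
  moreover have "f (\<lambda>i. q i m) \<le> 0" for m
  proof -
    have "vec k (\<lambda>i. q i m) \<in> rat_vecs k" using q by (simp add: rat_vecs_def)
    from rat[OF this] have "f (($) (vec k (\<lambda>i. q i m))) \<le> 0" by (simp only: f[OF vec_carrier])
    then show ?thesis by (simp add: f_def)
  qed
  ultimately have "f (($) x) \<le> 0" by (intro LIMSEQ_le_const2) auto
  then show ?thesis by (simp add: f[OF x])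
qed

text \<open>An enumeration of \<open>C\<close> exhausts the event by increasing finite unions, all
  with the same bound \<open>b\<close>; continuity from below finishes.\<close>

lemma measure_countable_union_le:
  assumes M: "finite_measure M" and C: "countable C"
    and meas: "\<And>u. u \<in> C \<Longrightarrow> {z \<in> space M. Q u z} \<in> sets M"
    and bound: "\<And>T. finite T \<Longrightarrow> T \<subseteq> C \<Longrightarrow> measure M {z \<in> space M. \<exists>u\<in>T. Q u z} \<le> b"
  shows "{z \<in> space M. \<exists>u\<in>C. Q u z} \<in> sets M \<and> measure M {z \<in> space M. \<exists>u\<in>C. Q u z} \<le> b"
proof (cases "C = {}")
  case True
  then show ?thesis using bound[of "{}"] by simp
next
  case False
  define A where "A m = {z \<in> space M. \<exists>u\<in>from_nat_into C ` {..<m}. Q u z}" for m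
  have rC: "range (from_nat_into C) = C" using False C by (rule range_from_nat_into)
  have sub: "from_nat_into C ` {..<m} \<subseteq> C" for m using rC by blast
  have A: "A m \<in> sets M" for m
  proof -
    have "A m = (\<Union>u\<in>from_nat_into C ` {..<m}. {z \<in> space M. Q u z})" by (auto simp: A_def)
    then show ?thesis using meas[OF from_nat_into[OF False]] by auto
  qed
  have U: "{z \<in> space M. \<exists>u\<in>C. Q u z} = (\<Union>m. A m)"
    using rC by (auto simp: A_def) (metis imageE lessThan_iff lessI rangeE rC image_eqI)
  have "(\<lambda>m. measure M (A m)) \<longlonglongrightarrow> measure M (\<Union>m. A m)"
    using A by (intro finite_measure.finite_Lim_measure_incseq[OF M]) (auto simp: incseq_def A_def)
  moreover have "measure M (A m) \<le> b" for m
    unfolding A_def using sub by (intro bound) auto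
  ultimately have "measure M (\<Union>m. A m) \<le> b" by (intro LIMSEQ_le_const2) auto
  then show ?thesis using A unfolding U by auto
qed

text \<open>Independence with identical marginals makes the joint law of the entries a product. The
  restriction to \<open>J\<close> puts the family into the extensional space of
  \<open>PiM\<close>.\<close>

lemma std_gaussian_matrix_distr:
  assumes G: "std_gaussian_matrix P n N G" and n: "1 \<le> n" "1 \<le> N"
  defines "J \<equiv> {..<n} \<times> {..<N}"
  shows "(\<lambda>\<omega>. \<lambda>a\<in>J. G \<omega> $$ a) \<in> measurable P (gauss J)"
    "distr P (gauss J) (\<lambda>\<omega>. \<lambda>a\<in>J. G \<omega> $$ a) = gauss J"
proof -
  interpret P: prob_space P using G by (simp add: std_gaussian_matrix_def)
  have dist: "distributed P lborel (\<lambda>\<omega>. G \<omega> $$ a) std_normal_density" if "a \<in> J" for a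
    using G that by (auto simp: std_gaussian_matrix_def J_def)
  have rv: "(\<lambda>\<omega>. G \<omega> $$ a) \<in> borel_measurable P" if "a \<in> J" for a
    using distributed_measurable[OF dist[OF that]] by simp
  have marg: "distr P borel (\<lambda>\<omega>. G \<omega> $$ a) = std_gauss" if "a \<in> J" for a
  proof -
    have "distr P borel (\<lambda>\<omega>. G \<omega> $$ a) = distr P lborel (\<lambda>\<omega>. G \<omega> $$ a)" by (intro distr_cong) auto
    then show ?thesis using distributed_distr_eq_density[OF dist[OF that]] by simp
  qed
  have "(0, 0) \<in> J" using n by (simp add: J_def)
  then have J: "J \<noteq> {}" by blast
  have sets: "sets (gauss J) = sets (PiM J (\<lambda>_. borel))" by (intro sets_PiM_cong) auto
  have ind: "P.indep_vars (\<lambda>_. borel) (\<lambda>a \<omega>. G \<omega> $$ a) J"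
    using G by (simp add: std_gaussian_matrix_def J_def case_prod_beta')
  have "distr P (PiM J (\<lambda>_. borel)) (\<lambda>\<omega>. \<lambda>a\<in>J. G \<omega> $$ a) = PiM J (\<lambda>a. distr P borel (\<lambda>\<omega>. G \<omega> $$ a))"
    using P.indep_vars_iff_distr_eq_PiM'[OF J, of "\<lambda>a \<omega>. G \<omega> $$ a" "\<lambda>_. borel"] rv ind by simp
  also have "\<dots> = gauss J" by (intro PiM_cong marg) auto
  also have "distr P (PiM J (\<lambda>_. borel)) (\<lambda>\<omega>. \<lambda>a\<in>J. G \<omega> $$ a) = distr P (gauss J) (\<lambda>\<omega>. \<lambda>a\<in>J. G \<omega> $$ a)"
    using sets by (intro distr_cong) auto
  finally show "distr P (gauss J) (\<lambda>\<omega>. \<lambda>a\<in>J. G \<omega> $$ a) = gauss J" .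
  have "(\<lambda>\<omega>. \<lambda>a\<in>J. G \<omega> $$ a) \<in> measurable P (PiM J (\<lambda>_. borel))"
    using rv by (intro measurable_restrict) auto
  then show "(\<lambda>\<omega>. \<lambda>a\<in>J. G \<omega> $$ a) \<in> measurable P (gauss J)"
    using measurable_cong_sets[OF refl sets] by blast
qed

lemma row_norm_measurable:
  "row_norm n N a \<in> borel_measurable (gauss ({..<n} \<times> {..<N}))"
proof -
  have "(\<lambda>z. sqrt (\<Sum>j<N. (\<Sum>i<n. a i * z (i, j))\<^sup>2)) \<in> borel_measurable (gauss ({..<n} \<times> {..<N}))"
    by (intro measurable_compose[OF _ borel_measurable_sqrt] borel_measurable_sum borel_measurable_power
        borel_measurable_times borel_measurable_const measurable_component_singleton) auto
  then show ?thesis by (simp add: row_norm_def[abs_def])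
qed

lemma row_norm_matrix:
  assumes "G \<in> carrier_mat n N" "y \<in> carrier_vec n"
  shows "(row_norm n N (($) y) (\<lambda>a\<in>{..<n} \<times> {..<N}. G $$ a))\<^sup>2 = (G\<^sup>T *\<^sub>v y) \<bullet> (G\<^sup>T *\<^sub>v y)"
    "row_norm n N (($) y) z \<ge> 0"
proof -
  have "(G\<^sup>T *\<^sub>v y) $ j = (\<Sum>i<n. y $ i * (\<lambda>a\<in>{..<n} \<times> {..<N}. G $$ a) (i, j))" if "j < N" for j
    using that assms by (simp add: scalar_prod_def atLeast0LessThan mult.commute)
  then have "(G\<^sup>T *\<^sub>v y) \<bullet> (G\<^sup>T *\<^sub>v y)
      = (\<Sum>j<N. (\<Sum>i<n. y $ i * (\<lambda>a\<in>{..<n} \<times> {..<N}. G $$ a) (i, j))\<^sup>2)"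
    using assms by (simp add: scalar_prod_def[of _ "G\<^sup>T *\<^sub>v y"] atLeast0LessThan power2_eq_square
        del: index_mult_mat_vec)
  then show "(row_norm n N (($) y) (\<lambda>a\<in>{..<n} \<times> {..<N}. G $$ a))\<^sup>2 = (G\<^sup>T *\<^sub>v y) \<bullet> (G\<^sup>T *\<^sub>v y)"
    unfolding row_norm_def by (simp add: sum_nonneg)
qed (simp add: row_norm_def sum_nonneg)

text \<open>The exceptional set is pulled back from the space of entries. The factor
  \<open>s\<close> is 1 for the upper tail and -1 for the lower one.\<close>

lemma std_gaussian_matrix_event:
  assumes G: "std_gaussian_matrix P n N G" and n: "1 \<le> n" "1 \<le> N"
    and C: "countable C"
    and bound: "\<And>T. finite T \<Longrightarrow> T \<subseteq> C \<Longrightarrow>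
      measure (gauss ({..<n} \<times> {..<N})) {z \<in> space (gauss ({..<n} \<times> {..<N})). \<exists>u\<in>T. s * row_norm n N (A u) z > c} \<le> b"
  obtains E where "E \<in> sets P" "measure P E \<le> b"
    "\<And>\<omega> u. \<omega> \<in> space P - E \<Longrightarrow> u \<in> C \<Longrightarrow> s * row_norm n N (A u) (\<lambda>a\<in>{..<n} \<times> {..<N}. G \<omega> $$ a) \<le> c"
proof -
  define J where "J = {..<n} \<times> {..<N}"
  define X where "X = (\<lambda>\<omega>. \<lambda>a\<in>J. G \<omega> $$ a)"
  note D = std_gaussian_matrix_distr[OF G n, folded J_def, folded X_def]
  define B where "B = {z \<in> space (gauss J). \<exists>u\<in>C. s * row_norm n N (A u) z > c}"
  have B: "B \<in> sets (gauss J) \<and> measure (gauss J) B \<le> b"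
    unfolding B_def
  proof (rule measure_countable_union_le[OF _ C])
    show "finite_measure (gauss J)" using prob_space_gauss by (rule prob_space.finite_measure)
    show "{z \<in> space (gauss J). c < s * row_norm n N (A u) z} \<in> sets (gauss J)" for u
      using row_norm_measurable[of n N "A u", folded J_def]
      by (intro borel_measurable_less borel_measurable_times borel_measurable_const)
  qed (use bound in \<open>simp add: J_def\<close>)
  define E where "E = X -` B \<inter> space P"
  have "E \<in> sets P" unfolding E_def using D(1) B by (intro measurable_sets) auto
  moreover have "measure P E \<le> b"
  proof -
    have "measure (distr P (gauss J) X) B = measure P E"
      unfolding E_def using D(1) B by (intro measure_distr) auto
    then show ?thesis using B D(2) by simp
  qed
  moreover have "s * row_norm n N (A u) (\<lambda>a\<in>{..<n} \<times> {..<N}. G \<omega> $$ a) \<le> c" if "\<omega> \<in> space P - E" "u \<in> C" for \<omega> u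
  proof -
    have "X \<omega> \<in> space (gauss J)" using measurable_space[OF D(1)] that by simp
    moreover have "X \<omega> \<notin> B" using that by (auto simp: E_def)
    ultimately have "\<not> (s * row_norm n N (A u) (X \<omega>) > c)" using that(2) unfolding B_def by blast
    then show ?thesis by (simp add: X_def J_def not_less)
  qed
  ultimately show ?thesis by (rule that)
qed

lemma vec_index_sum_unit:
  assumes "u \<in> carrier_vec n" "v \<in> carrier_vec n"
  shows "u \<bullet> v = (\<Sum>i<n. u $ i * v $ i)"
  using assms by (simp add: scalar_prod_def atLeast0LessThan)

text \<open>\<open>A u\<close> is the image of \<open>u\<close> under the isometry \<open>W\<close>,
  and \<open>B u\<close> is \<open>u\<close> padded with zeros. Both have the Gram matrix of the
  vectors \<open>u\<close> themselves, so the comparison sees \<open>k\<close> coordinates although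
  \<open>G\<close> has \<open>n\<close> rows.\<close>

lemma gaussian_matrix_lower:
  assumes G: "std_gaussian_matrix P n N G" and W: "W \<in> carrier_mat n k" and WW: "W\<^sup>T * W = 1\<^sub>m k"
    and k: "1 \<le> k" "k \<le> n" "k \<le> N" and t: "t \<ge> 0" and \<tau>: "\<tau> \<le> sqrt (real N) - sqrt (real k) - t" "\<tau> \<ge> 0"
  obtains E where "E \<in> sets P" "measure P E \<le> exp (- t\<^sup>2 / 2)"
    "\<And>\<omega> x. \<omega> \<in> space P - E \<Longrightarrow> x \<in> carrier_vec k \<Longrightarrow>
      \<tau>\<^sup>2 * (x \<bullet> x) \<le> ((G \<omega>)\<^sup>T *\<^sub>v (W *\<^sub>v x)) \<bullet> ((G \<omega>)\<^sup>T *\<^sub>v (W *\<^sub>v x))"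
proof -
  define A where "A x = ($) (W *\<^sub>v x)" for x :: "real vec"
  define B where "B x i = (if i < k then x $ i else 0)" for x :: "real vec" and i
  have Agram: "(\<Sum>i<n. A u i * A v i) = u \<bullet> v" if "u \<in> rat_units k" "v \<in> rat_units k" for u v
  proof -
    have c: "u \<in> carrier_vec k" "v \<in> carrier_vec k" using that rat_units_unit by auto
    have "W *\<^sub>v u \<in> carrier_vec n" "W *\<^sub>v v \<in> carrier_vec n" using W c by auto
    then have "(\<Sum>i<n. A u i * A v i) = (W *\<^sub>v u) \<bullet> (W *\<^sub>v v)" unfolding A_def by (rule vec_index_sum_unit[symmetric])
    then show ?thesis using orthonormal_cols_isometry[OF W WW c] by simp
  qed
  have Bgram: "(\<Sum>i<n. B u i * B v i) = u \<bullet> v" if "u \<in> rat_units k" "v \<in> rat_units k" for u v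
  proof -
    have c: "u \<in> carrier_vec k" "v \<in> carrier_vec k" using that rat_units_unit by auto
    have "(\<Sum>i<n. B u i * B v i) = (\<Sum>i<k. B u i * B v i)"
      by (rule sum.mono_neutral_right) (use k in \<open>auto simp: B_def\<close>)
    also have "\<dots> = u \<bullet> v" using vec_index_sum_unit[OF c] by (simp add: B_def)
    finally show ?thesis .
  qed
  have bound: "measure (gauss ({..<n} \<times> {..<N})) {z \<in> space (gauss ({..<n} \<times> {..<N})). \<exists>u\<in>T. - 1 * row_norm n N (A u) z > - \<tau>}
      \<le> exp (- t\<^sup>2 / 2)" if T: "finite T" "T \<subseteq> rat_units k" for T
  proof -
    have "measure (gauss ({..<n} \<times> {..<N})) {z \<in> space (gauss ({..<n} \<times> {..<N})). \<exists>u\<in>T. row_norm n N (A u) z < \<tau>}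
      \<le> exp (- t\<^sup>2 / 2)"
    proof (rule gauss_lower_tail[where B = B, OF T(1)])
      show "(\<Sum>i<n. A u i * A u i) = 1" if "u \<in> T" for u
        using Agram[of u u] rat_units_unit[of u k] that T by auto
      show "(\<Sum>i<n. B u i * B v i) = (\<Sum>i<n. A u i * A v i)" if "u \<in> T" "v \<in> T" for u v
      proof -
        have "u \<in> rat_units k" "v \<in> rat_units k" using that T by auto
        then show ?thesis by (simp only: Agram Bgram)
      qed
    qed (use k t \<tau> in \<open>auto simp: B_def\<close>)
    then show ?thesis by simp
  qed
  have "1 \<le> n" "1 \<le> N" using k by auto
  from std_gaussian_matrix_event[OF G this countable_rat_units bound]
  obtain E where E: "E \<in> sets P" "measure P E \<le> exp (- t\<^sup>2 / 2)"
    "\<And>\<omega> u. \<omega> \<in> space P - E \<Longrightarrow> u \<in> rat_units k \<Longrightarrow>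
      - 1 * row_norm n N (A u) (\<lambda>a\<in>{..<n} \<times> {..<N}. G \<omega> $$ a) \<le> - \<tau>" by metis
  show ?thesis
  proof (rule that[OF E(1,2)])
    fix \<omega> and x :: "real vec" assume \<omega>: "\<omega> \<in> space P - E" and x: "x \<in> carrier_vec k"
    have Gc: "G \<omega> \<in> carrier_mat n N" using G \<omega> by (auto simp: std_gaussian_matrix_def)
    define Z where "Z = (G \<omega>)\<^sup>T * W"
    have Z: "Z \<in> carrier_mat N k" using Gc W by (simp add: Z_def)
    have Zx: "Z *\<^sub>v x = (G \<omega>)\<^sup>T *\<^sub>v (W *\<^sub>v x)" if "x \<in> carrier_vec k" for x
      unfolding Z_def by (rule assoc_mult_mat_vec[of _ N n _ k]) (use Gc W that in auto)
    have "\<tau>\<^sup>2 * (x \<bullet> x) + (- 1) * ((Z *\<^sub>v x) \<bullet> (Z *\<^sub>v x)) \<le> 0"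
    proof (rule quadratic_ineq_of_rat_units[OF Z _ x])
      fix u assume u: "u \<in> rat_units k"
      then have uc: "u \<in> carrier_vec k" using rat_units_unit by auto
      then have Wu: "W *\<^sub>v u \<in> carrier_vec n" using W by simp
      let ?r = "row_norm n N (($) (W *\<^sub>v u)) (\<lambda>a\<in>{..<n} \<times> {..<N}. G \<omega> $$ a)"
      have "\<tau> \<le> ?r" using E(3)[OF \<omega> u] by (simp add: A_def)
      then have "\<tau>\<^sup>2 \<le> ?r\<^sup>2" using \<tau>(2) by (intro power_mono)
      also have "\<dots> = (Z *\<^sub>v u) \<bullet> (Z *\<^sub>v u)" by (simp only: row_norm_matrix[OF Gc Wu] Zx[OF uc])
      finally show "\<tau>\<^sup>2 + (- 1) * ((Z *\<^sub>v u) \<bullet> (Z *\<^sub>v u)) \<le> 0" by simp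
    qed
    then show "\<tau>\<^sup>2 * (x \<bullet> x) \<le> ((G \<omega>)\<^sup>T *\<^sub>v (W *\<^sub>v x)) \<bullet> ((G \<omega>)\<^sup>T *\<^sub>v (W *\<^sub>v x))"
      by (simp add: Zx[OF x])
  qed
qed

text \<open>Expanding the squared length of \<open>b\<^sup>2 \<cdot>\<^sub>v z - G\<^sup>T *\<^sub>v
  (G *\<^sub>v z)\<close>, which is nonnegative, and bounding its last term by the hypothesis leaves
  the claim times \<open>b\<^sup>2\<close>.\<close>

lemma norm_bound_transpose:
  assumes G: "G \<in> carrier_mat n N"
    and le: "\<And>y. y \<in> carrier_vec n \<Longrightarrow> (G\<^sup>T *\<^sub>v y) \<bullet> (G\<^sup>T *\<^sub>v y) \<le> b\<^sup>2 * (y \<bullet> y)"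
    and z: "z \<in> carrier_vec N" and b: "b > 0"
  shows "(G *\<^sub>v z) \<bullet> (G *\<^sub>v z) \<le> b\<^sup>2 * (z \<bullet> (z :: real vec))"
proof -
  define y where "y = G *\<^sub>v z"
  define x where "x = G\<^sup>T *\<^sub>v y"
  have y: "y \<in> carrier_vec n" and x: "x \<in> carrier_vec N" using G z by (auto simp: y_def x_def)
  have zx: "z \<bullet> x = y \<bullet> y" using scalar_prod_mult_mat_vec[OF G z y] by (simp add: x_def y_def)
  have xz: "x \<bullet> z = y \<bullet> y" using zx comm_scalar_prod[OF x z] by simp
  have bz: "b\<^sup>2 \<cdot>\<^sub>v z \<in> carrier_vec N" using z by simp
  have "0 \<le> (b\<^sup>2 \<cdot>\<^sub>v z - x) \<bullet> (b\<^sup>2 \<cdot>\<^sub>v z - x)" by (rule scalar_prod_self_nonneg)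
  also have "\<dots> = b\<^sup>2 * (b\<^sup>2 * (z \<bullet> z)) - b\<^sup>2 * (z \<bullet> x) - (b\<^sup>2 * (x \<bullet> z) - x \<bullet> x)"
    using minus_scalar_prod_distrib[OF bz x, of "b\<^sup>2 \<cdot>\<^sub>v z - x"]
      scalar_prod_minus_distrib[OF bz bz x] scalar_prod_minus_distrib[OF x bz x] x z bz
    by simp
  also have "\<dots> \<le> b\<^sup>2 * (b\<^sup>2 * (z \<bullet> z)) - b\<^sup>2 * (y \<bullet> y)"
    using le[OF y] unfolding zx xz x_def[symmetric] by linarith
  finally have "b\<^sup>2 * (y \<bullet> y) \<le> b\<^sup>2 * (b\<^sup>2 * (z \<bullet> z))" by simp
  from mult_left_le_imp_le[OF this] show ?thesis using b by (simp add: y_def)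
qed

lemma gaussian_matrix_upper:
  assumes G: "std_gaussian_matrix P n N G" and n: "1 \<le> n" "1 \<le> N" and t: "t > 0"
    and b: "b \<ge> sqrt (real N) + sqrt (real n) + t"
  obtains E where "E \<in> sets P" "measure P E \<le> exp (- t\<^sup>2 / 2)"
    "\<And>\<omega> z. \<omega> \<in> space P - E \<Longrightarrow> z \<in> carrier_vec N \<Longrightarrow>
      (G \<omega> *\<^sub>v z) \<bullet> (G \<omega> *\<^sub>v z) \<le> b\<^sup>2 * (z \<bullet> z)"
proof -
  have b0: "b > 0"
    using b t real_sqrt_ge_zero[of "real N"] real_sqrt_ge_zero[of "real n"] by linarith
  have bound: "measure (gauss ({..<n} \<times> {..<N})) {z \<in> space (gauss ({..<n} \<times> {..<N})). \<exists>u\<in>T. 1 * row_norm n N (($) u) z > b}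
      \<le> exp (- t\<^sup>2 / 2)" if T: "finite T" "T \<subseteq> rat_units n" for T
  proof -
    have "(\<Sum>i<n. u $ i * u $ i) = 1" if "u \<in> T" for u
      using rat_units_unit[of u n] vec_index_sum_unit[of u n u] that T by auto
    from gauss_upper_tail[OF T(1) this n t b] show ?thesis by simp
  qed
  from std_gaussian_matrix_event[OF G n countable_rat_units bound]
  obtain E where E: "E \<in> sets P" "measure P E \<le> exp (- t\<^sup>2 / 2)"
    "\<And>\<omega> u. \<omega> \<in> space P - E \<Longrightarrow> u \<in> rat_units n \<Longrightarrow>
      1 * row_norm n N (($) u) (\<lambda>a\<in>{..<n} \<times> {..<N}. G \<omega> $$ a) \<le> b" by metis
  show ?thesis
  proof (rule that[OF E(1,2)])
    fix \<omega> and z :: "real vec" assume \<omega>: "\<omega> \<in> space P - E" and z: "z \<in> carrier_vec N"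
    have Gc: "G \<omega> \<in> carrier_mat n N" using G \<omega> by (auto simp: std_gaussian_matrix_def)
    show "(G \<omega> *\<^sub>v z) \<bullet> (G \<omega> *\<^sub>v z) \<le> b\<^sup>2 * (z \<bullet> z)"
    proof (rule norm_bound_transpose[OF Gc _ z b0])
      fix y :: "real vec" assume y: "y \<in> carrier_vec n"
      have "- (b\<^sup>2) * (y \<bullet> y) + 1 * (((G \<omega>)\<^sup>T *\<^sub>v y) \<bullet> ((G \<omega>)\<^sup>T *\<^sub>v y)) \<le> 0"
      proof (rule quadratic_ineq_of_rat_units[OF _ _ y])
        show "(G \<omega>)\<^sup>T \<in> carrier_mat N n" using Gc by simp
        fix u assume u: "u \<in> rat_units n"
        then have uc: "u \<in> carrier_vec n" using rat_units_unit by auto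
        let ?r = "row_norm n N (($) u) (\<lambda>a\<in>{..<n} \<times> {..<N}. G \<omega> $$ a)"
        have "?r \<le> b" using E(3)[OF \<omega> u] by simp
        then have "?r\<^sup>2 \<le> b\<^sup>2" using row_norm_matrix(2)[OF Gc uc] by (intro power_mono)
        then show "- (b\<^sup>2) + 1 * (((G \<omega>)\<^sup>T *\<^sub>v u) \<bullet> ((G \<omega>)\<^sup>T *\<^sub>v u)) \<le> 0"
          by (simp add: row_norm_matrix(1)[OF Gc uc])
      qed
      then show "((G \<omega>)\<^sup>T *\<^sub>v y) \<bullet> ((G \<omega>)\<^sup>T *\<^sub>v y) \<le> b\<^sup>2 * (y \<bullet> y)" by simp
    qed
  qed
qed

section \<open>The error bound for the random sketch\<close>

lemma finite_sing_val_support: "finite {i. sing_val A (i + 1) \<noteq> 0}"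
  by (rule finite_subset[of _ "{..<dim_col A}"])
    (auto simp: not_less[symmetric] sing_val_eq_0 intro: ccontr)

text \<open>The diagonal entries are nonnegative and decreasing already, so they are the singular
  values of the diagonal matrix.\<close>

lemma sing_val_sin_Theta:
  assumes "U1 \<in> carrier_mat m k" "U2 \<in> carrier_mat m k"
  shows "sing_val (sin_Theta U1 U2) (i + 1) = sing_val ((1\<^sub>m m - U1 * U1\<^sup>T) * U2) (i + 1)"
proof -
  have d: "dim_col U2 = k" "dim_row U1 = m" using assms by auto
  have "sing_val ((1\<^sub>m m - U1 * U1\<^sup>T) * U2) (i + 1) = 0" if "\<not> i < k"
    using that assms by (intro sing_val_eq_0) auto
  then show ?thesis
    unfolding sin_Theta_def d
    by (subst sing_val_mat_diag) (auto simp: sing_val_nonneg sing_val_antimono)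
qed

theorem theorem1:
  fixes M Uk Sk Vk Up Sp Vp :: "real mat"
    and m n k kt g gt :: nat
    and c \<theta> :: real
    and P :: "'w measure"
    and G Ug :: "'w \<Rightarrow> real mat"
    and \<Phi> :: "(nat \<Rightarrow> real) \<Rightarrow> real"
  assumes M: "M \<in> carrier_mat m n"
    and k: "1 \<le> k" "k \<le> min m n"
    and pos: "sing_val M k > 0"
    and svd: "svd_split k M Uk Sk Vk Up Sp Vp"
    and c: "0 < c" "c < 1"
    and \<theta>: "0 < \<theta>" "\<theta> < 1"
    and kt: "kt \<le> n"
      "real kt \<ge> (real k + sqrt (8 * real k * ln (1 / \<theta>)) + 2 * ln (1 / \<theta>)) / (1 - c)\<^sup>2"
    and g: "1 \<le> g"
    and gt: "gt = (if symmetric_mat M then g else 2 * g + 1)"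
    and G: "std_gaussian_matrix P n kt G"
    and Ug: "\<And>\<omega>. \<omega> \<in> space P \<Longrightarrow> rsvd_output k g M (G \<omega>) (Ug \<omega>)"
    and \<Phi>: "symmetric_gauge \<Phi>"
  shows
    "with_prob_at_least P (1 - \<theta> - 2 * exp (- real n / 2)) (\<lambda>\<omega>.
        ui_norm \<Phi> (sin_Theta (Ug \<omega>) Uk) = ui_norm \<Phi> ((1\<^sub>m m - Ug \<omega> * (Ug \<omega>)\<^sup>T) * Uk) \<and>
        ui_norm \<Phi> ((1\<^sub>m m - Ug \<omega> * (Ug \<omega>)\<^sup>T) * Uk)
          \<le> 3 * sqrt (real n) * ui_norm \<Phi> (Sp ^\<^sub>m gt) / (c * sqrt (real kt) * sing_val M k ^ gt))
     \<and> with_prob_at_least P (1 - \<theta> - 2 * exp (- real n / 2)) (\<lambda>\<omega>.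
        d2 (Ug \<omega>) Uk \<le> sqrt 2 * spectral_norm (sin_Theta (Ug \<omega>) Uk) \<and>
        sqrt 2 * spectral_norm (sin_Theta (Ug \<omega>) Uk)
          \<le> 3 * sqrt 2 * sqrt (real n) / (c * sqrt (real kt)) * (sing_val M (k + 1) / sing_val M k) ^ gt)"
proof -
  interpret P: prob_space P using G by (simp add: std_gaussian_matrix_def)
  define L where "L = ln (1 / \<theta>)"
  have L: "L > 0" using \<theta> by (simp add: L_def)
  \<comment> \<open>With this deviation \<open>exp (- t\<^sup>2 / 2) = \<theta>\<close>, and
    \<open>(sqrt k + t)\<^sup>2\<close> is the numerator of the bound on \<open>kt\<close>.\<close>
  define t where "t = sqrt (2 * L)"
  have t: "t > 0" using L by (simp add: t_def)
  have sq: "(sqrt (real k) + t)\<^sup>2 = real k + sqrt (8 * real k * L) + 2 * L"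
  proof -
    have "8 * real k * L = 2\<^sup>2 * (real k * (2 * L))" by simp
    then have "sqrt (8 * real k * L) = sqrt (2\<^sup>2 * (real k * (2 * L)))" by (simp only:)
    also have "\<dots> = 2 * (sqrt (real k) * t)" unfolding t_def
      by (simp only: real_sqrt_mult real_sqrt_abs abs_numeral)
    finally have e: "sqrt (8 * real k * L) = 2 * (sqrt (real k) * t)" .
    have "t\<^sup>2 = 2 * L" using L by (simp add: t_def)
    then show ?thesis unfolding e by (simp add: power2_sum)
  qed
  have c1: "(1 - c)\<^sup>2 > 0" using c by simp
  have "(sqrt (real k) + t)\<^sup>2 \<le> real kt * (1 - c)\<^sup>2"
    using kt(2) c1 unfolding L_def[symmetric] sq by (simp add: pos_divide_le_eq)
  then have "sqrt (real k) + t \<le> sqrt (real kt * (1 - c)\<^sup>2)" by (rule real_le_rsqrt)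
  then have st: "sqrt (real k) + t \<le> sqrt (real kt) * (1 - c)" using c by (simp add: real_sqrt_mult)
  then have cb: "c * sqrt (real kt) \<le> sqrt (real kt) - sqrt (real k) - t" by (simp add: algebra_simps)
  have "sqrt (real kt) * (1 - c) \<le> sqrt (real kt) * 1" using c by (intro mult_left_mono) auto
  then have "sqrt (real k) \<le> sqrt (real kt)" using st t by linarith
  then have kkt: "k \<le> kt" by simp
  have kn: "k \<le> n" "1 \<le> n" "1 \<le> kt" using k kt(1) kkt by auto
  define r where "r = min m n - k"
  obtain W W' where W: "two_blocks W W' n k r" and U: "two_blocks Uk Up m k r"
    and sketch: "\<And>G l. G \<in> carrier_mat n l \<Longrightarrow> rsvd_sketch g M G =
      Uk * mat_diag k (\<lambda>i. sing_val M (i + 1) ^ gt) * (G\<^sup>T * W)\<^sup>T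
      + Up * mat_diag r (\<lambda>i. sing_val M (k + i + 1) ^ gt) * (G\<^sup>T * W')\<^sup>T"
    using rsvd_sketch_svd_form[OF svd M g gt] unfolding r_def by blast
  interpret W: two_blocks W W' n k r by (rule W)
  interpret U: two_blocks Uk Up m k r by (rule U)
  \<comment> \<open>The two bounds fed into \<open>sin_theta_sketch_bound\<close>; their quotient
    \<open>b / s\<close> is the constant of the claim.\<close>
  define s b where "s = c * sqrt (real kt)" and "b = 3 * sqrt (real n)"
  have s: "s > 0" and b: "b > 0" using c kn by (auto simp: s_def b_def)
  obtain E1 where E1: "E1 \<in> sets P" "measure P E1 \<le> exp (- t\<^sup>2 / 2)"
    and low: "\<And>\<omega> x. \<omega> \<in> space P - E1 \<Longrightarrow> x \<in> carrier_vec k \<Longrightarrow>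
      s\<^sup>2 * (x \<bullet> x) \<le> ((G \<omega>)\<^sup>T *\<^sub>v (W *\<^sub>v x)) \<bullet> ((G \<omega>)\<^sup>T *\<^sub>v (W *\<^sub>v x))"
    using gaussian_matrix_lower[OF G W.U W.UU k(1) kn(1) kkt _ cb[folded s_def]] t s by (metis less_imp_le)
  \<comment> \<open>The deviation is taken as \<open>sqrt n\<close>; with \<open>kt \<le> n\<close>
    this is where the constant 3 arises.\<close>
  have bb: "b \<ge> sqrt (real kt) + sqrt (real n) + sqrt (real n)" using kt(1) by (simp add: b_def)
  have sn: "sqrt (real n) > 0" using kn by simp
  obtain E2 where E2: "E2 \<in> sets P" "measure P E2 \<le> exp (- (sqrt (real n))\<^sup>2 / 2)"
    and up: "\<And>\<omega> z. \<omega> \<in> space P - E2 \<Longrightarrow> z \<in> carrier_vec kt \<Longrightarrow>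
      (G \<omega> *\<^sub>v z) \<bullet> (G \<omega> *\<^sub>v z) \<le> b\<^sup>2 * (z \<bullet> z)"
    using gaussian_matrix_upper[OF G kn(2,3) sn bb] by metis
  \<comment> \<open>The event constrains \<open>G\<close> only, so it is measurable however
    \<open>Ug\<close> selects singular vectors, and it serves both assertions.\<close>
  define E where "E = space P - (E1 \<union> E2)"
  have E: "E \<in> sets P" using E1 E2 by (simp add: E_def)
  have "exp (- t\<^sup>2 / 2) = \<theta>" using L \<theta> by (simp add: t_def) (simp add: L_def ln_div)
  moreover have "measure P (E1 \<union> E2) \<le> measure P E1 + measure P E2"
    using E1 E2 by (intro measure_Un_le)
  moreover have "measure P E = 1 - measure P (E1 \<union> E2)"
    unfolding E_def using E1 E2 by (intro P.prob_compl) auto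
  \<comment> \<open>The upper tail fails with probability at most \<open>exp (- n / 2)\<close>; the
    claim allows twice that.\<close>
  moreover have "exp (- (sqrt (real n))\<^sup>2 / 2) \<le> 2 * exp (- real n / 2)" by simp
  ultimately have PE: "measure P E \<ge> 1 - \<theta> - 2 * exp (- real n / 2)"
    using E1(2) E2(2) by linarith
  define \<kappa> where "\<kappa> = b / (s * sing_val M k ^ gt)"
  have \<kappa>: "\<kappa> \<ge> 0" using b s pos by (simp add: \<kappa>_def)
  define d' where "d' i = sing_val M (k + i + 1) ^ gt" for i
  have d': "d' i \<ge> 0" "i \<le> j \<Longrightarrow> d' j \<le> d' i" for i j
    by (auto simp: d'_def sing_val_nonneg intro!: power_mono sing_val_antimono)
  have "Sp = mat_diag r (\<lambda>i. sing_val M (k + i + 1))" using svd_splitD(4)[OF svd M] by (simp add: r_def)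
  then have Sp: "Sp ^\<^sub>m gt = mat_diag r d'" by (simp only: pow_mat_diag d'_def[abs_def])
  have svSp: "sing_val (Sp ^\<^sub>m gt) (i + 1) = (if i < r then d' i else 0)" for i
    unfolding Sp by (rule sing_val_mat_diag) (use d' in auto)
  have main: "Ug \<omega> \<in> carrier_mat m k" "(Ug \<omega>)\<^sup>T * Ug \<omega> = 1\<^sub>m k"
    "sing_val ((1\<^sub>m m - Ug \<omega> * (Ug \<omega>)\<^sup>T) * Uk) (i + 1) \<le> (if i < r then d' i else 0) * \<kappa>"
    if \<omega>: "\<omega> \<in> E" for \<omega> i
  proof -
    have w: "\<omega> \<in> space P" "\<omega> \<in> space P - E1" "\<omega> \<in> space P - E2" using \<omega> by (auto simp: E_def)
    have Gc: "G \<omega> \<in> carrier_mat n kt" using G w(1) by (auto simp: std_gaussian_matrix_def)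
    define Z Z' where "Z = (G \<omega>)\<^sup>T * W" and "Z' = (G \<omega>)\<^sup>T * W'"
    have Z: "Z \<in> carrier_mat kt k" and Z': "Z' \<in> carrier_mat kt r" using Gc W.U W.U' by (auto simp: Z_def Z'_def)
    have lead: "leading_left_singular_vectors k (rsvd_sketch g M (G \<omega>)) (Ug \<omega>)"
      using Ug[OF w(1)] by (simp add: rsvd_output_def)
    have Y: "rsvd_sketch g M (G \<omega>) = Uk * mat_diag k (\<lambda>i. sing_val M (i + 1) ^ gt) * Z\<^sup>T + Up * mat_diag r d' * Z'\<^sup>T"
      unfolding Z_def Z'_def d'_def using sketch[OF Gc] .
    have dk: "sing_val M k ^ gt > 0" using pos by simp
    have d: "sing_val M k ^ gt \<le> sing_val M (i + 1) ^ gt" if "i < k" for i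
      using that pos by (intro power_mono sing_val_antimono) auto
    have Zs: "s\<^sup>2 * (x \<bullet> x) \<le> (Z *\<^sub>v x) \<bullet> (Z *\<^sub>v x)" if x: "x \<in> carrier_vec k" for x
    proof -
      have "Z *\<^sub>v x = (G \<omega>)\<^sup>T *\<^sub>v (W *\<^sub>v x)"
        unfolding Z_def by (rule assoc_mult_mat_vec[of _ kt n _ k]) (use Gc W.U x in auto)
      then show ?thesis using low[OF w(2) x] by simp
    qed
    have Zb: "(Z'\<^sup>T *\<^sub>v z) \<bullet> (Z'\<^sup>T *\<^sub>v z) \<le> b\<^sup>2 * (z \<bullet> z)" if z: "z \<in> carrier_vec kt" for z
    proof -
      have Gz: "G \<omega> *\<^sub>v z \<in> carrier_vec n" using Gc z by simp
      have "Z'\<^sup>T = W'\<^sup>T * G \<omega>" using transpose_mult[of "(G \<omega>)\<^sup>T" kt n W' r] Gc W.U' by (simp add: Z'_def)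
      moreover have "(W'\<^sup>T * G \<omega>) *\<^sub>v z = W'\<^sup>T *\<^sub>v (G \<omega> *\<^sub>v z)"
        by (rule assoc_mult_mat_vec[of _ r n _ kt]) (use Gc W.U' z in auto)
      ultimately have eq: "Z'\<^sup>T *\<^sub>v z = W'\<^sup>T *\<^sub>v (G \<omega> *\<^sub>v z)" by simp
      have "(W'\<^sup>T *\<^sub>v (G \<omega> *\<^sub>v z)) \<bullet> (W'\<^sup>T *\<^sub>v (G \<omega> *\<^sub>v z)) \<le> (G \<omega> *\<^sub>v z) \<bullet> (G \<omega> *\<^sub>v z)"
        using W.bessel[OF Gz] scalar_prod_self_nonneg[of "W\<^sup>T *\<^sub>v (G \<omega> *\<^sub>v z)"] by linarith
      also have "\<dots> \<le> b\<^sup>2 * (z \<bullet> z)" by (rule up[OF w(3) z])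
      finally show ?thesis by (simp only: eq)
    qed
    note * = sin_theta_sketch_bound[OF U Z Z' Y lead k(1) s dk less_imp_le[OF b] d d'(1) _ Zs Zb]
    show "Ug \<omega> \<in> carrier_mat m k" "(Ug \<omega>)\<^sup>T * Ug \<omega> = 1\<^sub>m k" using d'(2) by (auto intro: *)
    show "sing_val ((1\<^sub>m m - Ug \<omega> * (Ug \<omega>)\<^sup>T) * Uk) (i + 1) \<le> (if i < r then d' i else 0) * \<kappa>"
      unfolding \<kappa>_def by (rule *(3)) (use d'(2) in auto)
  qed
  have "with_prob_at_least P (1 - \<theta> - 2 * exp (- real n / 2)) (\<lambda>\<omega>.
        ui_norm \<Phi> (sin_Theta (Ug \<omega>) Uk) = ui_norm \<Phi> ((1\<^sub>m m - Ug \<omega> * (Ug \<omega>)\<^sup>T) * Uk) \<and>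
        ui_norm \<Phi> ((1\<^sub>m m - Ug \<omega> * (Ug \<omega>)\<^sup>T) * Uk)
          \<le> 3 * sqrt (real n) * ui_norm \<Phi> (Sp ^\<^sub>m gt) / (c * sqrt (real kt) * sing_val M k ^ gt))"
    unfolding with_prob_at_least_def
  proof (intro bexI[OF _ E] conjI PE ballI)
    fix \<omega> assume \<omega>: "\<omega> \<in> E"
    show "ui_norm \<Phi> (sin_Theta (Ug \<omega>) Uk) = ui_norm \<Phi> ((1\<^sub>m m - Ug \<omega> * (Ug \<omega>)\<^sup>T) * Uk)"
      unfolding ui_norm_def sing_val_sin_Theta[OF main(1)[OF \<omega>] U.U] ..
    have fin: "finite {i. sing_val (Sp ^\<^sub>m gt) (i + 1) \<noteq> 0}" by (rule finite_sing_val_support)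
    have "ui_norm \<Phi> ((1\<^sub>m m - Ug \<omega> * (Ug \<omega>)\<^sup>T) * Uk) \<le> \<Phi> (\<lambda>i. \<kappa> * sing_val (Sp ^\<^sub>m gt) (i + 1))"
      unfolding ui_norm_def
    proof (rule symmetric_gauge_mono[OF \<Phi>])
      show "finite {i. \<kappa> * sing_val (Sp ^\<^sub>m gt) (i + 1) \<noteq> 0}" by (rule finite_subset[OF _ fin]) auto
      show "sing_val ((1\<^sub>m m - Ug \<omega> * (Ug \<omega>)\<^sup>T) * Uk) (i + 1) \<le> \<kappa> * sing_val (Sp ^\<^sub>m gt) (i + 1)" for i
        using main(3)[OF \<omega>, of i] unfolding svSp by (simp only: mult.commute)
    qed (rule sing_val_nonneg)
    also have "\<dots> = \<kappa> * ui_norm \<Phi> (Sp ^\<^sub>m gt)"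
      using symmetric_gauge_scale[OF \<Phi> fin, of \<kappa>] \<kappa> by (simp add: ui_norm_def)
    also have "\<dots> = 3 * sqrt (real n) * ui_norm \<Phi> (Sp ^\<^sub>m gt) / (c * sqrt (real kt) * sing_val M k ^ gt)"
      by (simp add: \<kappa>_def b_def s_def)
    finally show "ui_norm \<Phi> ((1\<^sub>m m - Ug \<omega> * (Ug \<omega>)\<^sup>T) * Uk)
          \<le> 3 * sqrt (real n) * ui_norm \<Phi> (Sp ^\<^sub>m gt) / (c * sqrt (real kt) * sing_val M k ^ gt)" .
  qed
  moreover have "with_prob_at_least P (1 - \<theta> - 2 * exp (- real n / 2)) (\<lambda>\<omega>.
        d2 (Ug \<omega>) Uk \<le> sqrt 2 * spectral_norm (sin_Theta (Ug \<omega>) Uk) \<and>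
        sqrt 2 * spectral_norm (sin_Theta (Ug \<omega>) Uk)
          \<le> 3 * sqrt 2 * sqrt (real n) / (c * sqrt (real kt)) * (sing_val M (k + 1) / sing_val M k) ^ gt)"
    unfolding with_prob_at_least_def
  proof (intro bexI[OF _ E] conjI PE ballI)
    fix \<omega> assume \<omega>: "\<omega> \<in> E"
    have sp: "spectral_norm (sin_Theta (Ug \<omega>) Uk) = sing_val ((1\<^sub>m m - Ug \<omega> * (Ug \<omega>)\<^sup>T) * Uk) 1"
      using sing_val_sin_Theta[OF main(1)[OF \<omega>] U.U, of 0] by (simp add: spectral_norm_def)
    show "d2 (Ug \<omega>) Uk \<le> sqrt 2 * spectral_norm (sin_Theta (Ug \<omega>) Uk)"
      unfolding sp by (rule d2_le_sqrt2_sin[OF main(1)[OF \<omega>] main(2)[OF \<omega>] U.U U.UU])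
    have "sing_val ((1\<^sub>m m - Ug \<omega> * (Ug \<omega>)\<^sup>T) * Uk) 1 \<le> (if 0 < r then d' 0 else 0) * \<kappa>"
      using main(3)[OF \<omega>, of 0] by simp
    \<comment> \<open>For \<open>r = 0\<close> the left side is 0, and \<open>d' 0\<close> is still
      nonnegative.\<close>
    also have "\<dots> \<le> d' 0 * \<kappa>" using d'(1)[of 0] \<kappa> by (intro mult_right_mono) auto
    finally have "sqrt 2 * spectral_norm (sin_Theta (Ug \<omega>) Uk) \<le> sqrt 2 * (d' 0 * \<kappa>)"
      unfolding sp by (intro mult_left_mono) auto
    also have "\<dots> = 3 * sqrt 2 * sqrt (real n) / (c * sqrt (real kt)) * (sing_val M (k + 1) / sing_val M k) ^ gt"
      by (simp add: \<kappa>_def b_def s_def d'_def power_divide)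
    finally show "sqrt 2 * spectral_norm (sin_Theta (Ug \<omega>) Uk)
          \<le> 3 * sqrt 2 * sqrt (real n) / (c * sqrt (real kt)) * (sing_val M (k + 1) / sing_val M k) ^ gt" .
  qed
  ultimately show ?thesis by blast
qed

end
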